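(* Let $\lambda>0$, $\nu>0$, let $m\in\mathbb N_0$ and $N\in\mathbb N$ with $m\le N+1$, and let $u\in A^m_{\nu,\lambda}(\mathbb R^+)$. Then $$\|\pi_N^{-\nu,\lambda}u-u\|_{\omega^{-\nu}}\le c\,(2\lambda N)^{-\frac{\nu+m}{2}}\,\big\|{}_0D_x^{\nu+m,\lambda}u\big\|_{\omega^m},$$ and for any $k\in\mathbb N_0$ with $k\le m$, $$\big\|{}_0D_x^{\nu+k,\lambda}\big(\pi_N^{-\nu,\lambda}u-u\big)\big\|_{\omega^k}\le c\,(2\lambda N)^{\frac{k-m}{2}}\,\big\|{}_0D_x^{\nu+m,\lambda}u\big\|_{\omega^m},$$ where $c$ is a positive constant independent of $u$ and $\lambda$ with $c\approx1$ for large $N$ (that is, $c$ may depend on $N,\nu,m,k$, and for fixed $\nu,m,k$ it can be chosen with $c\to1$ as $N\to\infty$).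
   Context: $\mathbb N=\{1,2,\dots\}$, $\mathbb N_0=\mathbb N\cup\{0\}$, $\mathbb R^+=(0,\infty)$. For real $a$, $\omega^a(x)=x^a$ on $\mathbb R^+$; $(f,g)_{\omega}=\int_0^\infty f\,\bar g\,\omega\,dx$, $\|f\|_\omega^2=(f,f)_\omega$, and $L^2_\omega(\mathbb R^+)$ is the corresponding weighted $L^2$ space. Fractional operators on the half line: for $\mu>0$, ${}_0I_x^{\mu}u(x)=\frac1{\Gamma(\mu)}\int_0^x (x-y)^{\mu-1}u(y)\,dy$; for $\mu\in[j-1,j)$, $j\in\mathbb N$, the Riemann–Liouville derivative is ${}_0D_x^{\mu}u=\frac{d^j}{dx^j}\,{}_0I_x^{j-\mu}u$. The (left) tempered fractional derivative is ${}_0D_x^{\mu,\lambda}u(x)=e^{-\lambda x}\,{}_0D_x^{\mu}\{e^{\lambda x}u(x)\}$. The non-uniformly weighted Sobolev space is $$A^m_{\nu,\lambda}(\mathbb R^+)=\{u\in L^2_{\omega^{-\nu}}(\mathbb R^+):\ {}_0D_x^{\nu+k,\lambda}u\in L^2_{\omega^k}(\mathbb R^+),\ k=0,\dots,m\}.$$ With $\mathcal P_N$ the polynomials of degree at most $N$, $\mathcal F_N^{\nu,\lambda}(\mathbb R^+)=\{x^\nu e^{-\lambda x}p(x):p\in\mathcal P_N\}$. The orthogonal projection $\pi_N^{-\nu,\lambda}:L^2_{\omega^{-\nu}}(\mathbb R^+)\to\mathcal F_N^{\nu,\lambda}(\mathbb R^+)$ is defined by $(\pi_N^{-\nu,\lambda}u-u,\phi)_{\omega^{-\nu}}=0$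 for all $\phi\in\mathcal F_N^{\nu,\lambda}(\mathbb R^+)$.
   Formalization: Membership in A^m also requires that I^{j-ν}(e^{λx}u), set to 0 for x≤0, and its first j-1 derivatives be absolutely continuous across 0; automatic for ν≤1. For ν>1 the claim otherwise fails: u=x^{ν-1}e^{-λx} has zero right-hand side but is not in F_N. *)

theory Defs
  imports "HOL-Analysis.Analysis" "HOL-Computational_Algebra.Polynomial"
begin

text \<open>
  Functions on the half line \<open>(0, \<infinity>)\<close> are total functions \<^typ>\<open>real \<Rightarrow> complex\<close>; their values
  outside \<open>(0, \<infinity>)\<close> are irrelevant. The weight is \<open>\<omega>\<^sup>a(x) = x\<^sup>a\<close>.
\<close>

definition winner :: "real \<Rightarrow> (real \<Rightarrow> complex) \<Rightarrow> (real \<Rightarrow> complex) \<Rightarrow> complex" where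
  "winner a f g = (LINT x|lebesgue_on {0<..}. f x * cnj (g x) * of_real (x powr a))"

definition wnorm :: "real \<Rightarrow> (real \<Rightarrow> complex) \<Rightarrow> real" where
  "wnorm a f = sqrt (Re (winner a f f))"

definition weighted_L2 :: "real \<Rightarrow> (real \<Rightarrow> complex) set" where
  "weighted_L2 a = {f. f \<in> borel_measurable (lebesgue_on {0<..}) \<and>
     integrable (lebesgue_on {0<..}) (\<lambda>x. (cmod (f x))\<^sup>2 * x powr a)}"

definition RL_integral :: "real \<Rightarrow> (real \<Rightarrow> complex) \<Rightarrow> real \<Rightarrow> complex" where
  "RL_integral \<mu> u x =
     (1 / Gamma \<mu>) *\<^sub>R (LINT y|lebesgue_on {0<..<x}. (x - y) powr (\<mu> - 1) *\<^sub>R u y)"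

definition iter_deriv :: "nat \<Rightarrow> (real \<Rightarrow> complex) \<Rightarrow> real \<Rightarrow> complex" where
  "iter_deriv n f = ((\<lambda>g x. vector_derivative g (at x)) ^^ n) f"

text \<open>The \<open>j\<close> with \<open>\<mu> \<in> [j - 1, j)\<close>, for \<open>\<mu> \<ge> 0\<close>.\<close>

definition RL_order :: "real \<Rightarrow> nat" where
  "RL_order \<mu> = nat \<lfloor>\<mu>\<rfloor> + 1"

definition RL_deriv :: "real \<Rightarrow> (real \<Rightarrow> complex) \<Rightarrow> real \<Rightarrow> complex" where
  "RL_deriv \<mu> u = iter_deriv (RL_order \<mu>) (RL_integral (real (RL_order \<mu>) - \<mu>) u)"

definition tempered_deriv :: "real \<Rightarrow> real \<Rightarrow> (real \<Rightarrow> complex) \<Rightarrow> real \<Rightarrow> complex" where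
  "tempered_deriv \<mu> lam u x =
     of_real (exp (- lam * x)) * RL_deriv \<mu> (\<lambda>y. of_real (exp (lam * y)) * u y) x"

text \<open>
  The functions \<open>f, f', \<dots>, f\<^sup>(\<^sup>n\<^sup>-\<^sup>1\<^sup>)\<close> are locally absolutely continuous on the interval \<open>S\<close>: each
  is an indefinite Lebesgue integral of the next one. In particular the first \<open>n - 1\<close> derivatives
  exist everywhere in the interior of \<open>S\<close>, and the \<open>n\<close>-th one almost everywhere. Mere existence
  almost everywhere would be too weak, because of singular (Cantor type) functions.
\<close>

definition locally_AC_deriv_on :: "nat \<Rightarrow> real set \<Rightarrow> (real \<Rightarrow> complex) \<Rightarrow> bool" where
  "locally_AC_deriv_on n S f \<longleftrightarrow>
     (\<forall>i<n. \<forall>a\<in>S. \<forall>b\<in>S. a \<le> b \<longrightarrow>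
        iter_deriv (Suc i) f absolutely_integrable_on {a..b} \<and>
        integral {a..b} (iter_deriv (Suc i) f) = iter_deriv i f b - iter_deriv i f a)"

definition RL_differentiable_on :: "real \<Rightarrow> real set \<Rightarrow> (real \<Rightarrow> complex) \<Rightarrow> bool" where
  "RL_differentiable_on \<mu> S u \<longleftrightarrow>
     locally_AC_deriv_on (RL_order \<mu>) S (RL_integral (real (RL_order \<mu>) - \<mu>) u)"

text \<open>
  The derivatives \<open>d\<^sup>k/dx\<^sup>k\<close> of \<open>D\<^sup>\<nu>(e\<^sup>\<lambda>\<^sup>xu)\<close> are taken on the open half line, but \<open>D\<^sup>\<nu>\<close> itself is taken
  on the whole line, where the fractional integral vanishes for \<open>x \<le> 0\<close> (\<^const>\<open>RL_integral\<close> is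
  then an integral over the empty set): \<open>D\<^sup>\<nu>(e\<^sup>\<lambda>\<^sup>xu)\<close> has no singular part at the endpoint \<open>0\<close>. For
  \<open>\<nu> \<le> 1\<close> this follows from \<open>u \<in> L\<^sup>2(\<omega>\<^sup>-\<^sup>\<nu>)\<close> and \<open>D\<^sup>\<nu>(e\<^sup>\<lambda>\<^sup>xu) \<in> L\<^sup>2\<close> near \<open>0\<close>. For \<open>\<nu> > 1\<close> it
  excludes functions such as \<open>x\<^sup>\<nu>\<^sup>-\<^sup>1e\<^sup>-\<^sup>\<lambda>\<^sup>x \<in> L\<^sup>2(\<omega>\<^sup>-\<^sup>\<nu>)\<close>, all of whose tempered derivatives of orders
  \<open>\<nu>, \<nu> + 1, \<dots>\<close> vanish on the open half line, although they do not lie in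
  \<open>\<F>\<^sub>N\<close>; in the sense of distributions on the line their derivative of order \<open>\<nu>\<close> is a multiple of
  the Dirac distribution at \<open>0\<close>.
\<close>

definition A_space :: "nat \<Rightarrow> real \<Rightarrow> real \<Rightarrow> (real \<Rightarrow> complex) set" where
  "A_space m \<nu> lam =
     {u \<in> weighted_L2 (- \<nu>).
        RL_differentiable_on \<nu> UNIV (\<lambda>x. of_real (exp (lam * x)) * u x) \<and>
        (\<forall>k\<le>m. RL_differentiable_on (\<nu> + real k) {0<..} (\<lambda>x. of_real (exp (lam * x)) * u x) \<and>
               tempered_deriv (\<nu> + real k) lam u \<in> weighted_L2 (real k))}"

definition F_space :: "nat \<Rightarrow> real \<Rightarrow> real \<Rightarrow> (real \<Rightarrow> complex) set" where
  "F_space N \<nu> lam =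
     {\<lambda>x. of_real (x powr \<nu> * exp (- lam * x)) * poly p (of_real x) | p. degree p \<le> N}"

definition proj :: "nat \<Rightarrow> real \<Rightarrow> real \<Rightarrow> (real \<Rightarrow> complex) \<Rightarrow> real \<Rightarrow> complex" where
  "proj N \<nu> lam u =
     (THE w. w \<in> F_space N \<nu> lam \<and>
        (\<forall>\<phi>\<in>F_space N \<nu> lam. winner (- \<nu>) (\<lambda>x. w x - u x) \<phi> = 0))"

end

theory Submission
  imports Defs "HOL-Real_Asymp.Real_Asymp"
begin

text \<open>
  Write \<open>\<beta> = 2\<lambda>\<close> and \<open>v = e\<^sup>\<lambda>\<^sup>xu\<close>. The exponential factors turn every norm of the theorem into a norm of
  \<open>L\<^sup>2(x\<^sup>a e\<^sup>-\<^sup>\<beta>\<^sup>x dx)\<close> on the half line: the weight \<open>a = \<nu>\<close> for \<open>x\<^sup>-\<^sup>\<nu>v\<close>, the weight \<open>a = k\<close> for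
  \<open>\<gamma>\<^sub>k = D\<^sup>\<nu>\<^sup>+\<^sup>kv\<close>. The projection becomes the orthogonal projection onto the polynomials of degree
  at most \<open>N\<close> in the weight \<open>\<nu>\<close>.

  The functions \<open>x\<^sup>-\<^sup>\<nu>v, \<gamma>\<^sub>0, \<gamma>\<^sub>1, \<dots>, \<gamma>\<^sub>m\<close> are linked step by step: \<open>v\<close> is the fractional integral
  \<open>I\<^sup>\<nu>\<gamma>\<^sub>0\<close> almost everywhere, and \<open>\<gamma>\<^sub>k\<^sub>+\<^sub>1 = \<gamma>\<^sub>k'\<close> in the sense of absolutely continuous functions
  (\<open>RL_chainI\<close>). Each of the operators \<open>\<gamma> \<mapsto> x\<^sup>-\<^sup>\<nu>I\<^sup>\<nu>\<gamma>\<close> and \<open>\<gamma> \<mapsto> \<gamma>'\<close> maps polynomials to polynomials with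
  a fixed change of degree, and so does its adjoint between the two weighted spaces
  (\<open>ip_rl_scaled\<close>, \<open>ip_deriv\<close>). Hence each step commutes with the projections onto the polynomials of
  the matching degrees, and it maps the orthogonal polynomials of one weight to multiples of those
  of the other weight. These multiples can be read off from the leading coefficients alone; the explicit
  Laguerre polynomials and their norms never enter. On the orthogonal complement of the
  low degrees one obtains

    \<open>\<parallel>\<gamma>\<^sub>k - \<pi>\<gamma>\<^sub>k\<parallel>\<^sup>2 \<le> (\<beta>(N + 1 - k))\<^sup>-\<^sup>1 \<parallel>\<gamma>\<^sub>k\<^sub>+\<^sub>1 - \<pi>\<gamma>\<^sub>k\<^sub>+\<^sub>1\<parallel>\<^sup>2\<close>  (\<open>sqnorm_le_deriv\<close>),

    \<open>\<parallel>x\<^sup>-\<^sup>\<nu>(v - \<pi>v)\<parallel>\<^sup>2 \<le> \<beta>\<^sup>-\<^sup>\<nu> (N + 1)!/\<Gamma>(N + 2 + \<nu>) \<parallel>\<gamma>\<^sub>0 - \<pi>\<gamma>\<^sub>0\<parallel>\<^sup>2\<close>  (\<open>sqnorm_le_rl_scaled\<close>).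

  Chaining these inequalities up to \<open>k = m\<close>, where the projection error is at most \<open>\<parallel>\<gamma>\<^sub>m\<parallel>\<close>, gives the theorem;
  the products of the factors are asymptotically the stated powers of \<open>2\<lambda>N\<close>. Both inequalities use
  that an element of the weighted space is determined by its Fourier coefficients, that is, the
  density of the polynomials (\<open>approx_lag\<close>).

  Two points need care because the derivatives in the space are only absolutely continuous up to
  the last but one. Iterated derivatives are recovered almost everywhere from iterated integrals by
  the Lebesgue differentiation theorem (\<open>lebesgue_differentiation\<close>), and a Riemann-Liouville integral
  has the value \<open>0\<close> by convention where its integrand is not integrable; that this never occurs follows
  from \<open>v = I\<^sup>\<nu>\<gamma>\<^sub>0\<close> and the semigroup law \<open>I\<^sup>aI\<^sup>b = I\<^sup>a\<^sup>+\<^sup>b\<close> (\<open>integrable_rl_int_compose\<close>).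
\<close>

section \<open>Lebesgue differentiation on the line\<close>

text \<open>
  Henstock's lemma bounds the sum of the errors of finitely many disjoint tagged intervals that are fine for a gauge.
  A Vitali covering of the bad points by such intervals, each with an error above \<open>\<epsilon>\<close> times its length, therefore has
  small total length.
\<close>
lemma negligible_bad_averages:
  fixes h :: "real \<Rightarrow> complex"
  assumes h: "h integrable_on {l..u}" and \<epsilon>: "\<epsilon> > 0"
  shows "negligible {x \<in> {l<..<u}. \<forall>d>0. \<exists>a b. a < b \<and> a \<le> x \<and> x \<le> b \<and> b - a < d \<and>
           \<epsilon> * (b - a) < norm ((b - a) *\<^sub>R h x - integral {a..b} h)}"
    (is "negligible ?S")
  unfolding negligible_outer_le
proof (intro allI impI)
  fix e :: real assume e: "e > 0"
  have "h integrable_on cbox l u" "\<epsilon> * e > 0" using h \<epsilon> e by auto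
  then obtain \<gamma> where \<gamma>: "gauge \<gamma>" and fine: "\<And>p. p tagged_partial_division_of cbox l u \<Longrightarrow> \<gamma> fine p \<Longrightarrow>
      (\<Sum>(x, k)\<in>p. norm (measure lborel k *\<^sub>R h x - integral k h)) < \<epsilon> * e"
    by (rule Henstock_lemma) blast
  define I where "I = (\<lambda>(x::real, a, b). {a..b::real})"
  \<comment> \<open>The point \<open>x\<close> is the tag of the interval; the covering theorem needs the intervals as balls.\<close>
  define K where "K = {(x, a, b). a < b \<and> a \<le> x \<and> x \<le> b \<and> {a..b} \<subseteq> {l<..<u} \<inter> \<gamma> x \<and>
      \<epsilon> * (b - a) < norm ((b - a) *\<^sub>R h x - integral {a..b} h)}"
  define ctr where "ctr = (\<lambda>(x::real, a, b). (a + b) / 2 :: real)"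
  define rad where "rad = (\<lambda>(x::real, a, b). (b - a) / 2 :: real)"
  have cb: "cball (ctr i) (rad i) = I i" for i
    by (cases i) (auto simp: ctr_def rad_def I_def cball_def dist_real_def abs_le_iff field_simps)
  have pos: "0 < rad i" if "i \<in> K" for i using that by (auto simp: K_def rad_def)
  have cover: "\<exists>i. i \<in> K \<and> x \<in> cball (ctr i) (rad i) \<and> rad i < d" if x: "x \<in> ?S" and d: "d > 0" for x d
  proof -
    have "open ({l<..<u} \<inter> \<gamma> x)" "x \<in> {l<..<u} \<inter> \<gamma> x" using \<gamma> x by (auto simp: gauge_def)
    then obtain r where r: "r > 0" "ball x r \<subseteq> {l<..<u} \<inter> \<gamma> x" by (meson open_contains_ball)
    obtain a b where ab: "a < b" "a \<le> x" "x \<le> b" "b - a < min d r"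
        "\<epsilon> * (b - a) < norm ((b - a) *\<^sub>R h x - integral {a..b} h)"
      using x d r(1) by (auto dest!: spec[of _ "min d r"])
    have "{a..b} \<subseteq> ball x r" using ab by (auto simp: dist_real_def)
    then have "(x, a, b) \<in> K" using ab r(2) by (auto simp: K_def)
    then show ?thesis using ab d unfolding cb by (intro exI[of _ "(x, a, b)"]) (auto simp: I_def rad_def)
  qed
  obtain C where C: "countable C" "C \<subseteq> K" "pairwise (\<lambda>i j. disjnt (cball (ctr i) (rad i)) (cball (ctr j) (rad j))) C"
      and neg: "negligible (?S - (\<Union>i\<in>C. cball (ctr i) (rad i)))"
    by (rule Vitali_covering_theorem_cballs[of K rad ?S ctr]) (use pos cover in \<open>blast+\<close>)
  have le: "measure lebesgue (\<Union>i\<in>J. I i) \<le> e" if J: "J \<subseteq> C" "finite J" for J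
  proof -
    define p where "p = (\<lambda>i. (fst i, I i)) ` J"
    have JK: "fst i \<in> I i" "I i \<subseteq> cbox l u" "I i \<subseteq> \<gamma> (fst i)" "\<exists>a b. I i = cbox a b"
        "\<epsilon> * measure lborel (I i) \<le> norm (measure lborel (I i) *\<^sub>R h (fst i) - integral (I i) h)" if "i \<in> J" for i
    proof -
      obtain x a b where i: "i = (x, a, b)" by (cases i)
      then have "(x, a, b) \<in> K" using that J(1) C(2) by blast
      then have *: "a < b" "a \<le> x" "x \<le> b" "{a..b} \<subseteq> {l<..<u}" "{a..b} \<subseteq> \<gamma> x"
          "\<epsilon> * (b - a) < norm ((b - a) *\<^sub>R h x - integral {a..b} h)"
        unfolding K_def by auto
      have "{a..b} \<subseteq> cbox l u" using *(4) greaterThanLessThan_subseteq_atLeastAtMost_iff[of l u l u] by (auto simp: subset_iff)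
      then show "fst i \<in> I i" "I i \<subseteq> cbox l u" "I i \<subseteq> \<gamma> (fst i)" "\<exists>a b. I i = cbox a b"
        "\<epsilon> * measure lborel (I i) \<le> norm (measure lborel (I i) *\<^sub>R h (fst i) - integral (I i) h)"
        using * by (auto simp: i I_def intro!: exI[of _ a] exI[of _ b])
    qed
    have disj: "I i \<inter> I j = {}" if "i \<in> J" "j \<in> J" "i \<noteq> j" for i j
      using C(3) J(1) that unfolding pairwise_def cb disjnt_def by blast
    have inj: "inj_on (\<lambda>i. (fst i, I i)) J"
      using disj JK(1) by (fastforce intro!: inj_onI)
    have "p tagged_partial_division_of cbox l u"
      unfolding tagged_partial_division_of_def
    proof (intro conjI allI impI)
      show "finite p" using J(2) by (simp add: p_def)
      show "x \<in> k" "k \<subseteq> cbox l u" "\<exists>a b. k = cbox a b" if "(x, k) \<in> p" for x k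
      proof -
        from that obtain i where i: "i \<in> J" "x = fst i" "k = I i" unfolding p_def by blast
        show "x \<in> k" "k \<subseteq> cbox l u" "\<exists>a b. k = cbox a b" using JK(1,2,4)[OF i(1)] unfolding i(2,3) .
      qed
      fix x1 k1 x2 k2 assume "(x1, k1) \<in> p \<and> (x2, k2) \<in> p \<and> (x1, k1) \<noteq> (x2, k2)"
      then have "k1 \<inter> k2 = {}" using disj unfolding p_def by blast
      then show "interior k1 \<inter> interior k2 = {}" using interior_subset by blast
    qed
    moreover have "\<gamma> fine p" using JK(3) by (auto simp: fine_def p_def)
    ultimately have "(\<Sum>i\<in>J. norm (measure lborel (I i) *\<^sub>R h (fst i) - integral (I i) h)) < \<epsilon> * e"
      using fine[of p] unfolding p_def sum.reindex[OF inj] by simp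
    moreover have "(\<Sum>i\<in>J. \<epsilon> * measure lborel (I i)) \<le> (\<Sum>i\<in>J. norm (measure lborel (I i) *\<^sub>R h (fst i) - integral (I i) h))"
      by (rule sum_mono) (rule JK(5))
    ultimately have "\<epsilon> * (\<Sum>i\<in>J. measure lborel (I i)) \<le> \<epsilon> * e" by (simp add: sum_distrib_left)
    then have "(\<Sum>i\<in>J. measure lborel (I i)) \<le> e" using \<epsilon> by simp
    moreover have "measure lebesgue (\<Union>i\<in>J. I i) \<le> (\<Sum>i\<in>J. measure lebesgue (I i))"
      using J(2) by (intro measure_UNION_le) (auto simp: I_def split: prod.split)
    moreover have "measure lebesgue (I i) = measure lborel (I i)" for i by (cases i) (simp add: I_def)
    ultimately show ?thesis by simp
  qed
  define T where "T = (\<Union>i\<in>C. I i) \<union> (?S - (\<Union>i\<in>C. I i))"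
  have fm: "I i \<in> lmeasurable" for i by (cases i) (simp add: I_def)
  have UC: "(\<Union>i\<in>C. I i) \<in> lmeasurable" "measure lebesgue (\<Union>i\<in>C. I i) \<le> e"
    by (rule fmeasurable_UN_bound[OF C(1)] measure_UN_bound[OF C(1)]; use fm le in blast)+
  have neg': "negligible (?S - (\<Union>i\<in>C. I i))" using neg unfolding cb .
  have "T \<in> lmeasurable" unfolding T_def by (rule fmeasurable.Un[OF UC(1) negligible_imp_measurable[OF neg']])
  moreover have "measure lebesgue T = measure lebesgue (\<Union>i\<in>C. I i)"
    unfolding T_def by (rule measure_Un_null_set) (use neg' UC(1) in \<open>auto simp: negligible_iff_null_sets\<close>)
  ultimately show "\<exists>T. ?S \<subseteq> T \<and> T \<in> lmeasurable \<and> measure lebesgue T \<le> e"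
    using UC(2) by (intro exI[of _ T]) (auto simp: T_def)
qed

text \<open>
  Outside the bad sets for \<open>\<epsilon> = 1, 1/2, 1/3, \<dots>\<close> the difference quotients converge. Compact intervals with rational end points
  inside \<open>S\<close> reduce the statement to an interval on which \<open>h\<close> is integrable.
\<close>
lemma lebesgue_differentiation:
  fixes h F :: "real \<Rightarrow> complex"
  assumes S: "open S"
    and int: "\<And>a b. a \<le> b \<Longrightarrow> {a..b} \<subseteq> S \<Longrightarrow> h absolutely_integrable_on {a..b} \<and> integral {a..b} h = F b - F a"
  shows "AE x in lebesgue. x \<in> S \<longrightarrow> (F has_vector_derivative h x) (at x)"
proof -
  have local: "AE x in lebesgue. x \<in> {l<..<u} \<longrightarrow> (F has_vector_derivative h x) (at x)"
    if lu: "{l..u} \<subseteq> S" for l u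
  proof (cases "l \<le> u")
    case True
    have "h integrable_on {l..u}" using int[OF True lu] by (simp add: absolutely_integrable_on_def)
    note neg = negligible_bad_averages[OF this]
    define bad where "bad = (\<lambda>\<epsilon>. {x \<in> {l<..<u}. \<forall>d>0. \<exists>a b. a < b \<and> a \<le> x \<and> x \<le> b \<and> b - a < d \<and>
           \<epsilon> * (b - a) < norm ((b - a) *\<^sub>R h x - integral {a..b} h)})"
    have "bad (1 / real (Suc n)) \<in> null_sets lebesgue" for n
      using neg[of "1 / real (Suc n)"] unfolding bad_def negligible_iff_null_sets by simp
    then have "AE x in lebesgue. \<forall>n. x \<notin> bad (1 / real (Suc n))"
      unfolding AE_all_countable by (intro allI AE_not_in)
    then show ?thesis
    proof eventually_elim
      case (elim x)
      show ?case
      proof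
        assume x: "x \<in> {l<..<u}"
        show "(F has_vector_derivative h x) (at x)"
          unfolding has_vector_derivative_def has_derivative_within_alt
        proof (intro conjI allI impI)
          show "bounded_linear (\<lambda>y. y *\<^sub>R h x)" by (rule bounded_linear_scaleR_left)
          fix e :: real assume "e > 0"
          then obtain n where n: "1 / real (Suc n) < e" using nat_approx_posE by blast
          obtain d where d: "d > 0" "\<And>a b. a < b \<Longrightarrow> a \<le> x \<Longrightarrow> x \<le> b \<Longrightarrow> b - a < d \<Longrightarrow>
              norm ((b - a) *\<^sub>R h x - integral {a..b} h) \<le> 1 / real (Suc n) * (b - a)"
            using spec[OF elim, of n] x unfolding bad_def by (simp add: not_less) (meson not_less)
          define r where "r = min d (min (x - l) (u - x))"
          have main: "norm (F b - F a - (b - a) *\<^sub>R h x) \<le> e * (b - a)"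
            if "a < b" "a \<le> x" "x \<le> b" "b - a < r" for a b
          proof -
            have "{a..b} \<subseteq> S" using that lu by (auto simp: r_def subset_iff)
            then have "integral {a..b} h = F b - F a" using int that by simp
            then have "norm (F b - F a - (b - a) *\<^sub>R h x) \<le> 1 / real (Suc n) * (b - a)"
              using d(2)[of a b] that by (simp add: r_def norm_minus_commute)
            also have "\<dots> \<le> e * (b - a)" using n that by (intro mult_right_mono) auto
            finally show ?thesis .
          qed
          show "\<exists>d>0. \<forall>y\<in>UNIV. norm (y - x) < d \<longrightarrow> norm (F y - F x - (y - x) *\<^sub>R h x) \<le> e * norm (y - x)"
          proof (intro exI[of _ r] conjI ballI impI)
            show "r > 0" using d x by (auto simp: r_def)
            fix y assume y: "norm (y - x) < r"
            consider "y = x" | "x < y" | "y < x" by linarith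
            then show "norm (F y - F x - (y - x) *\<^sub>R h x) \<le> e * norm (y - x)"
            proof cases
              case 2 then show ?thesis using main[of x y] y by auto
            next
              case 3
              have "F y - F x - (y - x) *\<^sub>R h x = - (F x - F y - (x - y) *\<^sub>R h x)" by (simp add: algebra_simps)
              then have "norm (F y - F x - (y - x) *\<^sub>R h x) = norm (F x - F y - (x - y) *\<^sub>R h x)"
                by (metis norm_minus_cancel)
              then show ?thesis using main[of y x] y 3 by auto
            qed simp
          qed
        qed
      qed
    qed
  qed auto
  have "AE x in lebesgue. \<forall>l::rat. \<forall>u::rat. {of_rat l..of_rat u} \<subseteq> S \<longrightarrow> x \<in> {of_rat l<..<of_rat u} \<longrightarrow>
          (F has_vector_derivative h x) (at x)"
    unfolding AE_all_countable by (intro allI AE_impI local)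
  then show ?thesis
  proof eventually_elim
    case (elim x)
    show ?case
    proof
      assume "x \<in> S"
      then obtain e where e: "e > 0" "ball x e \<subseteq> S" using S by (meson open_contains_ball)
      obtain l :: rat where l: "x - e < of_rat l" "of_rat l < x"
        using of_rat_dense[of "x - e" x] e by auto
      obtain u :: rat where u: "x < of_rat u" "of_rat u < x + e"
        using of_rat_dense[of x "x + e"] e by auto
      have "{of_rat l..of_rat u} \<subseteq> ball x e" using l u by (auto simp: dist_real_def)
      then have "{of_rat l..of_rat u} \<subseteq> S" using e(2) by (rule order_trans)
      then show "(F has_vector_derivative h x) (at x)" using elim l u by auto
    qed
  qed
qed

section \<open>Chains of indefinite integrals\<close>

text \<open>
  The predicate \<^const>\<open>locally_AC_deriv_on\<close> with the iterated derivatives replaced by arbitrary functions.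
  The iterated derivative of the highest order has unspecified values at the points where the derivative does not exist, so
  it is linear in the function only almost everywhere; such sequences are closed under differences term by term.
\<close>
definition AC_chain :: "nat \<Rightarrow> real set \<Rightarrow> (nat \<Rightarrow> real \<Rightarrow> complex) \<Rightarrow> bool" where
  "AC_chain n S F \<longleftrightarrow>
     (\<forall>i<n. \<forall>a\<in>S. \<forall>b\<in>S. a \<le> b \<longrightarrow>
        F (Suc i) absolutely_integrable_on {a..b} \<and> integral {a..b} (F (Suc i)) = F i b - F i a)"

lemma locally_AC_deriv_on_iff_chain: "locally_AC_deriv_on n S f \<longleftrightarrow> AC_chain n S (\<lambda>i. iter_deriv i f)"
  by (simp add: locally_AC_deriv_on_def AC_chain_def)

lemma iter_deriv_0 [simp]: "iter_deriv 0 f = f"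
  and iter_deriv_Suc: "iter_deriv (Suc n) f x = vector_derivative (iter_deriv n f) (at x)"
  by (simp_all add: iter_deriv_def)

lemma AC_chainD:
  assumes "AC_chain n S F" "i < n" "a \<in> S" "b \<in> S" "a \<le> b"
  shows "F (Suc i) absolutely_integrable_on {a..b}" "integral {a..b} (F (Suc i)) = F i b - F i a"
    "F (Suc i) integrable_on {a..b}"
proof -
  show "F (Suc i) absolutely_integrable_on {a..b}" "integral {a..b} (F (Suc i)) = F i b - F i a"
    using assms by (simp_all add: AC_chain_def)
  then show "F (Suc i) integrable_on {a..b}" by (simp add: absolutely_integrable_on_def)
qed

lemma AC_chain_mono:
  assumes "AC_chain n S F" "m \<le> n" "T \<subseteq> S"
  shows "AC_chain m T F"
  unfolding AC_chain_def using assms(2,3)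
  by (intro allI ballI impI conjI AC_chainD[OF assms(1)]) auto

lemma AC_chain_diff:
  assumes "AC_chain n S F" "AC_chain n S G"
  shows "AC_chain n S (\<lambda>i x. F i x - G i x)"
  unfolding AC_chain_def
proof (intro allI impI ballI)
  fix i a b assume H: "i < n" "a \<in> S" "b \<in> S" "a \<le> b"
  have F: "F (Suc i) absolutely_integrable_on {a..b}" "integral {a..b} (F (Suc i)) = F i b - F i a"
    using AC_chainD[OF assms(1) H] by simp_all
  have G: "G (Suc i) absolutely_integrable_on {a..b}" "integral {a..b} (G (Suc i)) = G i b - G i a"
    using AC_chainD[OF assms(2) H] by simp_all
  have "integral {a..b} (\<lambda>x. F (Suc i) x - G (Suc i) x) = (F i b - F i a) - (G i b - G i a)"
    using F G by (subst Henstock_Kurzweil_Integration.integral_diff) (auto dest: set_lebesgue_integral_eq_integral(1))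
  then show "(\<lambda>x. F (Suc i) x - G (Suc i) x) absolutely_integrable_on {a..b} \<and>
     integral {a..b} (\<lambda>x. F (Suc i) x - G (Suc i) x) = F i b - G i b - (F i a - G i a)"
    using F G by (auto intro!: set_integral_diff(1))
qed

lemma AC_chain_continuous_on:
  assumes C: "AC_chain n S F" and "i < n" and S: "open S" "is_interval S"
  shows "continuous_on S (F i)"
proof (rule continuous_at_imp_continuous_on, rule ballI)
  fix x assume "x \<in> S"
  then obtain e where e: "e > 0" "cball x e \<subseteq> S" using S open_contains_cball by meson
  define a b where "a = x - e" and "b = x + e"
  have ab: "{a..b} \<subseteq> S" using e by (simp add: a_def b_def cball_eq_atLeastAtMost)
  have abS: "a \<in> S" "a < b" "b \<in> S" using ab e by (auto simp: a_def b_def)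
  have int: "F (Suc i) integrable_on {a..b}"
    using AC_chainD(3)[OF C \<open>i < n\<close>, of a b] abS by simp
  have "continuous_on {a..b} (\<lambda>y. F i a + integral {a..y} (F (Suc i)))"
    by (intro continuous_intros indefinite_integral_continuous_1 int)
  moreover have "F i a + integral {a..y} (F (Suc i)) = F i y" if "y \<in> {a..b}" for y
    using AC_chainD(2)[OF C \<open>i < n\<close>, of a y] abS ab that by auto
  ultimately have "continuous_on {a..b} (F i)" by (rule continuous_on_eq)
  then show "isCont (F i) x"
    using e by (intro continuous_on_interior[of "{a..b}"]) (auto simp: a_def b_def)
qed

lemma AC_chain_has_vector_derivative:
  assumes C: "AC_chain n S F" and "Suc i < n" and S: "open S" "is_interval S" and "x \<in> S"
  shows "(F i has_vector_derivative F (Suc i) x) (at x)"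
proof -
  obtain e where e: "e > 0" "cball x e \<subseteq> S" using S open_contains_cball \<open>x \<in> S\<close> by meson
  define a b where "a = x - e" and "b = x + e"
  have ab: "{a..b} \<subseteq> S" using e by (simp add: a_def b_def cball_eq_atLeastAtMost)
  have abS: "a \<in> S" "a < b" "b \<in> S" using ab e by (auto simp: a_def b_def)
  have "continuous_on {a..b} (F (Suc i))"
    using AC_chain_continuous_on[OF C \<open>Suc i < n\<close> S] ab by (rule continuous_on_subset)
  then have "((\<lambda>u. integral {a..u} (F (Suc i))) has_vector_derivative F (Suc i) x) (at x within {a..b})"
    by (rule integral_has_vector_derivative) (use e in \<open>auto simp: a_def b_def\<close>)
  then have "((\<lambda>u. integral {a..u} (F (Suc i))) has_vector_derivative F (Suc i) x) (at x)"
    using e by (subst (asm) at_within_interior) (auto simp: a_def b_def)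
  then have "((\<lambda>u. F i a + integral {a..u} (F (Suc i))) has_vector_derivative F (Suc i) x) (at x)"
    by (auto intro!: derivative_eq_intros)
  then show ?thesis
  proof (rule has_vector_derivative_transform_within_open[of _ _ _ "{a<..<b}"])
    fix y assume "y \<in> {a<..<b}"
    then show "F i a + integral {a..y} (F (Suc i)) = F i y"
      using AC_chainD(2)[OF C, of i a y] abS subsetD[OF ab, of y] \<open>Suc i < n\<close> by auto
  qed (use e in \<open>auto simp: a_def b_def\<close>)
qed

text \<open>
  Every member below the last one is an indefinite integral, hence continuous, so that the member before it is
  differentiable everywhere. For the last member only almost everywhere differentiability is available.
\<close>
lemma AC_chain_iter_deriv:
  assumes C: "AC_chain n S F" and S: "open S" "is_interval S" and f: "\<And>x. x \<in> S \<Longrightarrow> f x = F 0 x"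
  shows "i < n \<Longrightarrow> x \<in> S \<Longrightarrow> iter_deriv i f x = F i x"
    and "i \<le> n \<Longrightarrow> AE x in lebesgue. x \<in> S \<longrightarrow> iter_deriv i f x = F i x"
proof -
  have 1: "i < n \<Longrightarrow> \<forall>x\<in>S. iter_deriv i f x = F i x" for i
  proof (induction i)
    case (Suc i)
    show ?case
    proof
      fix x assume x: "x \<in> S"
      have "(F i has_vector_derivative F (Suc i) x) (at x)"
        by (rule AC_chain_has_vector_derivative[OF C Suc.prems S x])
      then have "(iter_deriv i f has_vector_derivative F (Suc i) x) (at x)"
        by (rule has_vector_derivative_transform_within_open[OF _ S(1) x]) (use Suc in auto)
      then show "iter_deriv (Suc i) f x = F (Suc i) x"
        by (simp add: iter_deriv_Suc vector_derivative_at)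
    qed
  qed (use f in auto)
  then show "i < n \<Longrightarrow> x \<in> S \<Longrightarrow> iter_deriv i f x = F i x" for x by auto
  assume "i \<le> n"
  show "AE x in lebesgue. x \<in> S \<longrightarrow> iter_deriv i f x = F i x"
  proof (cases i)
    case 0 then show ?thesis using f by auto
  next
    case (Suc j)
    have "AE x in lebesgue. x \<in> S \<longrightarrow> (F j has_vector_derivative F i x) (at x)"
      using \<open>i \<le> n\<close> unfolding Suc
      by (intro lebesgue_differentiation S(1) conjI AC_chainD[OF C]) auto
    then show ?thesis
    proof eventually_elim
      case (elim x)
      show ?case
      proof
        assume x: "x \<in> S"
        then have "(F j has_vector_derivative F i x) (at x)" using elim by simp
        then have "(iter_deriv j f has_vector_derivative F i x) (at x)"
          by (rule has_vector_derivative_transform_within_open[OF _ S(1) x]) (use 1 Suc \<open>i \<le> n\<close> in auto)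
        then show "iter_deriv i f x = F i x"
          by (simp add: Suc iter_deriv_Suc vector_derivative_at)
      qed
    qed
  qed
qed

lemma AE_lebesgue_imp_negligible: "AE x in lebesgue. P x \<Longrightarrow> negligible {x. \<not> P x}"
  unfolding eventually_ae_filter by (auto simp: negligible_iff_null_sets[symmetric] intro: negligible_subset)

lemma AC_chain_imp_locally_AC:
  assumes C: "AC_chain n S F" and S: "open S" "is_interval S" and f: "\<And>x. x \<in> S \<Longrightarrow> f x = F 0 x"
  shows "locally_AC_deriv_on n S f"
  unfolding locally_AC_deriv_on_def
proof (intro allI impI ballI)
  fix i a b assume H: "i < n" "a \<in> S" "b \<in> S" "a \<le> b"
  have ab: "{a..b} \<subseteq> S" using mem_is_interval_1_I[OF S(2) H(2,3)] by auto
  have F: "F (Suc i) absolutely_integrable_on {a..b}" "integral {a..b} (F (Suc i)) = F i b - F i a"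
    using AC_chainD[OF C H] by simp_all
  have "AE x in lebesgue. x \<in> S \<longrightarrow> iter_deriv (Suc i) f x = F (Suc i) x"
    by (rule AC_chain_iter_deriv(2)[OF C S f]) (use H in auto)
  then have neg: "negligible {x. \<not> (x \<in> S \<longrightarrow> iter_deriv (Suc i) f x = F (Suc i) x)}" (is "negligible ?N")
    by (rule AE_lebesgue_imp_negligible)
  have eq: "iter_deriv (Suc i) f x = F (Suc i) x" if "x \<in> {a..b} - ?N" for x
    using that subsetD[OF ab, of x] by simp
  have "iter_deriv (Suc i) f absolutely_integrable_on {a..b}"
    by (rule absolutely_integrable_spike[OF F(1) neg eq])
  moreover have "integral {a..b} (iter_deriv (Suc i) f) = integral {a..b} (F (Suc i))"
    by (rule integral_spike[OF neg eq[symmetric]])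
  moreover have "iter_deriv i f b = F i b" "iter_deriv i f a = F i a"
    using AC_chain_iter_deriv(1)[OF C S f] H by auto
  ultimately show "iter_deriv (Suc i) f absolutely_integrable_on {a..b} \<and>
     integral {a..b} (iter_deriv (Suc i) f) = iter_deriv i f b - iter_deriv i f a"
    using F(2) by simp
qed

section \<open>The Riemann-Liouville kernel\<close>

text \<open>
  With the value \<open>0\<close> on the closed negative half line, Riemann-Liouville integrals are convolutions on the whole line.
\<close>
definition rl_kernel :: "real \<Rightarrow> real \<Rightarrow> real" where
  "rl_kernel a x = (if x > 0 then x powr (a - 1) / Gamma a else 0)"

lemma rl_kernel_measurable [measurable]: "rl_kernel a \<in> borel_measurable borel"
  unfolding rl_kernel_def by measurable

lemma rl_kernel_nonneg [simp]: "a > 0 \<Longrightarrow> rl_kernel a x \<ge> 0"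
  by (simp add: rl_kernel_def Gamma_real_pos less_imp_le)

lemma rl_kernel_nonpos [simp]: "x \<le> 0 \<Longrightarrow> rl_kernel a x = 0"
  by (simp add: rl_kernel_def)

lemma rl_kernel_1: "rl_kernel 1 x = indicator {0<..} x"
  by (simp add: rl_kernel_def)

text \<open>
  The substitution \<open>y = t + (x - t)s\<close> reduces the integral to Euler's Beta integral.
\<close>
lemma rl_kernel_convolution:
  assumes "a > 0" "b > 0"
  shows "(\<integral>\<^sup>+y. ennreal (rl_kernel a (x - y) * rl_kernel b (y - t)) \<partial>lborel) = ennreal (rl_kernel (a + b) (x - t))"
proof (cases "t < x")
  case False
  have 0: "rl_kernel a (x - y) * rl_kernel b (y - t) = 0" for y
    using False by (cases "y < x") auto
  show ?thesis unfolding 0 using False by simp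
next
  case True
  define c where "c = x - t"
  have c: "c > 0" using True by (simp add: c_def)
  define B where "B = (\<lambda>s::real. s powr (b - 1) * (1 - s) powr (a - 1))"
  have eq: "rl_kernel a (x - (t + c * s)) * rl_kernel b (t + c * s - t)
      = c powr (a + b - 2) / (Gamma a * Gamma b) * (indicator {0..1} s * B s)" for s
  proof (cases "0 < s \<and> s < 1")
    case True
    have "x - (t + c * s) = c * (1 - s)" by (simp add: c_def algebra_simps)
    moreover have "c * (1 - s) > 0" "c * s > 0" using True c by auto
    moreover have "c powr (a + b - 2) = c powr (a - 1) * c powr (b - 1)"
      by (simp flip: powr_add add: algebra_simps)
    ultimately show ?thesis using True c by (simp add: rl_kernel_def B_def powr_mult)
  next
    case False
    have "rl_kernel a (x - (t + c * s)) * rl_kernel b (t + c * s - t) = 0"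
    proof (cases "s \<le> 0")
      case True then show ?thesis using c by (simp add: mult_nonneg_nonpos)
    next
      case F: False
      then have "c * s \<ge> c" using False c by simp
      then show ?thesis by (simp add: c_def)
    qed
    moreover have "indicator {0..1} s * B s = 0" using False by (auto simp: indicator_def B_def)
    ultimately show ?thesis by (simp only: mult_zero_right)
  qed
  have G: "Gamma a > 0" "Gamma b > 0" "Gamma (a + b) > 0" using assms by (auto intro: Gamma_real_pos)
  have [measurable]: "B \<in> borel_measurable borel" unfolding B_def by measurable
  have "(\<integral>\<^sup>+y. ennreal (rl_kernel a (x - y) * rl_kernel b (y - t)) \<partial>lborel)
      = \<bar>c\<bar> * (\<integral>\<^sup>+s. ennreal (rl_kernel a (x - (t + c * s)) * rl_kernel b (t + c * s - t)) \<partial>lborel)"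
    using c by (subst nn_integral_real_affine[where c=c and t=t]) auto
  also have "\<dots> = ennreal c * (\<integral>\<^sup>+s. ennreal (c powr (a + b - 2) / (Gamma a * Gamma b)) * ennreal (indicator {0..1} s * B s) \<partial>lborel)"
    unfolding eq using c G by (subst ennreal_mult'[symmetric]) (auto simp: B_def)
  also have "\<dots> = ennreal c * (ennreal (c powr (a + b - 2) / (Gamma a * Gamma b)) * (\<integral>\<^sup>+s. ennreal (indicator {0..1} s * B s) \<partial>lborel))"
    by (subst nn_integral_cmult) auto
  also have "(\<integral>\<^sup>+s. ennreal (indicator {0..1} s * B s) \<partial>lborel) = ennreal (Beta b a)"
    using has_integral_Beta_real[OF assms(2,1)] unfolding B_def[symmetric]
    by (subst nn_integral_has_integral_lebesgue) (auto simp: B_def)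
  also have "ennreal c * (ennreal (c powr (a + b - 2) / (Gamma a * Gamma b)) * ennreal (Beta b a))
     = ennreal (c * (c powr (a + b - 2) / (Gamma a * Gamma b) * Beta b a))"
  proof -
    have "Beta b a \<ge> 0" "c powr (a + b - 2) / (Gamma a * Gamma b) \<ge> 0"
      using G by (auto simp: Beta_def add.commute)
    moreover have "ennreal c * (ennreal A * ennreal C) = ennreal (c * (A * C))" if "A \<ge> 0" "C \<ge> 0" for A C
      using that c by (simp add: ennreal_mult')
    ultimately show ?thesis by blast
  qed
  also have "c * (c powr (a + b - 2) / (Gamma a * Gamma b) * Beta b a) = (c * c powr (a + b - 2)) / Gamma (a + b)"
    using G by (simp add: Beta_def field_simps)
  also have "c * c powr (a + b - 2) = c powr (a + b - 1)"
    using c powr_mult_base[of c "a + b - 2"] by simp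
  also have "c powr (a + b - 1) / Gamma (a + b) = rl_kernel (a + b) (x - t)"
    using True by (simp add: rl_kernel_def c_def)
  finally show ?thesis .
qed

definition rl_int :: "real \<Rightarrow> (real \<Rightarrow> complex) \<Rightarrow> real \<Rightarrow> complex" where
  "rl_int a h x = (LINT y|lebesgue. rl_kernel a (x - y) *\<^sub>R h y)"

definition restrict_pos :: "(real \<Rightarrow> complex) \<Rightarrow> real \<Rightarrow> complex" where
  "restrict_pos h x = indicator {0<..} x *\<^sub>R h x"

lemma RL_integral_eq_rl_int: "RL_integral a u x = rl_int a (restrict_pos u) x"
proof -
  have "RL_integral a u x = (1 / Gamma a) *\<^sub>R (LINT y|lebesgue. indicator {0<..<x} y *\<^sub>R ((x - y) powr (a - 1) *\<^sub>R u y))"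
    unfolding RL_integral_def by (subst integral_restrict_space) auto
  also have "\<dots> = (LINT y|lebesgue. (1 / Gamma a) *\<^sub>R (indicator {0<..<x} y *\<^sub>R ((x - y) powr (a - 1) *\<^sub>R u y)))"
    by (rule integral_scaleR_right[symmetric])
  also have "\<dots> = rl_int a (restrict_pos u) x"
    unfolding rl_int_def by (rule Bochner_Integration.integral_cong) (auto simp: rl_kernel_def restrict_pos_def indicator_def)
  finally show ?thesis .
qed

lemma borel_imp_lebesgue: "f \<in> borel_measurable borel \<Longrightarrow> f \<in> borel_measurable lebesgue"
  by (rule measurable_completion) simp

lemma sigma_finite_lebesgue: "sigma_finite_measure (lebesgue :: real measure)"
proof
  show "\<exists>A. countable A \<and> A \<subseteq> sets lebesgue \<and> \<Union>A = space lebesgue \<and> (\<forall>a\<in>A. emeasure (lebesgue :: real measure) a \<noteq> \<infinity>)"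
  proof (intro exI[of _ "range (\<lambda>n::nat. {- real n..real n})"] conjI ballI)
    show "\<Union>(range (\<lambda>n::nat. {- real n..real n})) = space lebesgue"
    proof -
      have "\<exists>n::nat. - real n \<le> x \<and> x \<le> real n" for x
        using real_arch_simple[of "\<bar>x\<bar>"] by (auto simp: abs_le_iff minus_le_iff)
      then show ?thesis by auto
    qed
    show "emeasure lebesgue a \<noteq> \<infinity>" if "a \<in> range (\<lambda>n::nat. {- real n..real n})" for a
      using that by auto
  qed auto
qed

text \<open>
  Fubini's theorem for a Borel kernel against a Lebesgue measurable function. The bound \<open>B\<close> is required only where
  \<open>h\<close> does not vanish, so that a function on the half line needs a bound only for positive arguments.
\<close>
lemma
  fixes k :: "real \<Rightarrow> real \<Rightarrow> real" and h :: "real \<Rightarrow> complex"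
  assumes k [measurable]: "case_prod k \<in> borel_measurable (borel \<Otimes>\<^sub>M borel)" and h [measurable]: "h \<in> borel_measurable lebesgue"
    and bound: "\<And>t. h t \<noteq> 0 \<Longrightarrow> (\<integral>\<^sup>+y. ennreal \<bar>k t y\<bar> \<partial>lborel) \<le> ennreal (B t)"
    and int: "integrable lebesgue (\<lambda>t. B t * norm (h t))"
  shows integrable_kernel_integral: "integrable lebesgue (\<lambda>y. LINT t|lebesgue. k t y *\<^sub>R h t)"
    and AE_integrable_kernel: "AE y in lebesgue. integrable lebesgue (\<lambda>t. k t y *\<^sub>R h t)"
    and kernel_integral_swap: "(LINT y|lebesgue. LINT t|lebesgue. k t y *\<^sub>R h t) = (LINT t|lebesgue. (LINT y|lborel. k t y) *\<^sub>R h t)"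
proof -
  interpret P: pair_sigma_finite "lebesgue :: real measure" "lebesgue :: real measure"
    by (intro pair_sigma_finite.intro sigma_finite_lebesgue)
  define F where "F = (\<lambda>(t, y). k t y *\<^sub>R h t)"
  have idm: "(\<lambda>z::real. z) \<in> lebesgue \<rightarrow>\<^sub>M borel" by (rule borel_imp_lebesgue) simp
  have fsm: "(\<lambda>z. (fst z, snd z)) \<in> (lebesgue :: real measure) \<Otimes>\<^sub>M (lebesgue :: real measure) \<rightarrow>\<^sub>M borel \<Otimes>\<^sub>M borel"
    by (intro measurable_Pair measurable_compose[OF measurable_fst idm] measurable_compose[OF measurable_snd idm])
  have [measurable]: "(\<lambda>z. k (fst z) (snd z)) \<in> borel_measurable ((lebesgue :: real measure) \<Otimes>\<^sub>M (lebesgue :: real measure))"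
    using measurable_compose[OF fsm k] by simp
  have [measurable]: "(\<lambda>z. h (fst z)) \<in> borel_measurable ((lebesgue :: real measure) \<Otimes>\<^sub>M (lebesgue :: real measure))"
    by (rule measurable_compose[OF measurable_fst h])
  have F [measurable]: "F \<in> borel_measurable (lebesgue \<Otimes>\<^sub>M lebesgue)"
    unfolding F_def case_prod_beta by measurable
  have kt [measurable]: "k t \<in> borel_measurable borel" for t
    using measurable_compose[OF measurable_Pair1' k, of t] by simp
  have inner: "(\<integral>\<^sup>+y. ennreal (norm (F (t, y))) \<partial>lebesgue) \<le> ennreal (norm (B t * norm (h t)))" for t
  proof (cases "h t = 0")
    case False
    have "(\<integral>\<^sup>+y. ennreal (norm (F (t, y))) \<partial>lebesgue)
        = (\<integral>\<^sup>+y. ennreal \<bar>k t y\<bar> * ennreal (norm (h t)) \<partial>lborel)"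
      unfolding F_def nn_integral_completion
      by (intro nn_integral_cong) (simp add: ennreal_mult'')
    also have "\<dots> \<le> ennreal (B t) * ennreal (norm (h t))"
      using bound[OF False] by (subst nn_integral_multc) (auto intro: mult_right_mono)
    also have "\<dots> = ennreal (B t * norm (h t))" by (simp add: ennreal_mult'')
    also have "\<dots> \<le> ennreal (norm (B t * norm (h t)))" by (intro ennreal_leI) simp
    finally show ?thesis .
  qed (simp add: F_def)
  have intF: "integrable (lebesgue \<Otimes>\<^sub>M lebesgue) F"
  proof (rule integrableI_bounded[OF F])
    have "(\<integral>\<^sup>+z. ennreal (norm (F z)) \<partial>(lebesgue \<Otimes>\<^sub>M lebesgue)) = (\<integral>\<^sup>+t. \<integral>\<^sup>+y. ennreal (norm (F (t, y))) \<partial>lebesgue \<partial>lebesgue)"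
      by (subst sigma_finite_measure.nn_integral_fst[OF sigma_finite_lebesgue, symmetric]) auto
    also have "\<dots> \<le> (\<integral>\<^sup>+t. ennreal (norm (B t * norm (h t))) \<partial>lebesgue)"
      by (intro nn_integral_mono inner)
    also have "\<dots> < \<infinity>" using int unfolding integrable_iff_bounded by blast
    finally show "(\<integral>\<^sup>+z. ennreal (norm (F z)) \<partial>(lebesgue \<Otimes>\<^sub>M lebesgue)) < \<infinity>" .
  qed
  have snd_eq: "(LINT y|lebesgue. F (t, y)) = (LINT y|lborel. k t y) *\<^sub>R h t" for t
  proof (cases "h t = 0")
    case False
    have "integrable lborel (k t)"
      using bound[OF False] by (intro integrableI_bounded) (auto intro: order.strict_trans1)
    then have "(LINT y|lborel. k t y *\<^sub>R h t) = (LINT y|lborel. k t y) *\<^sub>R h t"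
      by (intro integral_scaleR_left) auto
    then show ?thesis
      unfolding F_def by (subst integral_completion) auto
  qed (simp add: F_def)
  show "integrable lebesgue (\<lambda>y. LINT t|lebesgue. k t y *\<^sub>R h t)"
    using P.integrable_snd[of "\<lambda>t y. F (t, y)"] intF unfolding F_def by simp
  show "AE y in lebesgue. integrable lebesgue (\<lambda>t. k t y *\<^sub>R h t)"
    using P.AE_integrable_snd[of "\<lambda>t y. F (t, y)"] intF unfolding F_def by simp
  have "(LINT y|lebesgue. LINT t|lebesgue. F (t, y)) = (LINT t|lebesgue. LINT y|lebesgue. F (t, y))"
    using P.Fubini_integral[of "\<lambda>t y. F (t, y)"] intF by simp
  then show "(LINT y|lebesgue. LINT t|lebesgue. k t y *\<^sub>R h t) = (LINT t|lebesgue. (LINT y|lborel. k t y) *\<^sub>R h t)"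
    unfolding snd_eq by (simp add: F_def)
qed

text \<open>
  The semigroup law, at every point where the composed kernel is integrable against \<open>h\<close>. In particular the outer
  integral over \<open>rl_int b h\<close> converges absolutely at each such point, not merely at almost every one.
\<close>
lemma
  assumes ab: "a > 0" "b > 0" and h: "h \<in> borel_measurable lebesgue"
    and int: "integrable lebesgue (\<lambda>t. rl_kernel (a + b) (x - t) *\<^sub>R h t)"
  shows AE_integrable_rl_kernel_compose: "AE y in lebesgue. integrable lebesgue (\<lambda>t. (rl_kernel a (x - y) * rl_kernel b (y - t)) *\<^sub>R h t)"
    and integrable_rl_int_compose: "integrable lebesgue (\<lambda>y. rl_kernel a (x - y) *\<^sub>R rl_int b h y)"
    and rl_int_compose: "rl_int a (rl_int b h) x = rl_int (a + b) h x"
proof -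
  define k where "k = (\<lambda>t y. rl_kernel a (x - y) * rl_kernel b (y - t))"
  have k: "case_prod k \<in> borel_measurable (borel \<Otimes>\<^sub>M borel)"
    unfolding k_def case_prod_beta by measurable
  have kb: "(\<integral>\<^sup>+y. ennreal \<bar>k t y\<bar> \<partial>lborel) \<le> ennreal (rl_kernel (a + b) (x - t))" for t
    using ab unfolding k_def by (simp add: abs_mult rl_kernel_convolution)
  have ki: "integrable lebesgue (\<lambda>t. rl_kernel (a + b) (x - t) * norm (h t))"
    using integrable_norm[OF int] ab by simp
  have eq: "(LINT t|lebesgue. k t y *\<^sub>R h t) = rl_kernel a (x - y) *\<^sub>R rl_int b h y" for y
    unfolding k_def rl_int_def by (simp flip: integral_scaleR_right)
  have "(LINT y|lborel. k t y) = rl_kernel (a + b) (x - t)" for t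
    unfolding k_def using ab by (subst integral_eq_nn_integral) (auto simp: rl_kernel_convolution)
  then show "rl_int a (rl_int b h) x = rl_int (a + b) h x"
    using kernel_integral_swap[OF k h kb ki] unfolding eq by (simp add: rl_int_def)
  show "integrable lebesgue (\<lambda>y. rl_kernel a (x - y) *\<^sub>R rl_int b h y)"
    using integrable_kernel_integral[OF k h kb ki] unfolding eq .
  show "AE y in lebesgue. integrable lebesgue (\<lambda>t. (rl_kernel a (x - y) * rl_kernel b (y - t)) *\<^sub>R h t)"
    using AE_integrable_kernel[OF k h kb ki] unfolding k_def .
qed

text \<open>
  Local integrability up to the end point \<open>0\<close>, for functions on the half line extended by \<open>0\<close>.
\<close>
definition loc_integrable :: "(real \<Rightarrow> complex) \<Rightarrow> bool" where
  "loc_integrable h \<longleftrightarrow> (\<forall>x\<le>0. h x = 0) \<and> (\<forall>x. set_integrable lebesgue {0..x} h)"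

lemma loc_integrable_Iic:
  assumes "loc_integrable h"
  shows "set_integrable lebesgue {..x} h"
proof -
  have "(\<lambda>y. indicator {0..x} y *\<^sub>R h y) = (\<lambda>y. indicator {..x} y *\<^sub>R h y)"
  proof
    fix y show "indicator {0..x} y *\<^sub>R h y = indicator {..x} y *\<^sub>R h y"
      using assms by (cases "y \<le> 0") (auto simp: loc_integrable_def indicator_def)
  qed
  then show ?thesis using assms by (metis loc_integrable_def set_integrable_def)
qed

lemma loc_integrable_measurable:
  assumes "loc_integrable h"
  shows "h \<in> borel_measurable lebesgue"
proof (rule borel_measurable_LIMSEQ_metric)
  show "(\<lambda>y. indicator {..real n} y *\<^sub>R h y) \<in> borel_measurable lebesgue" for n
    using loc_integrable_Iic[OF assms, of "real n"] by (auto simp: set_integrable_def)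
  fix y :: real
  obtain n where n: "y \<le> real n" using real_arch_simple by blast
  have "eventually (\<lambda>n. indicator {..real n} y *\<^sub>R h y = h y) sequentially"
    using eventually_ge_at_top[of n] by eventually_elim (use n in auto)
  then show "(\<lambda>n. indicator {..real n} y *\<^sub>R h y) \<longlonglongrightarrow> h y"
    by (rule tendsto_eventually)
qed

lemma integrable_rl_kernel_ge1:
  assumes h: "loc_integrable h" and "a \<ge> 1"
  shows "integrable lebesgue (\<lambda>y. rl_kernel a (x - y) *\<^sub>R h y)"
proof (rule Bochner_Integration.integrable_bound)
  show "integrable lebesgue (\<lambda>y. (\<bar>x\<bar> powr (a - 1) / Gamma a) *\<^sub>R (indicator {..x} y *\<^sub>R h y))"
    using loc_integrable_Iic[OF h, of x] unfolding set_integrable_def by (intro integrable_scaleR_right)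
  show "(\<lambda>y. rl_kernel a (x - y) *\<^sub>R h y) \<in> borel_measurable lebesgue"
    by (intro borel_measurable_scaleR borel_imp_lebesgue[of "\<lambda>y. rl_kernel a (x - y)"] loc_integrable_measurable[OF h]) measurable
  have "rl_kernel a (x - y) \<le> \<bar>x\<bar> powr (a - 1) / Gamma a" if "0 < y" "y < x" for y
    using that assms(2) Gamma_real_pos[of a] unfolding rl_kernel_def by (auto intro!: divide_right_mono powr_mono2)
  then have "rl_kernel a (x - y) * norm (h y) \<le> norm ((\<bar>x\<bar> powr (a - 1) / Gamma a) *\<^sub>R (indicator {..x} y *\<^sub>R h y))" for y
    using h assms(2) Gamma_real_pos[of a] mult_right_mono[of "rl_kernel a (x - y)" "\<bar>x\<bar> powr (a - 1) / Gamma a" "norm (h y)"]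
    by (cases "0 < y \<and> y < x") (auto simp: loc_integrable_def)
  then show "AE y in lebesgue. norm (rl_kernel a (x - y) *\<^sub>R h y) \<le> norm ((\<bar>x\<bar> powr (a - 1) / Gamma a) *\<^sub>R (indicator {..x} y *\<^sub>R h y))"
    using assms(2) by simp
qed

lemma rl_int_nonpos:
  assumes "loc_integrable h" "x \<le> 0"
  shows "rl_int a h x = 0"
proof -
  have "(\<lambda>y. rl_kernel a (x - y) *\<^sub>R h y) = (\<lambda>y. 0)"
  proof
    fix y show "rl_kernel a (x - y) *\<^sub>R h y = 0"
      using assms by (cases "y \<le> 0") (auto simp: loc_integrable_def)
  qed
  then show ?thesis by (simp add: rl_int_def)
qed

lemma loc_integrable_rl_int:
  assumes h: "loc_integrable h" and a: "a > 0"
  shows "loc_integrable (rl_int a h)"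
  unfolding loc_integrable_def
proof (intro conjI allI impI)
  show "rl_int a h x = 0" if "x \<le> 0" for x using rl_int_nonpos[OF h that] .
  fix x
  have "integrable lebesgue (\<lambda>y. rl_kernel 1 (x - y) *\<^sub>R rl_int a h y)"
    by (rule integrable_rl_int_compose) (use a in \<open>auto intro!: loc_integrable_measurable h integrable_rl_kernel_ge1\<close>)
  then have "integrable lebesgue (\<lambda>y. indicator {0..x} y *\<^sub>R (rl_kernel 1 (x - y) *\<^sub>R rl_int a h y))"
    by (intro integrable_mult_indicator) auto
  then show "set_integrable lebesgue {0..x} (rl_int a h)"
    unfolding set_integrable_def
  proof (rule integrable_cong_AE_imp)
    have "AE y in lebesgue. y \<noteq> x" 
      using AE_completion[OF AE_lborel_singleton[of x]] by simp
    then show "AE y in lebesgue. indicat_real {0..x} y *\<^sub>R (rl_kernel 1 (x - y) *\<^sub>R rl_int a h y) = indicat_real {0..x} y *\<^sub>R rl_int a h y"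
      by eventually_elim (auto simp: rl_kernel_1 indicator_def)
    have "(\<lambda>y. rl_kernel 1 (x + 1 - y) *\<^sub>R rl_int a h y) \<in> borel_measurable lebesgue"
      using integrable_rl_int_compose[OF zero_less_one a loc_integrable_measurable[OF h], of "x+1"] integrable_rl_kernel_ge1[OF h, of "1 + a" "x+1"] a
      by (auto simp: add.commute)
    then have "(\<lambda>y. indicat_real {0..x} y *\<^sub>R (rl_kernel 1 (x + 1 - y) *\<^sub>R rl_int a h y)) \<in> borel_measurable lebesgue"
      by (rule borel_measurable_scaleR[OF borel_measurable_indicator, rotated]) auto
    also have "(\<lambda>y. indicat_real {0..x} y *\<^sub>R (rl_kernel 1 (x + 1 - y) *\<^sub>R rl_int a h y)) = (\<lambda>y. indicat_real {0..x} y *\<^sub>R rl_int a h y)"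
      by (auto simp: fun_eq_iff rl_kernel_1 indicator_def)
    finally show "(\<lambda>y. indicat_real {0..x} y *\<^sub>R rl_int a h y) \<in> borel_measurable lebesgue" .
  qed
qed

lemma loc_integrable_absolutely_integrable:
  assumes h: "loc_integrable h"
  shows "h absolutely_integrable_on {a..b}"
proof -
  have "set_integrable lebesgue ({..b} \<inter> {a..}) h"
    using loc_integrable_Iic[OF h, of b] by (rule set_integrable_subset) auto
  moreover have "{..b} \<inter> {a..} = {a..b}" by auto
  ultimately show ?thesis by simp
qed

lemma rl_int_1:
  assumes h: "loc_integrable h"
  shows "rl_int 1 h x = integral {0..x} h"
proof -
  have ai: "h absolutely_integrable_on {0..x}" by (rule loc_integrable_absolutely_integrable[OF h])
  have "rl_int 1 h x = (LINT y:{0..x}|lebesgue. h y)"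
    unfolding rl_int_def set_lebesgue_integral_def
  proof (rule integral_cong_AE)
    have "AE y in lebesgue. y \<noteq> x" 
      using AE_completion[OF AE_lborel_singleton[of x]] by simp
    then show "AE y in lebesgue. rl_kernel 1 (x - y) *\<^sub>R h y = indicat_real {0..x} y *\<^sub>R h y"
      by eventually_elim (use h in \<open>auto simp: rl_kernel_1 indicator_def loc_integrable_def\<close>)
    show "(\<lambda>y. rl_kernel 1 (x - y) *\<^sub>R h y) \<in> borel_measurable lebesgue"
      using integrable_rl_kernel_ge1[OF h, of 1 x] by auto
    show "(\<lambda>y. indicat_real {0..x} y *\<^sub>R h y) \<in> borel_measurable lebesgue"
      using ai by (auto simp: set_integrable_def)
  qed
  also have "\<dots> = integral {0..x} h" by (rule set_lebesgue_integral_eq_integral(2)[OF ai])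
  finally show ?thesis .
qed

lemma integral_rl_int_1:
  assumes h: "loc_integrable h" and "a \<le> b"
  shows "integral {a..b} h = rl_int 1 h b - rl_int 1 h a"
proof -
  have "h integrable_on {min a 0..b}" using loc_integrable_absolutely_integrable[OF h] by (simp add: absolutely_integrable_on_def)
  have E: "integral {c..x} h = rl_int 1 h x" if "c \<le> 0" for c x
  proof -
    have "integral {c..x} h = integral ({c..x} \<inter> {0..}) h"
      by (rule integral_spike_set; rule negligible_subset[of "{}"]) (use h in \<open>auto simp: loc_integrable_def not_le\<close>)
    also have "{c..x} \<inter> {0..} = {0..x}" using that by auto
    finally show ?thesis using rl_int_1[OF h] by simp
  qed
  have "integral {min a 0..a} h + integral {a..b} h = integral {min a 0..b} h"
    by (rule Henstock_Kurzweil_Integration.integral_combine) (use assms(2) \<open>h integrable_on {min a 0..b}\<close> in auto)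
  then show ?thesis using E[of "min a 0"] by (auto simp: algebra_simps)
qed

text \<open>
  Both functions are almost everywhere the derivative of the same indefinite integral.
\<close>
lemma rl_int_1_inj:
  assumes f: "loc_integrable f" and g: "loc_integrable g" and eq: "\<And>x. x > 0 \<Longrightarrow> rl_int 1 f x = rl_int 1 g x"
  shows "AE x in lebesgue. f x = g x"
proof -
  have eq': "rl_int 1 f x = rl_int 1 g x" for x
    using eq rl_int_nonpos[OF f] rl_int_nonpos[OF g] by (cases "x > 0") auto
  have "AE x in lebesgue. x \<in> UNIV \<longrightarrow> (rl_int 1 f has_vector_derivative f x) (at x)"
    by (rule lebesgue_differentiation) (auto intro: loc_integrable_absolutely_integrable f integral_rl_int_1)
  moreover have "AE x in lebesgue. x \<in> UNIV \<longrightarrow> (rl_int 1 f has_vector_derivative g x) (at x)"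
    by (rule lebesgue_differentiation) (auto simp: eq' intro: loc_integrable_absolutely_integrable g integral_rl_int_1)
  ultimately show ?thesis
    by eventually_elim (auto intro: vector_derivative_unique_at)
qed

lemma AE_integrable_rl_kernel:
  assumes h: "loc_integrable h" and a: "a > 0"
  shows "AE y in lebesgue. integrable lebesgue (\<lambda>t. rl_kernel a (y - t) *\<^sub>R h t)"
proof -
  have "AE y in lebesgue. integrable lebesgue (\<lambda>t. (rl_kernel 1 (real n - y) * rl_kernel a (y - t)) *\<^sub>R h t)" for n
    by (rule AE_integrable_rl_kernel_compose)
       (use a in \<open>auto intro!: loc_integrable_measurable h integrable_rl_kernel_ge1\<close>)
  then have "AE y in lebesgue. \<forall>n. integrable lebesgue (\<lambda>t. (rl_kernel 1 (real n - y) * rl_kernel a (y - t)) *\<^sub>R h t)"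
    by (simp add: AE_all_countable)
  then show ?thesis
  proof eventually_elim
    case (elim y)
    obtain n :: nat where "y < real n" using reals_Archimedean2 by blast
    then have "rl_kernel 1 (real n - y) = 1" by (simp add: rl_kernel_1)
    then show ?case using spec[OF elim, of n] by simp
  qed
qed

section \<open>Riemann-Liouville derivatives as chains\<close>

text \<open>
  A description of the space \<^const>\<open>A_space\<close> without derivatives: \<open>\<gamma> k\<close> stands for the derivative of \<open>v\<close> of
  order \<open>\<nu> + k\<close>. It is closed under differences and, in the following two lemmas, equivalent to the
  differentiability conditions of the space.
\<close>
definition RL_chain :: "nat \<Rightarrow> real \<Rightarrow> (real \<Rightarrow> complex) \<Rightarrow> (nat \<Rightarrow> real \<Rightarrow> complex) \<Rightarrow> bool" where
  "RL_chain m \<nu> v \<gamma> \<longleftrightarrow>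
     loc_integrable (restrict_pos (\<gamma> 0)) \<and>
     (AE x in lebesgue. restrict_pos v x = rl_int \<nu> (restrict_pos (\<gamma> 0)) x) \<and>
     AC_chain m {0<..} \<gamma>"

lemma restrict_pos_simps [simp]: "x > 0 \<Longrightarrow> restrict_pos f x = f x" "x \<le> 0 \<Longrightarrow> restrict_pos f x = 0"
  by (auto simp: restrict_pos_def)

lemma RL_order_bounds:
  assumes "\<nu> > 0"
  shows "real (RL_order \<nu>) - \<nu> > 0" "real (RL_order \<nu>) - \<nu> \<le> 1" "RL_order \<nu> > 0"
  using assms by (simp_all add: RL_order_def) linarith+

lemma RL_order_add:
  assumes "\<nu> > 0"
  shows "RL_order (\<nu> + real k) = RL_order \<nu> + k"
    "real (RL_order \<nu> + k) - (\<nu> + real k) = real (RL_order \<nu>) - \<nu>"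
proof -
  have "\<lfloor>\<nu> + real k\<rfloor> = \<lfloor>\<nu>\<rfloor> + int k" by linarith
  moreover have "\<lfloor>\<nu>\<rfloor> \<ge> 0" using assms by simp
  ultimately show "RL_order (\<nu> + real k) = RL_order \<nu> + k"
    unfolding RL_order_def by linarith
qed simp

lemma AE_lebesgue_neq: "AE y in lebesgue. y \<noteq> (c::real)"
  using AE_completion[OF AE_lborel_singleton[of c]] by simp

text \<open>
  Let \<open>j\<close> be the order of differentiation in \<open>D\<^sup>\<nu>\<close>, let \<open>\<sigma> = j - \<nu>\<close>, \<open>V = I\<^sup>\<sigma>v\<close> and \<open>g = V\<^sup>(\<^sup>j\<^sup>)\<close>. As \<open>V\<close> vanishes on the negative
  half line, \<open>V\<close> and its first \<open>j - 1\<close> derivatives vanish at \<open>0\<close>, and \<open>V = I\<^sup>jg\<close>. Applying \<open>I\<^sup>1\<^sup>-\<^sup>\<sigma>\<close> (for \<open>\<sigma> < 1\<close>) to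
  \<open>I\<^sup>\<sigma>v = I\<^sup>jg\<close> gives \<open>I\<^sup>1v = I\<^sup>1\<^sup>+\<^sup>\<nu>g = I\<^sup>1I\<^sup>\<nu>g\<close>, and \<open>I\<^sup>1\<close> is injective up to null sets.
\<close>
lemma RL_chainI:
  assumes \<nu>: "\<nu> > 0"
    and v: "loc_integrable (restrict_pos v)"
    and d0: "RL_differentiable_on \<nu> UNIV v"
    and dm: "RL_differentiable_on (\<nu> + real m) {0<..} v"
  shows "RL_chain m \<nu> v (\<lambda>k. RL_deriv (\<nu> + real k) v)"
proof -
  define j where "j = RL_order \<nu>"
  define \<sigma> where "\<sigma> = real j - \<nu>"
  define V where "V = RL_integral \<sigma> v"
  define D where "D = (\<lambda>i. iter_deriv i V)"
  have \<sigma>: "\<sigma> > 0" "\<sigma> \<le> 1" and j: "j > 0" using RL_order_bounds[OF \<nu>] by (auto simp: \<sigma>_def j_def)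
  have Dk: "RL_deriv (\<nu> + real k) v = D (j + k)" for k
    unfolding RL_deriv_def RL_order_add[OF \<nu>] D_def V_def \<sigma>_def j_def ..
  have C0: "AC_chain j UNIV D"
    using d0 unfolding RL_differentiable_on_def locally_AC_deriv_on_iff_chain D_def V_def \<sigma>_def j_def .
  have Cm: "AC_chain (j + m) {0<..} D"
    using dm unfolding RL_differentiable_on_def locally_AC_deriv_on_iff_chain RL_order_add[OF \<nu>] D_def V_def \<sigma>_def j_def .
  have V: "V x = rl_int \<sigma> (restrict_pos v) x" for x
    unfolding V_def by (rule RL_integral_eq_rl_int)
  have V0: "V x = 0" if "x \<le> 0" for x
    unfolding V using v that by (rule rl_int_nonpos)
  have D0: "D i x = 0" if "i < j" "x \<le> 0" for i x
  proof -
    \<comment> \<open>Compare with the zero chain on the negative half line; continuity then carries the value to \<open>0\<close>.\<close>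
    have neg: "D i x = 0" if "x < 0" for x
    proof -
      have "AC_chain j {..<0} (\<lambda>_ _. 0)" by (simp add: AC_chain_def)
      then have "iter_deriv i V x = (\<lambda>_ _. 0) i x"
        by (rule AC_chain_iter_deriv(1)) (use V0 that \<open>i < j\<close> in \<open>auto simp: is_interval_ci is_interval_1\<close>)
      then show ?thesis by (simp add: D_def)
    qed
    have "continuous_on UNIV (D i)"
      by (rule AC_chain_continuous_on[OF C0 \<open>i < j\<close>]) auto
    then have "(D i \<longlongrightarrow> D i 0) (at_left 0)"
      by (simp add: continuous_on_eq_continuous_at isCont_def filterlim_at_split)
    moreover have "(D i \<longlongrightarrow> 0) (at_left 0)"
      by (rule tendsto_eventually) (auto simp: eventually_at_filter neg)
    ultimately have "D i 0 = 0" by (rule tendsto_unique[rotated]) simp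
    then show ?thesis using neg that by (cases "x = 0") auto
  qed
  have loc: "loc_integrable (restrict_pos (D (Suc i)))" if "i < j" for i
    unfolding loc_integrable_def
  proof (intro conjI allI impI)
    fix x :: real
    show "set_integrable lebesgue {0..x} (restrict_pos (D (Suc i)))"
    proof (cases "x \<ge> 0")
      case True
      show ?thesis
        by (rule absolutely_integrable_spike[OF AC_chainD(1)[OF C0 that _ _ True] negligible_sing[of 0]])
           (auto simp: restrict_pos_def indicator_def)
    qed (simp add: set_integrable_def)
  qed simp
  have step: "D i = rl_int 1 (restrict_pos (D (Suc i)))" if "i < j" for i
  proof
    fix x
    show "D i x = rl_int 1 (restrict_pos (D (Suc i))) x"
    proof (cases "x \<ge> 0")
      case True
      have "rl_int 1 (restrict_pos (D (Suc i))) x = integral {0..x} (restrict_pos (D (Suc i)))"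
        by (rule rl_int_1[OF loc[OF that]])
      also have "\<dots> = integral {0..x} (D (Suc i))"
        by (rule integral_spike[OF negligible_sing[of 0]]) (auto simp: restrict_pos_def indicator_def)
      also have "\<dots> = D i x - D i 0" using AC_chainD(2)[OF C0 that _ _ True] by simp
      finally show ?thesis using D0[OF that] by simp
    next
      case False
      then show ?thesis using D0[OF that, of x] rl_int_nonpos[OF loc[OF that], of x] by simp
    qed
  qed
  define g where "g = restrict_pos (D j)"
  have g: "loc_integrable g" using loc[of "j - 1"] j by (simp add: g_def)
  have gm: "g \<in> borel_measurable lebesgue" by (rule loc_integrable_measurable[OF g])
  have Dg: "D (j - n) = rl_int (real n) g" if "1 \<le> n" "n \<le> j" for n
    using that
  proof (induction n rule: dec_induct)
    case base
    then show ?case using step[of "j - 1"] j by (simp add: g_def)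
  next
    case (step n)
    have Sj: "Suc (j - Suc n) = j - n" using step by auto
    have "restrict_pos (D (j - n)) = D (j - n)"
    proof
      fix x show "restrict_pos (D (j - n)) x = D (j - n) x"
        using D0[of "j - n" x] step j by (cases "x > 0") auto
    qed
    then have "D (j - Suc n) = rl_int 1 (rl_int (real n) g)"
      using \<open>\<And>i. i < j \<Longrightarrow> D i = rl_int 1 (restrict_pos (D (Suc i)))\<close>[of "j - Suc n"] step Sj by simp
    also have "\<dots> = rl_int (1 + real n) g"
      using step by (intro ext rl_int_compose gm integrable_rl_kernel_ge1 g) auto
    finally show ?case by simp
  qed
  have Vg: "V = rl_int (real j) g" using Dg[of j] j by (simp add: D_def)
  have locg: "loc_integrable (rl_int \<nu> g)" by (rule loc_integrable_rl_int[OF g \<nu>])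
  have "rl_int 1 (restrict_pos v) x = rl_int 1 (rl_int \<nu> g) x" for x
  proof -
    have vm: "restrict_pos v \<in> borel_measurable lebesgue" by (rule loc_integrable_measurable[OF v])
    have "rl_int 1 (rl_int \<nu> g) x = rl_int (1 + \<nu>) g x"
      using \<nu> by (intro rl_int_compose gm integrable_rl_kernel_ge1 g) auto
    moreover have "rl_int 1 (restrict_pos v) x = rl_int (1 + \<nu>) g x"
    proof (cases "\<sigma> = 1")
      case True
      then have "real j = 1 + \<nu>" by (simp add: \<sigma>_def)
      then show ?thesis using V[of x] Vg True by simp
    next
      case False
      then have s: "1 - \<sigma> > 0" using \<sigma> by simp
      have "rl_int 1 (restrict_pos v) x = rl_int (1 - \<sigma> + \<sigma>) (restrict_pos v) x" by simp
      also have "\<dots> = rl_int (1 - \<sigma>) (rl_int \<sigma> (restrict_pos v)) x"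
        using s \<sigma> by (intro rl_int_compose[symmetric] vm integrable_rl_kernel_ge1 v) auto
      also have "rl_int \<sigma> (restrict_pos v) = rl_int (real j) g" using V Vg by auto
      also have "rl_int (1 - \<sigma>) (rl_int (real j) g) x = rl_int (1 - \<sigma> + real j) g x"
        using s j by (intro rl_int_compose gm integrable_rl_kernel_ge1 g) auto
      also have "1 - \<sigma> + real j = 1 + \<nu>" by (simp add: \<sigma>_def)
      finally show ?thesis .
    qed
    ultimately show ?thesis by simp
  qed
  then have "AE x in lebesgue. restrict_pos v x = rl_int \<nu> g x"
    by (intro rl_int_1_inj v locg)
  moreover have "AC_chain m {0<..} (\<lambda>k. D (j + k))"
    unfolding AC_chain_def
  proof (intro allI ballI impI)
    fix i and a b :: real assume "i < m" "a \<in> {0<..}" "b \<in> {0<..}" "a \<le> b"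
    then show "D (j + Suc i) absolutely_integrable_on {a..b} \<and> integral {a..b} (D (j + Suc i)) = D (j + i) b - D (j + i) a"
      using AC_chainD[OF Cm, of "j + i" a b] by simp
  qed
  ultimately show ?thesis
    unfolding RL_chain_def Dk using g by (simp add: g_def)
qed

text \<open>
  Conversely \<open>I\<^sup>\<sigma>v = I\<^sup>\<sigma>I\<^sup>\<nu>g = I\<^sup>jg\<close> holds at every point, and \<open>I\<^sup>jg, I\<^sup>j\<^sup>-\<^sup>1g, \<dots>, I\<^sup>1g, g = \<gamma> 0, \<gamma> 1, \<dots>\<close> is a chain of indefinite
  integrals.
\<close>
lemma
  assumes \<nu>: "\<nu> > 0" and C: "RL_chain m \<nu> v \<gamma>"
  shows RL_chain_RL_differentiable_UNIV: "RL_differentiable_on \<nu> UNIV v"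
    and RL_chain_RL_differentiable_pos: "k \<le> m \<Longrightarrow> RL_differentiable_on (\<nu> + real k) {0<..} v"
    and RL_chain_RL_deriv: "k \<le> m \<Longrightarrow> AE x in lebesgue. x > 0 \<longrightarrow> RL_deriv (\<nu> + real k) v x = \<gamma> k x"
proof -
  define j where "j = RL_order \<nu>"
  define \<sigma> where "\<sigma> = real j - \<nu>"
  define V where "V = RL_integral \<sigma> v"
  define g where "g = restrict_pos (\<gamma> 0)"
  have \<sigma>: "\<sigma> > 0" "\<sigma> \<le> 1" and j: "j > 0" using RL_order_bounds[OF \<nu>] by (auto simp: \<sigma>_def j_def)
  have g: "loc_integrable g" and vg: "AE x in lebesgue. restrict_pos v x = rl_int \<nu> g x"
    and AC: "AC_chain m {0<..} \<gamma>"
    using C by (auto simp: RL_chain_def g_def)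
  have gm: "g \<in> borel_measurable lebesgue" by (rule loc_integrable_measurable[OF g])
  have rm: "rl_int \<nu> g \<in> borel_measurable lebesgue" by (rule loc_integrable_measurable[OF loc_integrable_rl_int[OF g \<nu>]])
  have vm: "restrict_pos v \<in> borel_measurable lebesgue"
    by (rule borel_measurable_AE[OF rm]) (use vg in auto)
  define F where "F = (\<lambda>i. if i < j then rl_int (real (j - i)) g else if i = j then g else \<gamma> (i - j))"
  have "V x = F 0 x" for x
  proof -
    have km: "(\<lambda>y. rl_kernel \<sigma> (x - y)) \<in> borel_measurable lebesgue" by (rule borel_imp_lebesgue) measurable
    have "V x = rl_int \<sigma> (restrict_pos v) x"
      unfolding V_def by (rule RL_integral_eq_rl_int)
    also have "\<dots> = rl_int \<sigma> (rl_int \<nu> g) x"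
      unfolding rl_int_def[of \<sigma>]
      by (rule integral_cong_AE) (use vg in \<open>auto intro!: borel_measurable_scaleR km vm rm\<close>)
    also have "\<dots> = rl_int (\<sigma> + \<nu>) g x"
      using \<sigma> \<nu> j by (intro rl_int_compose gm integrable_rl_kernel_ge1 g) (auto simp: \<sigma>_def)
    also have "\<sigma> + \<nu> = real j" by (simp add: \<sigma>_def)
    finally show ?thesis using j by (simp add: F_def)
  qed
  note VF = this
  have locF: "loc_integrable (F i)" if "i \<le> j" for i
    using that g by (auto simp: F_def intro!: loc_integrable_rl_int)
  have stepF: "F i = rl_int 1 (F (Suc i))" if "i < j" for i
  proof (cases "Suc i = j")
    case True
    then have "real (j - i) = 1" by auto
    then show ?thesis using that True by (simp add: F_def del: of_nat_diff)
  next
    case False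
    then have "rl_int 1 (rl_int (real (j - Suc i)) g) = rl_int (1 + real (j - Suc i)) g"
      using that by (intro ext rl_int_compose gm integrable_rl_kernel_ge1 g) auto
    moreover have "1 + real (j - Suc i) = real (j - i)" using that by simp
    ultimately show ?thesis using that False by (simp add: F_def)
  qed
  have FAC: "F (Suc i) absolutely_integrable_on {a..b} \<and> integral {a..b} (F (Suc i)) = F i b - F i a"
    if "i < j" "a \<le> b" for i a b
    using loc_integrable_absolutely_integrable[OF locF[of "Suc i"]] integral_rl_int_1[OF locF[of "Suc i"] that(2)] that
    unfolding stepF[OF that(1)] by auto
  then have C0: "AC_chain j UNIV F" by (auto simp: AC_chain_def)
  have Fpos: "F (j + i) x = \<gamma> i x" if "x > 0" for i x using that by (auto simp: F_def g_def)
  have C1: "AC_chain (j + m) {0<..} F"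
    unfolding AC_chain_def
  proof (intro allI ballI impI)
    fix i and a b :: real assume H: "i < j + m" "a \<in> {0<..}" "b \<in> {0<..}" "a \<le> b"
    show "F (Suc i) absolutely_integrable_on {a..b} \<and> integral {a..b} (F (Suc i)) = F i b - F i a"
    proof (cases "i < j")
      case True then show ?thesis using FAC H by auto
    next
      case False
      define l where "l = i - j"
      have l: "i = j + l" "l < m" using False H by (auto simp: l_def)
      have eq: "F (Suc i) x = \<gamma> (Suc l) x" if "x \<in> {a..b}" for x
        using Fpos[of x "Suc l"] that H l by simp
      have "F (Suc i) absolutely_integrable_on {a..b}"
        by (rule absolutely_integrable_spike[OF AC_chainD(1)[OF AC l(2) H(2-4)] negligible_empty]) (use eq in auto)
      moreover have "integral {a..b} (F (Suc i)) = integral {a..b} (\<gamma> (Suc l))"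
        by (rule Henstock_Kurzweil_Integration.integral_cong) (use eq in auto)
      ultimately show ?thesis
        using AC_chainD(2)[OF AC l(2) H(2-4)] Fpos[of a l] Fpos[of b l] H l by simp
    qed
  qed
  have io: "open {0::real<..}" "is_interval {0::real<..}" by (auto simp: is_interval_1)
  show "RL_differentiable_on \<nu> UNIV v"
    unfolding RL_differentiable_on_def j_def[symmetric] \<sigma>_def[symmetric] V_def[symmetric]
    by (rule AC_chain_imp_locally_AC[OF C0]) (use VF in auto)
  assume "k \<le> m"
  have C2: "AC_chain (j + k) {0<..} F" by (rule AC_chain_mono[OF C1]) (use \<open>k \<le> m\<close> in auto)
  show "RL_differentiable_on (\<nu> + real k) {0<..} v"
    unfolding RL_differentiable_on_def RL_order_add[OF \<nu>] j_def[symmetric] \<sigma>_def[symmetric] V_def[symmetric]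
    by (rule AC_chain_imp_locally_AC[OF C2 io]) (use VF in \<open>simp add: V_def \<sigma>_def\<close>)
  have "AE x in lebesgue. x \<in> {0<..} \<longrightarrow> iter_deriv (j + k) V x = F (j + k) x"
    by (rule AC_chain_iter_deriv(2)[OF C2 io]) (use VF in auto)
  then show "AE x in lebesgue. x > 0 \<longrightarrow> RL_deriv (\<nu> + real k) v x = \<gamma> k x"
    unfolding RL_deriv_def RL_order_add[OF \<nu>] j_def[symmetric] \<sigma>_def[symmetric] V_def[symmetric]
    by eventually_elim (auto simp: Fpos V_def \<sigma>_def)
qed

section \<open>Orthogonal expansions in square-integrable functions\<close>

definition L2 :: "real measure \<Rightarrow> (real \<Rightarrow> complex) set" where
  "L2 M = {f. f \<in> borel_measurable M \<and> integrable M (\<lambda>x. (cmod (f x))\<^sup>2)}"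

definition ip :: "real measure \<Rightarrow> (real \<Rightarrow> complex) \<Rightarrow> (real \<Rightarrow> complex) \<Rightarrow> complex" where
  "ip M f g = (LINT x|M. f x * cnj (g x))"

definition sqnorm :: "real measure \<Rightarrow> (real \<Rightarrow> complex) \<Rightarrow> real" where
  "sqnorm M f = (LINT x|M. (cmod (f x))\<^sup>2)"

lemma L2_measurable [measurable_dest]: "f \<in> L2 M \<Longrightarrow> f \<in> borel_measurable M"
  by (simp add: L2_def)

lemma cmod_add_sq: "(cmod (a + b))\<^sup>2 \<le> 2 * (cmod a)\<^sup>2 + 2 * (cmod b)\<^sup>2"
proof -
  have "(cmod (a + b))\<^sup>2 \<le> (cmod a + cmod b)\<^sup>2" by (intro power_mono norm_triangle_ineq) simp
  also have "\<dots> \<le> 2 * (cmod a)\<^sup>2 + 2 * (cmod b)\<^sup>2"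
    using zero_le_power2[of "cmod a - cmod b"] by (simp add: power2_eq_square algebra_simps)
  finally show ?thesis .
qed

lemma L2_add [intro]: assumes f: "f \<in> L2 M" and g: "g \<in> L2 M" shows "(\<lambda>x. f x + g x) \<in> L2 M"
proof -
  have [measurable]: "f \<in> borel_measurable M" "g \<in> borel_measurable M" using f g by (auto simp: L2_def)
  have "integrable M (\<lambda>x. 2 * (cmod (f x))\<^sup>2 + 2 * (cmod (g x))\<^sup>2)"
    using f g by (auto simp: L2_def)
  then have "integrable M (\<lambda>x. (cmod (f x + g x))\<^sup>2)"
    by (rule Bochner_Integration.integrable_bound) (auto intro!: AE_I2 order_trans[OF cmod_add_sq])
  then show ?thesis by (simp add: L2_def)
qed

lemma L2_cmult [intro]: "f \<in> L2 M \<Longrightarrow> (\<lambda>x. c * f x) \<in> L2 M"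
  by (auto simp: L2_def norm_mult power_mult_distrib)

lemma L2_diff [intro]: "f \<in> L2 M \<Longrightarrow> g \<in> L2 M \<Longrightarrow> (\<lambda>x. f x - g x) \<in> L2 M"
  using L2_add[of f M "\<lambda>x. (-1) * g x"] L2_cmult[of g M "-1"] by simp

lemma L2_0 [simp]: "(\<lambda>x. 0) \<in> L2 M"
  by (simp add: L2_def)

lemma L2_sum [intro]: "(\<And>i. i \<in> A \<Longrightarrow> f i \<in> L2 M) \<Longrightarrow> (\<lambda>x. \<Sum>i\<in>A. f i x) \<in> L2 M"
  by (induction A rule: infinite_finite_induct) auto

lemma ip_integrable:
  assumes f: "f \<in> L2 M" and g: "g \<in> L2 M"
  shows "integrable M (\<lambda>x. f x * cnj (g x))"
proof (rule Bochner_Integration.integrable_bound)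
  show "integrable M (\<lambda>x. (cmod (f x))\<^sup>2 + (cmod (g x))\<^sup>2)" using f g by (auto simp: L2_def)
  have [measurable]: "f \<in> borel_measurable M" "g \<in> borel_measurable M" using f g by (auto simp: L2_def)
  have "continuous_on UNIV cnj" by (intro continuous_intros)
  then have [measurable]: "cnj \<in> borel_measurable borel" by (rule borel_measurable_continuous_onI)
  show "(\<lambda>x. f x * cnj (g x)) \<in> borel_measurable M" by measurable
  have "cmod (f x) * cmod (g x) \<le> (cmod (f x))\<^sup>2 + (cmod (g x))\<^sup>2" for x
  proof -
    have "2 * (cmod (f x) * cmod (g x)) \<le> (cmod (f x))\<^sup>2 + (cmod (g x))\<^sup>2"
      using sum_squares_bound[of "cmod (f x)" "cmod (g x)"] by simp
    moreover have "0 \<le> cmod (f x) * cmod (g x)" by simp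
    ultimately show ?thesis by linarith
  qed
  then show "AE x in M. norm (f x * cnj (g x)) \<le> norm ((cmod (f x))\<^sup>2 + (cmod (g x))\<^sup>2)"
    by (auto simp: norm_mult)
qed

lemma ip_add_left: "f \<in> L2 M \<Longrightarrow> g \<in> L2 M \<Longrightarrow> h \<in> L2 M \<Longrightarrow> ip M (\<lambda>x. f x + g x) h = ip M f h + ip M g h"
  unfolding ip_def using ip_integrable by (simp add: distrib_right)

lemma ip_diff_left: "f \<in> L2 M \<Longrightarrow> g \<in> L2 M \<Longrightarrow> h \<in> L2 M \<Longrightarrow> ip M (\<lambda>x. f x - g x) h = ip M f h - ip M g h"
  unfolding ip_def using ip_integrable by (simp add: left_diff_distrib)

lemma ip_cmult_left: "ip M (\<lambda>x. c * f x) g = c * ip M f g"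
  unfolding ip_def by (simp add: mult.assoc)

lemma ip_commute: "ip M g f = cnj (ip M f g)"
  unfolding ip_def by (subst Bochner_Integration.integral_cnj[symmetric]) (simp add: mult.commute)

lemma ip_0 [simp]: "ip M (\<lambda>x. 0) g = 0" "ip M f (\<lambda>x. 0) = 0"
  by (simp_all add: ip_def)

lemma ip_sum_left:
  "(\<And>i. i \<in> A \<Longrightarrow> f i \<in> L2 M) \<Longrightarrow> g \<in> L2 M \<Longrightarrow> ip M (\<lambda>x. \<Sum>i\<in>A. f i x) g = (\<Sum>i\<in>A. ip M (f i) g)"
  by (induction A rule: infinite_finite_induct) (auto simp: ip_add_left L2_sum)

lemma ip_add_right: "f \<in> L2 M \<Longrightarrow> g \<in> L2 M \<Longrightarrow> h \<in> L2 M \<Longrightarrow> ip M h (\<lambda>x. f x + g x) = ip M h f + ip M h g"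
  by (subst (1 2 3) ip_commute) (simp add: ip_add_left)

lemma ip_diff_right: "f \<in> L2 M \<Longrightarrow> g \<in> L2 M \<Longrightarrow> h \<in> L2 M \<Longrightarrow> ip M h (\<lambda>x. f x - g x) = ip M h f - ip M h g"
  by (subst (1 2 3) ip_commute) (simp add: ip_diff_left)

lemma ip_cmult_right: "ip M g (\<lambda>x. c * f x) = cnj c * ip M g f"
  by (subst (1 2) ip_commute) (simp add: ip_cmult_left)

lemma ip_sum_right:
  "(\<And>i. i \<in> A \<Longrightarrow> f i \<in> L2 M) \<Longrightarrow> g \<in> L2 M \<Longrightarrow> ip M g (\<lambda>x. \<Sum>i\<in>A. f i x) = (\<Sum>i\<in>A. ip M g (f i))"
  by (subst (1 2) ip_commute) (simp add: ip_sum_left)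

lemma ip_self: "ip M f f = of_real (sqnorm M f)"
  unfolding ip_def sqnorm_def complex_norm_square[symmetric] by (rule integral_complex_of_real)

lemma sqnorm_nonneg [simp]: "sqnorm M f \<ge> 0"
  unfolding sqnorm_def by (intro integral_nonneg_AE) auto

lemma sqnorm_cmult: "sqnorm M (\<lambda>x. c * f x) = (cmod c)\<^sup>2 * sqnorm M f"
  unfolding sqnorm_def by (simp add: norm_mult power_mult_distrib)

lemma sqnorm_add_le:
  assumes "f \<in> L2 M" "g \<in> L2 M"
  shows "sqnorm M (\<lambda>x. f x + g x) \<le> 2 * sqnorm M f + 2 * sqnorm M g"
proof -
  have "sqnorm M (\<lambda>x. f x + g x) \<le> (LINT x|M. 2 * (cmod (f x))\<^sup>2 + 2 * (cmod (g x))\<^sup>2)"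
    unfolding sqnorm_def using L2_add[OF assms] assms
    by (intro integral_mono cmod_add_sq) (auto simp: L2_def)
  also have "\<dots> = 2 * sqnorm M f + 2 * sqnorm M g"
    unfolding sqnorm_def using assms by (subst Bochner_Integration.integral_add) (auto simp: L2_def)
  finally show ?thesis .
qed

lemma sqnorm_pythagoras:
  assumes "f \<in> L2 M" "g \<in> L2 M" "ip M f g = 0"
  shows "sqnorm M (\<lambda>x. f x + g x) = sqnorm M f + sqnorm M g"
proof -
  have "of_real (sqnorm M (\<lambda>x. f x + g x)) = (of_real (sqnorm M f + sqnorm M g) :: complex)"
    using assms L2_add[OF assms(1,2)] ip_commute[of M g f]
    by (simp add: ip_self[symmetric] ip_add_left ip_add_right)
  then show ?thesis by (simp only: of_real_eq_iff)
qed

definition orthogonal_family :: "real measure \<Rightarrow> nat set \<Rightarrow> (nat \<Rightarrow> real \<Rightarrow> complex) \<Rightarrow> bool" where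
  "orthogonal_family M A P \<longleftrightarrow> (\<forall>n\<in>A. P n \<in> L2 M \<and> sqnorm M (P n) > 0 \<and> (\<forall>m\<in>A. m \<noteq> n \<longrightarrow> ip M (P m) (P n) = 0))"

definition fourier_coeff :: "real measure \<Rightarrow> (nat \<Rightarrow> real \<Rightarrow> complex) \<Rightarrow> (real \<Rightarrow> complex) \<Rightarrow> nat \<Rightarrow> complex" where
  "fourier_coeff M P f n = ip M f (P n) / sqnorm M (P n)"

definition fourier_sum :: "real measure \<Rightarrow> nat set \<Rightarrow> (nat \<Rightarrow> real \<Rightarrow> complex) \<Rightarrow> (real \<Rightarrow> complex) \<Rightarrow> real \<Rightarrow> complex" where
  "fourier_sum M A P f x = (\<Sum>n\<in>A. fourier_coeff M P f n * P n x)"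

lemma orthogonal_sum_ip:
  assumes "orthogonal_family M A P" "finite A" "n \<in> A"
  shows "ip M (\<lambda>x. \<Sum>i\<in>A. a i * P i x) (P n) = a n * sqnorm M (P n)"
proof -
  have "ip M (\<lambda>x. \<Sum>i\<in>A. a i * P i x) (P n) = (\<Sum>i\<in>A. a i * ip M (P i) (P n))"
    using assms by (subst ip_sum_left) (auto simp: orthogonal_family_def ip_cmult_left)
  also have "\<dots> = (\<Sum>i\<in>{n}. a i * ip M (P i) (P n))"
    using assms by (intro sum.mono_neutral_right) (auto simp: orthogonal_family_def)
  finally show ?thesis by (simp add: ip_self)
qed

lemma orthogonal_sum_L2:
  "orthogonal_family M A P \<Longrightarrow> (\<lambda>x. \<Sum>i\<in>A. a i * P i x) \<in> L2 M"
  by (intro L2_sum L2_cmult) (auto simp: orthogonal_family_def)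

lemma fourier_residual_orthogonal:
  assumes P: "orthogonal_family M A P" "finite A" and f: "f \<in> L2 M"
  shows "ip M (\<lambda>x. f x - fourier_sum M A P f x) (\<lambda>x. \<Sum>i\<in>A. a i * P i x) = 0"
proof -
  have S: "(\<lambda>x. \<Sum>n\<in>A. fourier_coeff M P f n * P n x) \<in> L2 M"
    by (rule orthogonal_sum_L2[OF P(1)])
  have "ip M (\<lambda>x. f x - fourier_sum M A P f x) (P n) = 0" if "n \<in> A" for n
  proof -
    have n: "P n \<in> L2 M" "sqnorm M (P n) > 0" using P(1) that by (auto simp: orthogonal_family_def)
    have "ip M (\<lambda>x. f x - fourier_sum M A P f x) (P n) = ip M f (P n) - fourier_coeff M P f n * sqnorm M (P n)"
      unfolding fourier_sum_def by (simp only: ip_diff_left[OF f S n(1)] orthogonal_sum_ip[OF P that])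
    then show ?thesis using n by (simp add: fourier_coeff_def)
  qed
  moreover have "(\<lambda>x. f x - fourier_sum M A P f x) \<in> L2 M"
    unfolding fourier_sum_def by (rule L2_diff[OF f S])
  ultimately show ?thesis using P
    by (subst ip_sum_right) (auto simp: ip_cmult_right orthogonal_family_def)
qed

lemma sqnorm_fourier_sum:
  assumes P: "orthogonal_family M A P" "finite A"
  shows "sqnorm M (fourier_sum M A P f) = (\<Sum>n\<in>A. (cmod (ip M f (P n)))\<^sup>2 / sqnorm M (P n))"
proof -
  have S: "(\<lambda>x. \<Sum>n\<in>A. fourier_coeff M P f n * P n x) \<in> L2 M"
    by (rule orthogonal_sum_L2[OF P(1)])
  have L: "P n \<in> L2 M" if "n \<in> A" for n using P(1) that by (auto simp: orthogonal_family_def)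
  have "of_real (sqnorm M (fourier_sum M A P f)) = ip M (fourier_sum M A P f) (fourier_sum M A P f)"
    by (simp add: ip_self)
  also have "\<dots> = (\<Sum>n\<in>A. cnj (fourier_coeff M P f n) * ip M (fourier_sum M A P f) (P n))"
    unfolding fourier_sum_def using S L
    by (subst ip_sum_right) (auto simp: ip_cmult_right)
  also have "\<dots> = (\<Sum>n\<in>A. of_real ((cmod (ip M f (P n)))\<^sup>2 / sqnorm M (P n)))"
  proof (rule sum.cong)
    fix n assume n: "n \<in> A"
    then have pos: "sqnorm M (P n) > 0" using P(1) by (auto simp: orthogonal_family_def)
    have "ip M (fourier_sum M A P f) (P n) = fourier_coeff M P f n * sqnorm M (P n)"
      unfolding fourier_sum_def by (rule orthogonal_sum_ip[OF P n])
    then have "ip M (fourier_sum M A P f) (P n) = ip M f (P n)"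
      using pos by (simp add: fourier_coeff_def)
    then show "cnj (fourier_coeff M P f n) * ip M (fourier_sum M A P f) (P n) = of_real ((cmod (ip M f (P n)))\<^sup>2 / sqnorm M (P n))"
      by (simp only: fourier_coeff_def of_real_divide complex_norm_square) (simp add: mult.commute)
  qed simp
  finally show ?thesis by (simp only: of_real_sum[symmetric] of_real_eq_iff)
qed

text \<open>
  Pythagoras for the orthogonal splitting of \<open>f\<close> into its Fourier sum and the residual.
\<close>
lemma bessel_identity:
  assumes P: "orthogonal_family M A P" "finite A" and f: "f \<in> L2 M"
  shows "sqnorm M f = sqnorm M (\<lambda>x. f x - fourier_sum M A P f x) + (\<Sum>n\<in>A. (cmod (ip M f (P n)))\<^sup>2 / sqnorm M (P n))"
proof -
  have S: "fourier_sum M A P f \<in> L2 M" using orthogonal_sum_L2[OF P(1)] unfolding fourier_sum_def .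
  have "ip M (\<lambda>x. f x - fourier_sum M A P f x) (fourier_sum M A P f) = 0"
    using fourier_residual_orthogonal[OF P f] unfolding fourier_sum_def .
  from sqnorm_pythagoras[OF L2_diff[OF f S] S this] show ?thesis by (simp add: sqnorm_fourier_sum[OF P])
qed

lemma fourier_sum_best:
  assumes P: "orthogonal_family M A P" "finite A" and f: "f \<in> L2 M"
  shows "sqnorm M (\<lambda>x. f x - fourier_sum M A P f x) \<le> sqnorm M (\<lambda>x. f x - (\<Sum>i\<in>A. a i * P i x))"
proof -
  have S: "fourier_sum M A P f \<in> L2 M" using orthogonal_sum_L2[OF P(1)] unfolding fourier_sum_def .
  define b where "b = (\<lambda>i. fourier_coeff M P f i - a i)"
  have b: "(\<lambda>x. \<Sum>i\<in>A. b i * P i x) \<in> L2 M" by (rule orthogonal_sum_L2[OF P(1)])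
  have eq: "f x - (\<Sum>i\<in>A. a i * P i x) = (f x - fourier_sum M A P f x) + (\<Sum>i\<in>A. b i * P i x)" for x
    by (simp add: b_def fourier_sum_def left_diff_distrib sum_subtractf)
  show ?thesis
    unfolding eq
    using sqnorm_pythagoras[OF L2_diff[OF f S] b fourier_residual_orthogonal[OF P f]] by simp
qed

text \<open>
  The passage from coefficients to norms. The completeness of \<open>P\<close> bounds the norm of \<open>f\<close> by its coefficients, which
  are those of \<open>h\<close> for the family \<open>Q\<close>, and Bessel's inequality for \<open>Q\<close> bounds them by the norm of \<open>h\<close>.
\<close>
lemma sqnorm_le_by_coefficients:
  assumes P: "orthogonal_family M1 UNIV P" and Q: "orthogonal_family M2 {K..} Q"
    and f: "f \<in> L2 M1" and h: "h \<in> L2 M2"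
    and dense: "\<And>\<epsilon>. \<epsilon> > 0 \<Longrightarrow> \<exists>n a. sqnorm M1 (\<lambda>x. f x - (\<Sum>i<n. a i * P i x)) < \<epsilon>"
    and low: "\<And>n. n < K \<Longrightarrow> ip M1 f (P n) = 0"
    and high: "\<And>n. n \<ge> K \<Longrightarrow> ip M1 f (P n) = ip M2 h (Q n)"
    and C: "\<And>n. n \<ge> K \<Longrightarrow> sqnorm M2 (Q n) \<le> C * sqnorm M1 (P n)" "C \<ge> 0"
  shows "sqnorm M1 f \<le> C * sqnorm M2 h"
proof (rule field_le_epsilon)
  fix \<epsilon> :: real assume "\<epsilon> > 0"
  then obtain n a where na: "sqnorm M1 (\<lambda>x. f x - (\<Sum>i<n. a i * P i x)) < \<epsilon>" using dense by blast
  have P': "orthogonal_family M1 {..<n} P" using P by (auto simp: orthogonal_family_def)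
  have Q': "orthogonal_family M2 {K..<n} Q" using Q by (auto simp: orthogonal_family_def)
  have "sqnorm M1 f = sqnorm M1 (\<lambda>x. f x - fourier_sum M1 {..<n} P f x) + (\<Sum>i<n. (cmod (ip M1 f (P i)))\<^sup>2 / sqnorm M1 (P i))"
    by (rule bessel_identity[OF P' _ f]) simp
  also have "sqnorm M1 (\<lambda>x. f x - fourier_sum M1 {..<n} P f x) \<le> \<epsilon>"
    using fourier_sum_best[OF P' _ f, of a] na by simp
  also have "(\<Sum>i<n. (cmod (ip M1 f (P i)))\<^sup>2 / sqnorm M1 (P i)) = (\<Sum>i=K..<n. (cmod (ip M1 f (P i)))\<^sup>2 / sqnorm M1 (P i))"
    using low by (intro sum.mono_neutral_right) auto
  also have "\<dots> \<le> (\<Sum>i=K..<n. C * ((cmod (ip M2 h (Q i)))\<^sup>2 / sqnorm M2 (Q i)))"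
  proof (rule sum_mono)
    fix i assume i: "i \<in> {K..<n}"
    have p: "sqnorm M1 (P i) > 0" "sqnorm M2 (Q i) > 0" using i P Q by (auto simp: orthogonal_family_def)
    have "1 / sqnorm M1 (P i) \<le> C / sqnorm M2 (Q i)" using C(1)[of i] i p by (simp add: field_simps)
    then have "(cmod (ip M2 h (Q i)))\<^sup>2 * (1 / sqnorm M1 (P i)) \<le> (cmod (ip M2 h (Q i)))\<^sup>2 * (C / sqnorm M2 (Q i))"
      by (intro mult_left_mono) auto
    then show "(cmod (ip M1 f (P i)))\<^sup>2 / sqnorm M1 (P i) \<le> C * ((cmod (ip M2 h (Q i)))\<^sup>2 / sqnorm M2 (Q i))"
      using high[of i] i by (simp add: mult_ac)
  qed
  also have "\<dots> = C * (\<Sum>i=K..<n. (cmod (ip M2 h (Q i)))\<^sup>2 / sqnorm M2 (Q i))"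
    by (simp add: sum_distrib_left)
  also have "\<dots> \<le> C * sqnorm M2 h"
    using bessel_identity[OF Q' _ h] C(2) by (intro mult_left_mono) auto
  finally show "sqnorm M1 f \<le> C * sqnorm M2 h + \<epsilon>" by simp
qed

definition rpoly :: "complex poly \<Rightarrow> real \<Rightarrow> complex" where
  "rpoly p x = poly p (complex_of_real x)"

text \<open>
  Used instead of a bound on \<^const>\<open>degree\<close> because \<open>deg_less 0\<close> has to describe the space that consists of
  the zero polynomial only; it occurs when \<open>m = N + 1\<close>.
\<close>
definition deg_less :: "nat \<Rightarrow> complex poly \<Rightarrow> bool" where
  "deg_less n p \<longleftrightarrow> (\<forall>i\<ge>n. coeff p i = 0)"

lemma rpoly_simps: "rpoly (p + q) x = rpoly p x + rpoly q x" "rpoly (p - q) x = rpoly p x - rpoly q x" "rpoly (smult c p) x = c * rpoly p x"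
  "rpoly 0 x = 0" "rpoly (\<Sum>i\<in>A. r i) x = (\<Sum>i\<in>A. rpoly (r i) x)" "rpoly (monom c n) x = c * of_real x ^ n"
  by (simp_all add: rpoly_def poly_sum poly_monom)

lemma deg_less_0 [simp]: "deg_less 0 p \<longleftrightarrow> p = 0"
  by (auto simp: deg_less_def poly_eq_iff)

lemma deg_less_zero [simp]: "deg_less n 0" by (simp add: deg_less_def)

lemma deg_less_add [intro]: "deg_less n p \<Longrightarrow> deg_less n q \<Longrightarrow> deg_less n (p + q)"
  and deg_less_diff [intro]: "deg_less n p \<Longrightarrow> deg_less n q \<Longrightarrow> deg_less n (p - q)"
  and deg_less_smult [intro]: "deg_less n p \<Longrightarrow> deg_less n (smult c p)"
  by (auto simp: deg_less_def)

lemma deg_less_mono: "deg_less m p \<Longrightarrow> m \<le> n \<Longrightarrow> deg_less n p" by (auto simp: deg_less_def)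

lemma deg_less_sum [intro]: "(\<And>i. i \<in> A \<Longrightarrow> deg_less n (r i)) \<Longrightarrow> deg_less n (\<Sum>i\<in>A. r i)"
  by (simp add: deg_less_def coeff_sum)

lemma deg_less_Suc_degree: "deg_less (Suc n) p \<longleftrightarrow> degree p \<le> n"
  unfolding deg_less_def using coeff_eq_0[of p] degree_le[of n p] by (auto simp: Suc_le_eq)

lemma deg_less_ex: "\<exists>n. deg_less n p"
  using deg_less_Suc_degree[of "degree p" p] by blast

lemma deg_less_diff_lead:
  assumes "deg_less (Suc n) p" "deg_less (Suc n) P" "coeff P n = 1"
  shows "deg_less n (p - smult (coeff p n) P)"
  unfolding deg_less_def
proof (intro allI impI)
  fix i assume "n \<le> i"
  then consider "i = n" | "Suc n \<le> i" by linarith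
  then show "coeff (p - smult (coeff p n) P) i = 0"
    using assms by cases (auto simp: deg_less_def)
qed

text \<open>
  Measures with finite moments of all orders whose support is infinite: the setting of orthogonal polynomials.
\<close>
locale poly_measure =
  fixes M :: "real measure"
  assumes rpoly_L2 [simp, intro]: "rpoly p \<in> L2 M"
    and rpoly_pos: "p \<noteq> 0 \<Longrightarrow> sqnorm M (rpoly p) > 0"
begin

lemma ip_rpoly_linear:
  "ip M (rpoly (p + q)) (rpoly r) = ip M (rpoly p) (rpoly r) + ip M (rpoly q) (rpoly r)"
  "ip M (rpoly (p - q)) (rpoly r) = ip M (rpoly p) (rpoly r) - ip M (rpoly q) (rpoly r)"
  "ip M (rpoly (smult c p)) (rpoly r) = c * ip M (rpoly p) (rpoly r)"
  unfolding rpoly_simps by (simp_all add: ip_add_left ip_diff_left ip_cmult_left)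

lemma ip_rpoly_right:
  assumes "f \<in> L2 M"
  shows "ip M f (rpoly (p + q)) = ip M f (rpoly p) + ip M f (rpoly q)"
  "ip M f (rpoly (p - q)) = ip M f (rpoly p) - ip M f (rpoly q)"
  "ip M f (rpoly (smult c p)) = cnj c * ip M f (rpoly p)"
  unfolding rpoly_simps using assms by (simp_all add: ip_add_right ip_diff_right ip_cmult_right)

lemma rpoly_eq_0: "ip M (rpoly p) (rpoly p) = 0 \<Longrightarrow> p = 0"
  using rpoly_pos[of p] by (auto simp: ip_self)

text \<open>
  One step of the Gram-Schmidt process: the residual of \<open>x\<^sup>n\<close> is the monic orthogonal polynomial of degree \<open>n\<close>.
\<close>
lemma orthogonal_projection_step:
  assumes ex: "\<And>f. f \<in> L2 M \<Longrightarrow> \<exists>p. deg_less n p \<and> (\<forall>r. deg_less n r \<longrightarrow> ip M (\<lambda>x. f x - rpoly p x) (rpoly r) = 0)"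
  shows "\<exists>p. coeff p n = 1 \<and> deg_less (Suc n) p \<and> (\<forall>r. deg_less n r \<longrightarrow> ip M (rpoly p) (rpoly r) = 0)"
proof -
  obtain q where q: "deg_less n q" "\<forall>r. deg_less n r \<longrightarrow> ip M (\<lambda>x. rpoly (monom 1 n) x - rpoly q x) (rpoly r) = 0"
    using ex[OF rpoly_L2] by blast
  show ?thesis
  proof (intro exI[of _ "monom 1 n - q"] conjI)
    show "coeff (monom 1 n - q) n = 1" using q(1) by (simp add: deg_less_def)
    show "deg_less (Suc n) (monom 1 n - q)" using q(1) by (auto simp: deg_less_def)
    show "\<forall>r. deg_less n r \<longrightarrow> ip M (rpoly (monom 1 n - q)) (rpoly r) = 0"
      using q(2) by (simp add: rpoly_simps(2)[abs_def])
  qed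
qed

lemma orthogonal_projection_exists:
  "f \<in> L2 M \<Longrightarrow> \<exists>p. deg_less n p \<and> (\<forall>r. deg_less n r \<longrightarrow> ip M (\<lambda>x. f x - rpoly p x) (rpoly r) = 0)"
proof (induction n arbitrary: f)
  case 0
  then show ?case by (auto simp: rpoly_simps(4)[abs_def])
next
  case (Suc n)
  obtain P where P: "coeff P n = 1" "deg_less (Suc n) P" "\<And>r. deg_less n r \<Longrightarrow> ip M (rpoly P) (rpoly r) = 0"
    using orthogonal_projection_step[OF Suc.IH] by blast
  obtain p where p: "deg_less n p" "\<And>r. deg_less n r \<Longrightarrow> ip M (\<lambda>x. f x - rpoly p x) (rpoly r) = 0"
    using Suc.IH[OF Suc.prems] by blast
  have "P \<noteq> 0" using P(1) by auto
  then have pos: "sqnorm M (rpoly P) > 0" by (rule rpoly_pos)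
  define c where "c = ip M (\<lambda>x. f x - rpoly p x) (rpoly P) / sqnorm M (rpoly P)"
  define q where "q = p + smult c P"
  have fp: "(\<lambda>x. f x - rpoly p x) \<in> L2 M" using Suc.prems by blast
  have split: "(\<lambda>x. f x - rpoly q x) = (\<lambda>x. (f x - rpoly p x) - rpoly (smult c P) x)"
    by (simp add: q_def rpoly_simps algebra_simps)
  have 1: "ip M (\<lambda>x. f x - rpoly q x) (rpoly r) = 0" if "deg_less n r" for r
    unfolding split using that P(3) p(2) fp by (simp add: ip_diff_left ip_rpoly_linear)
  have 2: "ip M (\<lambda>x. f x - rpoly q x) (rpoly P) = 0"
    unfolding split using fp pos by (simp add: ip_diff_left ip_rpoly_linear ip_self c_def)
  show ?case
  proof (intro exI[of _ q] conjI allI impI)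
    show "deg_less (Suc n) q"
      unfolding q_def using p(1) P(2) deg_less_mono[of n p "Suc n"] by auto
    fix r assume r: "deg_less (Suc n) r"
    define r' where "r' = r - smult (coeff r n) P"
    have r': "deg_less n r'"
      unfolding r'_def by (rule deg_less_diff_lead[OF r P(2,1)])
    have rr: "r = r' + smult (coeff r n) P" by (simp add: r'_def)
    have "(\<lambda>x. f x - rpoly q x) \<in> L2 M" using Suc.prems by blast
    then show "ip M (\<lambda>x. f x - rpoly q x) (rpoly r) = 0"
      using 1[OF r'] 2 by (subst rr) (simp add: ip_rpoly_right)
  qed
qed

definition orthopoly :: "nat \<Rightarrow> complex poly" where
  "orthopoly n = (SOME p. coeff p n = 1 \<and> deg_less (Suc n) p \<and> (\<forall>r. deg_less n r \<longrightarrow> ip M (rpoly p) (rpoly r) = 0))"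

lemma orthopoly:
  shows coeff_orthopoly: "coeff (orthopoly n) n = 1" and deg_orthopoly: "deg_less (Suc n) (orthopoly n)"
    and orthopoly_orthogonal: "deg_less n r \<Longrightarrow> ip M (rpoly (orthopoly n)) (rpoly r) = 0"
  using someI_ex[OF orthogonal_projection_step[OF orthogonal_projection_exists], of n]
  unfolding orthopoly_def by blast+

text \<open>
  This lets the action of an operator on an orthogonal polynomial be determined from its leading coefficient.
\<close>
lemma orthopoly_unique:
  assumes "deg_less (Suc n) p" "\<And>r. deg_less n r \<Longrightarrow> ip M (rpoly p) (rpoly r) = 0"
  shows "p = smult (coeff p n) (orthopoly n)"
proof -
  define d where "d = p - smult (coeff p n) (orthopoly n)"
  have "deg_less n d"
    unfolding d_def by (rule deg_less_diff_lead[OF assms(1) deg_orthopoly coeff_orthopoly])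
  then have "ip M (rpoly d) (rpoly d) = 0"
    using assms(2) orthopoly_orthogonal[of n d] by (subst (1) d_def) (simp add: ip_rpoly_linear)
  then have "d = 0" by (rule rpoly_eq_0)
  then show ?thesis by (simp add: d_def)
qed

lemma orthopoly_nonzero: "orthopoly n \<noteq> 0"
  using coeff_orthopoly[of n] by auto

lemma orthogonal_family_orthopoly: "orthogonal_family M UNIV (\<lambda>n. rpoly (orthopoly n))"
  unfolding orthogonal_family_def
proof (intro ballI conjI impI)
  fix n m :: nat
  show "sqnorm M (rpoly (orthopoly n)) > 0" by (intro rpoly_pos orthopoly_nonzero)
  assume "m \<noteq> n"
  then consider "m < n" | "n < m" by linarith
  then show "ip M (rpoly (orthopoly m)) (rpoly (orthopoly n)) = 0"
  proof cases
    case 1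
    then have "ip M (rpoly (orthopoly n)) (rpoly (orthopoly m)) = 0"
      by (intro orthopoly_orthogonal deg_less_mono[OF deg_orthopoly]) auto
    then show ?thesis by (subst ip_commute) simp
  next
    case 2
    then show ?thesis by (intro orthopoly_orthogonal deg_less_mono[OF deg_orthopoly]) auto
  qed
qed auto

lemma rpoly_span_orthopoly:
  "deg_less n p \<Longrightarrow> \<exists>a. \<forall>x. rpoly p x = (\<Sum>i<n. a i * rpoly (orthopoly i) x)"
proof (induction n arbitrary: p)
  case (Suc n)
  define d where "d = p - smult (coeff p n) (orthopoly n)"
  have "deg_less n d"
    unfolding d_def by (rule deg_less_diff_lead[OF Suc.prems deg_orthopoly coeff_orthopoly])
  then obtain a where a: "\<And>x. rpoly d x = (\<Sum>i<n. a i * rpoly (orthopoly i) x)" using Suc.IH by blast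
  have "rpoly p x = (\<Sum>i<Suc n. (if i < n then a i else coeff p n) * rpoly (orthopoly i) x)" for x
  proof -
    have "rpoly p x = rpoly d x + coeff p n * rpoly (orthopoly n) x" by (simp add: d_def rpoly_simps)
    also have "\<dots> = (\<Sum>i<n. (if i < n then a i else coeff p n) * rpoly (orthopoly i) x) + coeff p n * rpoly (orthopoly n) x"
      unfolding a by (intro arg_cong2[of _ _ _ _ "(+)"] sum.cong) auto
    finally show ?thesis by simp
  qed
  then show ?case by (intro exI[of _ "\<lambda>i. if i < n then a i else coeff p n"] allI)
qed (simp add: rpoly_simps)

lemma residual_sqnorm_le:
  assumes f: "f \<in> L2 M" and p: "deg_less n p" "\<And>r. deg_less n r \<Longrightarrow> ip M (\<lambda>x. f x - rpoly p x) (rpoly r) = 0"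
  shows "sqnorm M (\<lambda>x. f x - rpoly p x) \<le> sqnorm M f"
proof -
  have d: "(\<lambda>x. f x - rpoly p x) \<in> L2 M" using f by blast
  have "sqnorm M (\<lambda>x. (f x - rpoly p x) + rpoly p x) = sqnorm M (\<lambda>x. f x - rpoly p x) + sqnorm M (rpoly p)"
    by (rule sqnorm_pythagoras[OF d rpoly_L2 p(2)[OF p(1)]])
  then show ?thesis by simp
qed

end

section \<open>Density of the polynomials for Laguerre weights\<close>

text \<open>
  The measure \<open>x\<^sup>a e\<^sup>-\<^sup>\<beta>\<^sup>x dx\<close> on the half line, whose orthogonal polynomials are the scaled generalized Laguerre
  polynomials.
\<close>
definition lag :: "real \<Rightarrow> real \<Rightarrow> real measure" where
  "lag a \<beta> = density (lebesgue_on {0<..}) (\<lambda>x. ennreal (x powr a * exp (- \<beta> * x)))"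

lemma borel_imp_lebesgue_on: "f \<in> borel_measurable borel \<Longrightarrow> f \<in> borel_measurable (lebesgue_on S)"
  by (intro measurable_restrict_space1 borel_imp_lebesgue)

lemma measurable_lag: "f \<in> borel_measurable (lag a \<beta>) \<longleftrightarrow> f \<in> borel_measurable (lebesgue_on {0<..})"
  by (simp add: lag_def)

lemma borel_imp_lag [intro]: "f \<in> borel_measurable borel \<Longrightarrow> f \<in> borel_measurable (lag a \<beta>)"
  by (simp add: measurable_lag borel_imp_lebesgue_on)

lemma space_lag [simp]: "space (lag a \<beta>) = {0<..}"
  by (simp add: lag_def space_restrict_space)

lemma weight_measurable: "(\<lambda>x::real. x powr a * exp (- \<beta> * x)) \<in> borel_measurable (lebesgue_on {0<..})"
  by (intro borel_imp_lebesgue_on) measurable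

lemma AE_lag: "(AE x in lag a \<beta>. P x) \<longleftrightarrow> (AE x in lebesgue. x > 0 \<longrightarrow> P x)"
proof -
  have "(AE x in lag a \<beta>. P x) \<longleftrightarrow> (AE x in lebesgue_on {0<..}. 0 < ennreal (x powr a * exp (- \<beta> * x)) \<longrightarrow> P x)"
    unfolding lag_def by (rule AE_density) (intro measurable_compose[OF weight_measurable] measurable_ennreal)
  also have "\<dots> \<longleftrightarrow> (AE x in lebesgue. x > 0 \<longrightarrow> P x)"
    by (subst AE_restrict_space_iff) (auto intro!: AE_cong)
  finally show ?thesis .
qed

lemma
  fixes f :: "real \<Rightarrow> 'b::{banach, second_countable_topology}"
  assumes "f \<in> borel_measurable (lebesgue_on {0<..})"
  shows integrable_lag: "integrable (lag a \<beta>) f \<longleftrightarrow> integrable (lebesgue_on {0<..}) (\<lambda>x. (x powr a * exp (- \<beta> * x)) *\<^sub>R f x)"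
    and integral_lag: "integral\<^sup>L (lag a \<beta>) f = (LINT x|lebesgue_on {0<..}. (x powr a * exp (- \<beta> * x)) *\<^sub>R f x)"
  unfolding lag_def using assms weight_measurable[of a \<beta>]
  by (simp_all add: integrable_density integral_density)

lemma integrable_powr_exp:
  fixes a c :: real
  assumes "a > -1" "c > 0"
  shows "integrable (lebesgue_on {0<..}) (\<lambda>x. x powr a * exp (- c * x))"
proof -
  have "(\<lambda>t. complex_of_real t powr (complex_of_real (a + 1) - 1) / of_real (exp (c * t))) absolutely_integrable_on {0<..}"
    by (rule absolutely_integrable_Gamma_integral) (use assms in auto)
  then have "integrable (lebesgue_on {0<..}) (\<lambda>t. norm (complex_of_real t powr (complex_of_real (a + 1) - 1) / of_real (exp (c * t))))"
    unfolding set_integrable_def by (subst integrable_restrict_space) (auto dest: integrable_norm simp: norm_mult)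
  then show ?thesis
  proof (rule Bochner_Integration.integrable_cong[THEN iffD1, rotated -1])
    fix x :: real assume "x \<in> space (lebesgue_on {0<..})"
    then have x: "x > 0" by (simp add: space_restrict_space)
    have "norm (complex_of_real x powr (complex_of_real (a + 1) - 1)) = x powr a"
      using x by (subst norm_powr_real_powr) auto
    then show "norm (complex_of_real x powr (complex_of_real (a + 1) - 1) / of_real (exp (c * x))) = x powr a * exp (- c * x)"
      by (simp add: norm_divide exp_minus field_simps)
  qed simp
qed

lemma set_integrable_powr_exp:
  fixes a c :: real
  assumes "a > -1" "c > 0"
  shows "set_integrable lborel {0<..} (\<lambda>x. x powr a * exp (- c * x))"
proof -
  have "integrable lebesgue (\<lambda>x. indicator {0<..} x *\<^sub>R (x powr a * exp (- c * x)))"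
    using integrable_powr_exp[OF assms] by (subst (asm) integrable_restrict_space) auto
  then show ?thesis unfolding set_integrable_def by (subst (asm) integrable_completion) auto
qed

lemma integrable_lag_moment:
  assumes "a > -1" "s < \<beta>"
  shows "integrable (lag a \<beta>) (\<lambda>x. x ^ n * exp (s * x))"
proof (subst integrable_lag)
  show "(\<lambda>x::real. x ^ n * exp (s * x)) \<in> borel_measurable (lebesgue_on {0<..})"
    by (intro borel_imp_lebesgue_on) measurable
  have "integrable (lebesgue_on {0<..}) (\<lambda>x. x powr (a + real n) * exp (- (\<beta> - s) * x))"
    by (rule integrable_powr_exp) (use assms in auto)
  then show "integrable (lebesgue_on {0<..}) (\<lambda>x. (x powr a * exp (- \<beta> * x)) *\<^sub>R (x ^ n * exp (s * x)))"
  proof (rule Bochner_Integration.integrable_cong[THEN iffD1, rotated -1])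
    fix x :: real assume "x \<in> space (lebesgue_on {0<..})"
    then have x: "x > 0" by (simp add: space_restrict_space)
    have "exp (- (\<beta> - s) * x) = exp (- \<beta> * x) * exp (s * x)"
      by (simp add: algebra_simps flip: exp_add)
    then show "x powr (a + real n) * exp (- (\<beta> - s) * x) = (x powr a * exp (- \<beta> * x)) *\<^sub>R (x ^ n * exp (s * x))"
      using x by (simp add: powr_add powr_realpow mult_ac)
  qed simp
qed

lemma L2_lag_monomial_exp:
  assumes "a > -1" "2 * s < \<beta>"
  shows "(\<lambda>x. of_real (x ^ n * exp (s * x))) \<in> L2 (lag a \<beta>)"
proof -
  have "(\<lambda>x::real. complex_of_real (x ^ n * exp (s * x))) \<in> borel_measurable (lag a \<beta>)"
    by (rule borel_imp_lag) measurable
  moreover have "integrable (lag a \<beta>) (\<lambda>x. x ^ (2 * n) * exp ((2 * s) * x))"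
    by (rule integrable_lag_moment) (use assms in auto)
  moreover have "x ^ (2 * n) * exp ((2 * s) * x) = (cmod (of_real (x ^ n * exp (s * x))))\<^sup>2" for x :: real
    by (simp add: power_mult_distrib power_mult[symmetric] exp_double[symmetric] mult_ac del: of_real_mult of_real_power)
  ultimately show ?thesis by (simp add: L2_def del: of_real_mult of_real_power)
qed

text \<open>
  A polynomial of norm \<open>0\<close> vanishes almost everywhere on the half line and hence at infinitely many points.
\<close>
lemma poly_measure_lag:
  assumes "a > -1" "\<beta> > 0"
  shows "poly_measure (lag a \<beta>)"
proof
  fix p
  have "(\<lambda>x. \<Sum>i\<le>degree p. coeff p i * of_real (x ^ i * exp (0 * x))) \<in> L2 (lag a \<beta>)"
    by (intro L2_sum L2_cmult L2_lag_monomial_exp) (use assms in auto)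
  then show pL: "rpoly p \<in> L2 (lag a \<beta>)"
    by (simp add: rpoly_def[abs_def] poly_altdef)
  assume "p \<noteq> 0"
  show "sqnorm (lag a \<beta>) (rpoly p) > 0"
  proof (rule ccontr)
    assume "\<not> sqnorm (lag a \<beta>) (rpoly p) > 0"
    then have "sqnorm (lag a \<beta>) (rpoly p) = 0" using sqnorm_nonneg[of "lag a \<beta>" "rpoly p"] by linarith
    then have "AE x in lag a \<beta>. (cmod (rpoly p x))\<^sup>2 = 0"
      using pL unfolding sqnorm_def by (subst (asm) integral_nonneg_eq_0_iff_AE) (auto simp: L2_def)
    then have "AE x in lebesgue. x > 0 \<longrightarrow> rpoly p x = 0" unfolding AE_lag by simp
    then have 1: "negligible {x. \<not> (x > 0 \<longrightarrow> rpoly p x = 0)}" by (rule AE_lebesgue_imp_negligible)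
    have "finite {z. poly p z = 0}" using \<open>p \<noteq> 0\<close> by (rule poly_roots_finite)
    then have "finite (complex_of_real -` {z. poly p z = 0})"
      by (rule finite_vimageI) (simp add: inj_def)
    then have 2: "negligible (complex_of_real -` {z. poly p z = 0})" by (rule negligible_finite)
    have "negligible {0::real<..}"
      by (rule negligible_subset[OF negligible_Un[OF 1 2]]) (auto simp: rpoly_def)
    moreover have "\<not> negligible {0::real<..}" by (rule open_not_negligible) auto
    ultimately show False by simp
  qed
qed

context poly_measure
begin

definition approx :: "(real \<Rightarrow> complex) \<Rightarrow> bool" where
  "approx f \<longleftrightarrow> f \<in> L2 M \<and> (\<forall>\<epsilon>>0. \<exists>p. sqnorm M (\<lambda>x. f x - rpoly p x) < \<epsilon>)"

lemma approxD: "approx f \<Longrightarrow> f \<in> L2 M" by (simp add: approx_def)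

lemma approxE:
  assumes "approx f" "\<epsilon> > 0" obtains p where "sqnorm M (\<lambda>x. f x - rpoly p x) < \<epsilon>"
  using assms unfolding approx_def by blast

lemma approx_rpoly: "approx (rpoly p)"
  unfolding approx_def by (auto intro!: exI[of _ p] simp: sqnorm_def)

lemma approx_closure:
  assumes f: "f \<in> L2 M" and ex: "\<And>\<epsilon>. \<epsilon> > 0 \<Longrightarrow> \<exists>g. approx g \<and> sqnorm M (\<lambda>x. f x - g x) < \<epsilon>"
  shows "approx f"
  unfolding approx_def
proof (intro conjI allI impI)
  fix \<epsilon> :: real assume "\<epsilon> > 0"
  then have e: "\<epsilon> / 4 > 0" by simp
  obtain g where g: "approx g" "sqnorm M (\<lambda>x. f x - g x) < \<epsilon> / 4" using ex[OF e] by blast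
  obtain p where p: "sqnorm M (\<lambda>x. g x - rpoly p x) < \<epsilon> / 4" using approxE[OF g(1) e] .
  have "sqnorm M (\<lambda>x. (f x - g x) + (g x - rpoly p x)) \<le> 2 * sqnorm M (\<lambda>x. f x - g x) + 2 * sqnorm M (\<lambda>x. g x - rpoly p x)"
    using f approxD[OF g(1)] by (intro sqnorm_add_le) auto
  also have "\<dots> < \<epsilon>" using g(2) p by simp
  finally show "\<exists>p. sqnorm M (\<lambda>x. f x - rpoly p x) < \<epsilon>" by (intro exI[of _ p]) simp
qed (fact f)

lemma approx_add:
  assumes f: "approx f" and g: "approx g" shows "approx (\<lambda>x. f x + g x)"
  unfolding approx_def
proof (intro conjI allI impI)
  show "(\<lambda>x. f x + g x) \<in> L2 M" using approxD[OF f] approxD[OF g] by blast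
  fix \<epsilon> :: real assume "\<epsilon> > 0"
  then have e: "\<epsilon> / 4 > 0" by simp
  obtain p where p: "sqnorm M (\<lambda>x. f x - rpoly p x) < \<epsilon> / 4" using approxE[OF f e] .
  obtain q where q: "sqnorm M (\<lambda>x. g x - rpoly q x) < \<epsilon> / 4" using approxE[OF g e] .
  have "sqnorm M (\<lambda>x. (f x - rpoly p x) + (g x - rpoly q x)) \<le> 2 * sqnorm M (\<lambda>x. f x - rpoly p x) + 2 * sqnorm M (\<lambda>x. g x - rpoly q x)"
    using approxD[OF f] approxD[OF g] by (intro sqnorm_add_le) auto
  also have "\<dots> < \<epsilon>" using p q by simp
  finally show "\<exists>p. sqnorm M (\<lambda>x. f x + g x - rpoly p x) < \<epsilon>" by (intro exI[of _ "p + q"]) (simp add: rpoly_simps algebra_simps)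
qed

lemma approx_cmult:
  assumes f: "approx f" shows "approx (\<lambda>x. c * f x)"
  unfolding approx_def
proof (intro conjI allI impI)
  show "(\<lambda>x. c * f x) \<in> L2 M" using approxD[OF f] by blast
  fix \<epsilon> :: real assume "\<epsilon> > 0"
  define C where "C = (cmod c)\<^sup>2 + 1"
  have C: "C > 0" by (simp add: C_def add_nonneg_pos)
  obtain p where p: "sqnorm M (\<lambda>x. f x - rpoly p x) < \<epsilon> / C" using approxE[OF f divide_pos_pos[OF \<open>\<epsilon> > 0\<close> C]] .
  have "sqnorm M (\<lambda>x. c * (f x - rpoly p x)) \<le> C * sqnorm M (\<lambda>x. f x - rpoly p x)"
    unfolding sqnorm_cmult C_def by (intro mult_right_mono) auto
  also have "\<dots> < \<epsilon>" using p C by (simp add: field_simps)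
  finally show "\<exists>p. sqnorm M (\<lambda>x. c * f x - rpoly p x) < \<epsilon>"
    by (intro exI[of _ "smult c p"]) (simp add: rpoly_simps algebra_simps)
qed

lemma approx_0: "approx (\<lambda>x. 0)"
  using approx_rpoly[of 0] by (simp add: rpoly_simps(4)[abs_def])

lemma approx_sum: "(\<And>i. i \<in> A \<Longrightarrow> approx (f i)) \<Longrightarrow> approx (\<lambda>x. \<Sum>i\<in>A. f i x)"
  by (induction A rule: infinite_finite_induct) (auto intro: approx_add approx_0)

text \<open>
  Dominated convergence, with \<open>4 w\<^sup>2\<close> as the dominating function of the squared differences.
\<close>
lemma approx_dominated:
  assumes g: "\<And>n. approx (g n)" and f: "f \<in> borel_measurable M"
    and lim: "AE x in M. (\<lambda>n. g n x) \<longlonglongrightarrow> f x"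
    and w: "integrable M (\<lambda>x. (w x)\<^sup>2)" and bound: "\<And>n. AE x in M. cmod (g n x) \<le> w x"
  shows "approx f"
proof -
  have gm [measurable]: "g n \<in> borel_measurable M" for n using approxD[OF g[of n]] by (simp add: L2_def)
  note f [measurable]
  have "AE x in M. \<forall>n. cmod (g n x) \<le> w x" using bound by (simp add: AE_all_countable)
  with lim have B: "AE x in M. cmod (f x) \<le> w x \<and> (\<forall>n. cmod (g n x) \<le> w x)"
  proof eventually_elim
    case (elim x)
    have "(\<lambda>n. cmod (g n x)) \<longlonglongrightarrow> cmod (f x)" using elim(1) by (rule tendsto_norm)
    then have "cmod (f x) \<le> w x" by (rule LIMSEQ_le_const2) (use elim in auto)
    then show ?case using elim by auto
  qed
  have fL: "f \<in> L2 M"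
    unfolding L2_def
  proof (intro CollectI conjI f)
    show "integrable M (\<lambda>x. (cmod (f x))\<^sup>2)"
      by (rule Bochner_Integration.integrable_bound[OF w])
         (use B in \<open>auto elim!: eventually_mono intro!: power_mono\<close>)
  qed
  have "(\<lambda>n. LINT x|M. (cmod (f x - g n x))\<^sup>2) \<longlonglongrightarrow> (LINT x|M. 0)"
  proof (rule integral_dominated_convergence)
    show "integrable M (\<lambda>x. 4 * (w x)\<^sup>2)" using w by simp
    show "AE x in M. (\<lambda>n. (cmod (f x - g n x))\<^sup>2) \<longlonglongrightarrow> 0"
      using lim
    proof eventually_elim
      case (elim x)
      have "(\<lambda>n. (cmod (f x - g n x))\<^sup>2) \<longlonglongrightarrow> (cmod (f x - f x))\<^sup>2"
        using elim by (intro tendsto_intros)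
      then show ?case by simp
    qed
    show "AE x in M. norm ((cmod (f x - g n x))\<^sup>2) \<le> 4 * (w x)\<^sup>2" for n
      using B
    proof eventually_elim
      case (elim x)
      have "cmod (f x - g n x) \<le> cmod (f x) + cmod (g n x)" by (rule norm_triangle_ineq4)
      then have "cmod (f x - g n x) \<le> 2 * w x" using elim by (auto simp: add_mono dest!: spec[of _ n])
      then have "(cmod (f x - g n x))\<^sup>2 \<le> (2 * w x)\<^sup>2" by (rule power_mono) simp
      then show ?case by (simp add: power_mult_distrib)
    qed
  qed measurable
  then have lim0: "(\<lambda>n. sqnorm M (\<lambda>x. f x - g n x)) \<longlonglongrightarrow> 0" by (simp add: sqnorm_def)
  show ?thesis
  proof (rule approx_closure[OF fL])
    fix \<epsilon> :: real assume "\<epsilon> > 0"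
    from order_tendstoD(2)[OF lim0 this] obtain n where "sqnorm M (\<lambda>x. f x - g n x) < \<epsilon>"
      by (auto simp: eventually_sequentially)
    then show "\<exists>g. approx g \<and> sqnorm M (\<lambda>x. f x - g x) < \<epsilon>" using g by blast
  qed
qed

lemma dense_orthopoly:
  assumes "approx f" "\<epsilon> > 0"
  shows "\<exists>n a. sqnorm M (\<lambda>x. f x - (\<Sum>i<n. a i * rpoly (orthopoly i) x)) < \<epsilon>"
proof -
  obtain p where p: "sqnorm M (\<lambda>x. f x - rpoly p x) < \<epsilon>" using assms by (auto simp: approx_def)
  obtain n where "deg_less n p" using deg_less_ex by blast
  then obtain a where "\<forall>x. rpoly p x = (\<Sum>i<n. a i * rpoly (orthopoly i) x)" using rpoly_span_orthopoly by blast
  then show ?thesis using p by auto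
qed

end

lemma exp_partial_sum_bound:
  fixes y :: real assumes "y \<ge> 0"
  shows "\<bar>\<Sum>i<n. (- y) ^ i / fact i\<bar> \<le> exp y"
proof -
  have "\<bar>\<Sum>i<n. (- y) ^ i / fact i\<bar> \<le> (\<Sum>i<n. \<bar>(- y) ^ i / fact i\<bar>)" by (rule sum_abs)
  also have "\<dots> = (\<Sum>i<n. y ^ i / fact i)" using assms by (simp add: abs_mult power_abs)
  also have "\<dots> \<le> (\<Sum>i. y ^ i / fact i)"
    using assms summable_exp[of y] by (intro sum_le_suminf) (auto simp: field_simps)
  also have "\<dots> = exp y" by (simp add: exp_def divide_inverse mult_ac)
  finally show ?thesis .
qed

text \<open>
  The Taylor polynomials of \<open>e\<^sup>-\<^sup>s\<^sup>x\<close> are dominated by \<open>e\<^sup>s\<^sup>x\<close>, which is square integrable for the weight only if \<open>2s < \<beta>\<close>.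
  Faster decay is therefore reached in steps of size \<open>s = \<beta>/4\<close>, each multiplying the functions already reached by
  these Taylor polynomials.
\<close>
lemma approx_lag_exp:
  assumes a: "a > -1" and \<beta>: "\<beta> > 0" and s: "s = \<beta> / 4"
  shows "poly_measure.approx (lag a \<beta>) (\<lambda>x. of_real (x ^ n * exp (- (real k * s * x))))"
proof -
  interpret poly_measure "lag a \<beta>" by (rule poly_measure_lag[OF a \<beta>])
  show ?thesis
  proof (induction k arbitrary: n)
    case 0
    show ?case using approx_rpoly[of "monom 1 n"] by (simp add: rpoly_simps(6)[abs_def])
  next
    case (Suc k)
    define c where "c = (\<lambda>i. complex_of_real ((- s) ^ i / fact i))"
    define g where "g = (\<lambda>N x. \<Sum>i<N. c i * of_real (x ^ (n + i) * exp (- (real k * s * x))))"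
    have g: "approx (g N)" for N
      unfolding g_def by (intro approx_sum approx_cmult Suc.IH)
    have g_eq: "g N x = of_real (x ^ n * exp (- (real k * s * x)) * (\<Sum>i<N. (- (s * x)) ^ i / fact i))" for N x
    proof -
      have "g N x = of_real (\<Sum>i<N. (- s) ^ i / fact i * (x ^ (n + i) * exp (- (real k * s * x))))"
        by (simp add: g_def c_def)
      also have "(\<Sum>i<N. (- s) ^ i / fact i * (x ^ (n + i) * exp (- (real k * s * x))))
           = x ^ n * exp (- (real k * s * x)) * (\<Sum>i<N. (- (s * x)) ^ i / fact i)"
        
      proof -
        have "(- (s * x)) ^ i = (- s) ^ i * x ^ i" for i by (simp flip: power_mult_distrib)
        then show ?thesis unfolding sum_distrib_left by (intro sum.cong refl) (simp add: power_add mult_ac)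
      qed
      finally show ?thesis .
    qed
    show ?case
    proof (rule approx_dominated[OF g])
      show "(\<lambda>x. complex_of_real (x ^ n * exp (- (real (Suc k) * s * x)))) \<in> borel_measurable (lag a \<beta>)"
        by (intro borel_imp_lag) measurable
      show "AE x in lag a \<beta>. (\<lambda>N. g N x) \<longlonglongrightarrow> complex_of_real (x ^ n * exp (- (real (Suc k) * s * x)))"
      proof (rule AE_I2)
        fix x
        have "(\<lambda>N. \<Sum>i<N. (- (s * x)) ^ i / fact i) \<longlonglongrightarrow> exp (- (s * x))"
          using exp_converges[of "- (s * x)"] unfolding sums_def by (simp add: divide_inverse mult.commute)
        then have "(\<lambda>N. g N x) \<longlonglongrightarrow> of_real (x ^ n * exp (- (real k * s * x)) * exp (- (s * x)))"
          unfolding g_eq by (intro tendsto_intros)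
        also have "x ^ n * exp (- (real k * s * x)) * exp (- (s * x)) = x ^ n * exp (- (real (Suc k) * s * x))"
          by (simp add: algebra_simps flip: exp_add)
        finally show "(\<lambda>N. g N x) \<longlonglongrightarrow> complex_of_real (x ^ n * exp (- (real (Suc k) * s * x)))" .
      qed
      show "integrable (lag a \<beta>) (\<lambda>x. (x ^ n * exp (s * x))\<^sup>2)"
        
      proof -
        have "2 * s < \<beta>" using \<beta> s by simp
        from L2_lag_monomial_exp[OF a this, of n] show ?thesis by (simp add: L2_def del: of_real_mult of_real_power)
      qed
      show "AE x in lag a \<beta>. cmod (g N x) \<le> x ^ n * exp (s * x)" for N
      proof (rule AE_I2)
        fix x assume "x \<in> space (lag a \<beta>)"
        then have x: "x > 0" by simp
        have sx: "s * x \<ge> 0" using x s \<beta> by simp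
        have "cmod (g N x) = \<bar>x ^ n\<bar> * exp (- (real k * s * x)) * \<bar>\<Sum>i<N. (- (s * x)) ^ i / fact i\<bar>"
          unfolding g_eq norm_of_real by (simp add: abs_mult)
        also have "\<dots> \<le> \<bar>x ^ n\<bar> * 1 * exp (s * x)"
        proof (intro mult_mono exp_partial_sum_bound sx)
          have "real k * s * x \<ge> 0" using x s \<beta> by simp
          then show "exp (- (real k * s * x)) \<le> 1" by simp
        qed auto
        finally show "cmod (g N x) \<le> x ^ n * exp (s * x)" using x by simp
      qed
    qed
  qed
qed

text \<open>
  The Weierstrass theorem in the variable \<open>y = e\<^sup>-\<^sup>s\<^sup>x\<close>, which runs through \<open>(0, 1)\<close>.
\<close>
lemma approx_lag_continuous_of_exp:
  fixes \<phi> :: "real \<Rightarrow> real"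
  assumes a: "a > -1" and \<beta>: "\<beta> > 0" and s: "s = \<beta> / 4" and \<phi>: "continuous_on {0..1} \<phi>"
    and \<phi>m: "\<phi> \<in> borel_measurable borel"
  shows "poly_measure.approx (lag a \<beta>) (\<lambda>x. of_real (\<phi> (exp (- (s * x)))))"
proof -
  interpret poly_measure "lag a \<beta>" by (rule poly_measure_lag[OF a \<beta>])
  have "\<exists>q. real_polynomial_function q \<and> (\<forall>y\<in>{0..1}. \<bar>\<phi> y - q y\<bar> < 1 / real (Suc n))" for n
    by (rule Stone_Weierstrass_real_polynomial_function[OF compact_Icc \<phi>, of "1 / real (Suc n)"]) auto
  then obtain q where q: "\<And>n. real_polynomial_function (q n)" "\<And>n y. y \<in> {0..1} \<Longrightarrow> \<bar>\<phi> y - q n y\<bar> < 1 / real (Suc n)"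
    by metis
  have qa: "approx (\<lambda>x. of_real (q n (exp (- (s * x)))))" for n
  proof -
    obtain c N where cN: "q n = (\<lambda>y. \<Sum>i\<le>N. c i * y ^ i)"
      using q(1)[of n] unfolding real_polynomial_function_iff_sum by blast
    have "approx (\<lambda>x. \<Sum>i\<le>N. of_real (c i) * of_real (x ^ 0 * exp (- (real i * s * x))))"
      by (intro approx_sum approx_cmult approx_lag_exp[OF a \<beta> s])
    also have "(\<lambda>x. \<Sum>i\<le>N. of_real (c i) * of_real (x ^ 0 * exp (- (real i * s * x)))) = (\<lambda>x. complex_of_real (q n (exp (- (s * x)))))"
      unfolding cN by (simp add: fun_eq_iff exp_of_nat_mult[symmetric] mult_ac flip: of_real_power)
    finally show ?thesis .
  qed
  obtain B where B: "\<And>y. y \<in> {0..1} \<Longrightarrow> \<bar>\<phi> y\<bar> \<le> B"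
    using compact_imp_bounded[OF compact_continuous_image[OF \<phi> compact_Icc]] unfolding bounded_iff by fastforce
  have sx: "exp (- (s * x)) \<in> {0..1}" if "x > 0" for x using that s \<beta> by simp
  show ?thesis
  proof (rule approx_dominated[OF qa])
    show "(\<lambda>x. complex_of_real (\<phi> (exp (- (s * x))))) \<in> borel_measurable (lag a \<beta>)"
      
    proof -
      have m: "(\<lambda>x. exp (- (s * x))) \<in> borel_measurable borel" by measurable
      have "complex_of_real \<in> borel_measurable borel" by measurable
      then show ?thesis by (intro borel_imp_lag measurable_compose[OF measurable_compose[OF m \<phi>m]])
    qed
    show "AE x in lag a \<beta>. (\<lambda>n. complex_of_real (q n (exp (- (s * x))))) \<longlonglongrightarrow> complex_of_real (\<phi> (exp (- (s * x))))"
    proof (rule AE_I2)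
      fix x assume "x \<in> space (lag a \<beta>)"
      then have x: "x > 0" by simp
      have "(\<lambda>n. q n (exp (- (s * x)))) \<longlonglongrightarrow> \<phi> (exp (- (s * x)))"
      proof (rule LIMSEQ_I)
        fix e :: real assume "e > 0"
        then obtain N where N: "1 / real (Suc N) < e" using nat_approx_posE by blast
        show "\<exists>N. \<forall>n\<ge>N. norm (q n (exp (- (s * x))) - \<phi> (exp (- (s * x)))) < e"
        proof (intro exI[of _ N] allI impI)
          fix n assume "N \<le> n"
          then have "1 / real (Suc n) \<le> 1 / real (Suc N)" by (intro divide_left_mono) auto
          then show "norm (q n (exp (- (s * x))) - \<phi> (exp (- (s * x)))) < e"
            using q(2)[OF sx[OF x], of n] N by (simp add: abs_minus_commute)
        qed
      qed
      then show "(\<lambda>n. complex_of_real (q n (exp (- (s * x))))) \<longlonglongrightarrow> complex_of_real (\<phi> (exp (- (s * x))))"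
        by (rule tendsto_of_real)
    qed
    show "integrable (lag a \<beta>) (\<lambda>x. (B + 1)\<^sup>2)"
      using integrable_mult_right[OF integrable_lag_moment[of a 0 \<beta> 0], of "(B+1)\<^sup>2"] a \<beta> by simp
    show "AE x in lag a \<beta>. cmod (complex_of_real (q n (exp (- (s * x))))) \<le> B + 1" for n
    proof (rule AE_I2)
      fix x assume "x \<in> space (lag a \<beta>)"
      then have x: "x > 0" by simp
      have "1 / real (Suc n) \<le> 1" by simp
      then show "cmod (complex_of_real (q n (exp (- (s * x))))) \<le> B + 1"
        using q(2)[OF sx[OF x], of n] B[OF sx[OF x]] unfolding norm_of_real by linarith
    qed
  qed
qed

text \<open>
  Freezing \<open>h\<close> beyond \<open>N\<close> makes it a continuous function of \<open>e\<^sup>-\<^sup>s\<^sup>x\<close> up to the value \<open>0\<close>, which corresponds to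
  \<open>x = \<infinity>\<close>.
\<close>
lemma approx_lag_bounded_continuous:
  fixes h :: "real \<Rightarrow> complex"
  assumes a: "a > -1" and \<beta>: "\<beta> > 0" and h: "continuous_on UNIV h" and B: "\<And>x. norm (h x) \<le> B"
  shows "poly_measure.approx (lag a \<beta>) h"
proof -
  interpret poly_measure "lag a \<beta>" by (rule poly_measure_lag[OF a \<beta>])
  define s where "s = \<beta> / 4"
  have s: "s > 0" using \<beta> by (simp add: s_def)
  have ap: "approx (\<lambda>x. of_real (g (min x (real N))))" if g: "continuous_on UNIV g" for g :: "real \<Rightarrow> real" and N
  proof -
    \<comment> \<open>The maximum stops \<open>x = - ln y / s\<close> at \<open>N\<close>, before \<open>y\<close> reaches \<open>0\<close>.\<close>
    define \<phi> where "\<phi> = (\<lambda>y. g (- ln (max y (exp (- (s * real N)))) / s))"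
    have [measurable]: "g \<in> borel_measurable borel" using g by (rule borel_measurable_continuous_onI)
    have \<phi>: "continuous_on {0..1} \<phi>" "\<phi> \<in> borel_measurable borel"
      unfolding \<phi>_def by (intro continuous_on_compose2[OF g] continuous_intros; use s in \<open>auto simp: max_def\<close>) measurable
    have "max (exp (- (s * x))) (exp (- (s * real N))) = exp (- (s * min x (real N)))" for x
      using s by (auto simp: max_def min_def)
    then have "\<phi> (exp (- (s * x))) = g (min x (real N))" for x using s by (simp add: \<phi>_def)
    then show ?thesis using approx_lag_continuous_of_exp[OF a \<beta> s_def \<phi>] by simp
  qed
  have ap': "approx (\<lambda>x. h (min x (real N)))" for N
  proof -
    have "approx (\<lambda>x. of_real (Re (h (min x (real N)))) + \<i> * of_real (Im (h (min x (real N)))))"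
      using h by (intro approx_add approx_cmult ap[of "\<lambda>x. Re (h x)"] ap[of "\<lambda>x. Im (h x)"] continuous_intros)
    then show ?thesis by (simp add: complex_eq[symmetric])
  qed
  show ?thesis
  proof (rule approx_dominated[OF ap'])
    show "h \<in> borel_measurable (lag a \<beta>)" using h by (intro borel_imp_lag borel_measurable_continuous_onI)
    show "AE x in lag a \<beta>. (\<lambda>n. h (min x (real n))) \<longlonglongrightarrow> h x"
    proof (rule AE_I2)
      fix x
      obtain N :: nat where N: "x \<le> real N" using real_arch_simple by blast
      have "eventually (\<lambda>n. h (min x (real n)) = h x) sequentially"
        using eventually_ge_at_top[of N] by eventually_elim (use N in \<open>auto simp: min_def\<close>)
      then show "(\<lambda>n. h (min x (real n))) \<longlonglongrightarrow> h x" by (rule tendsto_eventually)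
    qed
    show "integrable (lag a \<beta>) (\<lambda>x. B\<^sup>2)"
      using integrable_mult_right[OF integrable_lag_moment[of a 0 \<beta> 0], of "B\<^sup>2"] a \<beta> by simp
  qed (use B in auto)
qed

definition clip :: "real \<Rightarrow> complex \<Rightarrow> complex" where "clip B = closest_point (cball 0 B)"

lemma clip:
  assumes "B \<ge> 0"
  shows "norm (clip B z) \<le> B" "norm z \<le> B \<Longrightarrow> clip B z = z" "continuous_on UNIV (clip B)"
proof -
  have "clip B z \<in> cball 0 B" unfolding clip_def by (rule closest_point_in_set) (use assms in auto)
  then show "norm (clip B z) \<le> B" by simp
  show "norm z \<le> B \<Longrightarrow> clip B z = z" unfolding clip_def by (rule closest_point_self) simp
  show "continuous_on UNIV (clip B)" unfolding clip_def by (rule continuous_on_closest_point) (use assms in auto)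
qed

text \<open>
  A measurable function is the limit almost everywhere of continuous functions; clipping them at the bound of \<open>f\<close>
  makes the convergence dominated.
\<close>
lemma approx_lag_bounded_measurable:
  assumes a: "a > -1" and \<beta>: "\<beta> > 0" and f: "f \<in> borel_measurable (lebesgue_on {0<..})" and B: "\<And>x. norm (f x) \<le> B"
  shows "poly_measure.approx (lag a \<beta>) f"
proof -
  interpret poly_measure "lag a \<beta>" by (rule poly_measure_lag[OF a \<beta>])
  have B0: "B \<ge> 0" using B[of 0] norm_ge_zero[of "f 0"] by linarith
  have "f measurable_on {0<..}" using f by (subst measurable_on_iff_borel_measurable) auto
  then obtain N g where N: "negligible N" and g: "\<And>n. continuous_on UNIV (g n)"
    and lim: "\<And>x. x \<notin> N \<Longrightarrow> (\<lambda>n. g n x) \<longlonglongrightarrow> (if x \<in> {0<..} then f x else 0)"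
    unfolding measurable_on_def by blast
  have ap: "approx (\<lambda>x. clip B (g n x))" for n
    by (intro approx_lag_bounded_continuous[OF a \<beta>, of _ B] continuous_on_compose2[OF clip(3)[OF B0] g] clip(1)[OF B0]) auto
  show ?thesis
  proof (rule approx_dominated[OF ap])
    show "f \<in> borel_measurable (lag a \<beta>)" using f by (simp add: measurable_lag)
    have "AE x in lebesgue. x \<notin> N" using N by (intro AE_not_in) (simp add: negligible_iff_null_sets)
    then show "AE x in lag a \<beta>. (\<lambda>n. clip B (g n x)) \<longlonglongrightarrow> f x"
      unfolding AE_lag
    proof eventually_elim
      case (elim x)
      have "(\<lambda>n. clip B (g n x)) \<longlonglongrightarrow> clip B (f x)" if "x > 0"
        using lim[OF elim] that by (intro continuous_on_tendsto_compose[OF clip(3)[OF B0]]) auto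
      then show ?case using clip(2)[OF B0 B[of x]] by simp
    qed
    show "integrable (lag a \<beta>) (\<lambda>x. B\<^sup>2)"
      using integrable_mult_right[OF integrable_lag_moment[of a 0 \<beta> 0], of "B\<^sup>2"] a \<beta> by simp
  qed (use clip(1)[OF B0] in auto)
qed

text \<open>
  The polynomials are dense in \<open>L\<^sup>2(x\<^sup>a e\<^sup>-\<^sup>\<beta>\<^sup>x dx)\<close>: a square integrable function is the dominated limit of its
  clipped versions, which are bounded.
\<close>
lemma approx_lag:
  assumes a: "a > -1" and \<beta>: "\<beta> > 0" and f: "f \<in> L2 (lag a \<beta>)"
  shows "poly_measure.approx (lag a \<beta>) f"
proof -
  interpret poly_measure "lag a \<beta>" by (rule poly_measure_lag[OF a \<beta>])
  have fm: "f \<in> borel_measurable (lebesgue_on {0<..})" using f by (simp add: L2_def measurable_lag)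
  have cm: "clip (real n) \<in> borel_measurable borel" for n by (intro borel_measurable_continuous_onI clip) simp
  have ap: "approx (\<lambda>x. clip (real n) (f x))" for n
    by (rule approx_lag_bounded_measurable[OF a \<beta> measurable_compose[OF fm cm[of n]], where B = "real n"]) (simp add: clip)
  show ?thesis
  proof (rule approx_dominated[OF ap])
    show "f \<in> borel_measurable (lag a \<beta>)" using f by (simp add: L2_def)
    show "AE x in lag a \<beta>. (\<lambda>n. clip (real n) (f x)) \<longlonglongrightarrow> f x"
    proof (rule AE_I2)
      fix x
      obtain N :: nat where N: "norm (f x) \<le> real N" using real_arch_simple by blast
      have "eventually (\<lambda>n. clip (real n) (f x) = f x) sequentially"
        using eventually_ge_at_top[of N] by eventually_elim (use N in \<open>auto simp: clip\<close>)
      then show "(\<lambda>n. clip (real n) (f x)) \<longlonglongrightarrow> f x" by (rule tendsto_eventually)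
    qed
    show "integrable (lag a \<beta>) (\<lambda>x. (norm (f x))\<^sup>2)" using f by (simp add: L2_def)
    show "AE x in lag a \<beta>. norm (clip (real n) (f x)) \<le> norm (f x)" for n
    proof (rule AE_I2)
      fix x show "norm (clip (real n) (f x)) \<le> norm (f x)"
        using clip(1)[of "real n" "f x"] clip(2)[of "real n" "f x"] by (cases "norm (f x) \<le> real n") auto
    qed
  qed
qed

section \<open>The adjoint of fractional integration\<close>

lemma nn_integral_gamma_kernel:
  assumes "\<nu> > 0" "\<beta> > 0"
  shows "(\<integral>\<^sup>+s. ennreal (rl_kernel \<nu> s * exp (- \<beta> * s)) \<partial>lborel) = ennreal (\<beta> powr - \<nu>)"
proof -
  define c where "c = Gamma \<nu>"
  have G: "c > 0" using assms unfolding c_def by (intro Gamma_real_pos)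
  have rk: "rl_kernel \<nu> s = s powr (\<nu> - 1) / c" if "s > 0" for s
    using that by (simp add: rl_kernel_def c_def)
  define F where "F = (\<lambda>y::real. indicator {0..} y * (y powr (\<nu> - 1) / exp y))"
  have [measurable]: "F \<in> borel_measurable borel" unfolding F_def by measurable
  have F: "F (\<beta> * s) = (\<beta> powr (\<nu> - 1) * c) * (rl_kernel \<nu> s * exp (- \<beta> * s))" for s
  proof (cases "s > 0")
    case True
    then show ?thesis using assms G by (simp add: F_def rk powr_mult exp_minus field_simps)
  next
    case False
    then have "\<beta> * s < 0 \<or> s = 0" using assms by (auto simp: mult_pos_neg)
    then show ?thesis using False by (auto simp: F_def)
  qed
  have "ennreal (c) = (\<integral>\<^sup>+y. ennreal (F y) \<partial>lborel)"
    unfolding F_def c_def using Gamma_conv_nn_integral_real[OF assms(1)] by simp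
  also have "\<dots> = \<bar>\<beta>\<bar> * (\<integral>\<^sup>+s. ennreal (F (0 + \<beta> * s)) \<partial>lborel)"
    using assms by (intro nn_integral_real_affine) auto
  also have "(\<integral>\<^sup>+s. ennreal (F (0 + \<beta> * s)) \<partial>lborel)
      = ennreal (\<beta> powr (\<nu> - 1) * c) * (\<integral>\<^sup>+s. ennreal (rl_kernel \<nu> s * exp (- \<beta> * s)) \<partial>lborel)"
    unfolding add_0 F using G assms
    by (subst nn_integral_cmult[symmetric]) (auto simp: ennreal_mult'[symmetric] intro!: nn_integral_cong)
  finally have "ennreal (c) = ennreal (\<beta> * \<beta> powr (\<nu> - 1) * c) * (\<integral>\<^sup>+s. ennreal (rl_kernel \<nu> s * exp (- \<beta> * s)) \<partial>lborel)"
    using G assms by (simp add: ennreal_mult' mult.assoc)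
  also have "\<beta> * \<beta> powr (\<nu> - 1) = \<beta> powr \<nu>" using assms powr_mult_base[of \<beta> "\<nu> - 1"] by simp
  finally have eq: "ennreal (c) = ennreal (\<beta> powr \<nu> * c) * (\<integral>\<^sup>+s. ennreal (rl_kernel \<nu> s * exp (- \<beta> * s)) \<partial>lborel)" .
  have bp1: "\<beta> powr - \<nu> / c * (\<beta> powr \<nu> * c) = 1"
    using assms G by (simp flip: powr_add)
  have "ennreal (\<beta> powr - \<nu>) = ennreal (\<beta> powr - \<nu> / c) * ennreal (c)"
    using G by (simp add: ennreal_mult'[symmetric])
  also have "\<dots> = ennreal (\<beta> powr - \<nu> / c) * ennreal (\<beta> powr \<nu> * c) * (\<integral>\<^sup>+s. ennreal (rl_kernel \<nu> s * exp (- \<beta> * s)) \<partial>lborel)"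
    by (subst eq) (simp add: mult.assoc)
  also have "ennreal (\<beta> powr - \<nu> / c) * ennreal (\<beta> powr \<nu> * c) = 1"
  proof -
    have "ennreal (\<beta> powr - \<nu> / c) * ennreal (\<beta> powr \<nu> * c) = ennreal (\<beta> powr - \<nu> / c * (\<beta> powr \<nu> * c))"
      by (rule ennreal_mult'[symmetric]) (use G in simp)
    then show ?thesis unfolding bp1 by simp
  qed
  finally show ?thesis by simp
qed

definition kernel_moment :: "real \<Rightarrow> real \<Rightarrow> nat \<Rightarrow> real" where
  "kernel_moment \<nu> \<beta> i = (LINT s|lborel. rl_kernel \<nu> s * exp (- \<beta> * s) * s ^ i)"

lemma integrable_kernel_moment:
  assumes "\<nu> > 0" "\<beta> > 0"
  shows "integrable lborel (\<lambda>s. rl_kernel \<nu> s * exp (- \<beta> * s) * s ^ i)"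
proof -
  have "integrable lborel (\<lambda>x. indicator {0<..} x *\<^sub>R (x powr (\<nu> - 1 + real i) * exp (- \<beta> * x)))"
    using set_integrable_powr_exp[of "\<nu> - 1 + real i" \<beta>] assms by (simp add: set_integrable_def)
  then have "integrable lborel (\<lambda>x. (1 / Gamma \<nu>) * (indicator {0<..} x *\<^sub>R (x powr (\<nu> - 1 + real i) * exp (- \<beta> * x))))"
    by (rule integrable_mult_right)
  also have "(\<lambda>x. (1 / Gamma \<nu>) * (indicator {0<..} x *\<^sub>R (x powr (\<nu> - 1 + real i) * exp (- \<beta> * x))))
     = (\<lambda>s. rl_kernel \<nu> s * exp (- \<beta> * s) * s ^ i)"
    by (auto simp: fun_eq_iff rl_kernel_def powr_add powr_realpow indicator_def)
  finally show ?thesis .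
qed

lemma kernel_moment_0:
  assumes "\<nu> > 0" "\<beta> > 0"
  shows "kernel_moment \<nu> \<beta> 0 = \<beta> powr - \<nu>"
  unfolding kernel_moment_def using nn_integral_gamma_kernel[OF assms] assms
  by (subst integral_eq_nn_integral) auto

text \<open>
  The polynomial \<open>q\<close> for which \<open>e\<^sup>-\<^sup>\<beta>\<^sup>tq(t)\<close> is the Weyl integral \<open>\<integral> (x - t)\<^sup>\<nu>\<^sup>-\<^sup>1/\<Gamma>(\<nu>) e\<^sup>-\<^sup>\<beta>\<^sup>xx\<^sup>n dx\<close> over \<open>x > t\<close>.
\<close>
definition weyl_monom :: "real \<Rightarrow> real \<Rightarrow> nat \<Rightarrow> complex poly" where
  "weyl_monom \<nu> \<beta> n = (\<Sum>i\<le>n. monom (of_real (real (n choose i) * kernel_moment \<nu> \<beta> i)) (n - i))"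

lemma rpoly_weyl_monom: "rpoly (weyl_monom \<nu> \<beta> n) x = of_real (\<Sum>i\<le>n. real (n choose i) * kernel_moment \<nu> \<beta> i * x ^ (n - i))"
  unfolding weyl_monom_def by (simp add: rpoly_simps)

text \<open>
  Shift by \<open>t\<close> and expand \<open>(t + s)\<^sup>n\<close>.
\<close>
lemma weyl_kernel_integral:
  assumes "\<nu> > 0" "\<beta> > 0"
  shows "integrable lborel (\<lambda>x. rl_kernel \<nu> (x - t) * (exp (- \<beta> * x) * x ^ n))"
    and "(LINT x|lborel. rl_kernel \<nu> (x - t) * (exp (- \<beta> * x) * x ^ n))
       = exp (- \<beta> * t) * (\<Sum>i\<le>n. real (n choose i) * kernel_moment \<nu> \<beta> i * t ^ (n - i))"
proof -
  define G where "G = (\<lambda>x. rl_kernel \<nu> (x - t) * (exp (- \<beta> * x) * x ^ n))"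
  have shift: "G (t + 1 * s) = (\<Sum>i\<le>n. (exp (- \<beta> * t) * (real (n choose i) * t ^ (n - i))) * (rl_kernel \<nu> s * exp (- \<beta> * s) * s ^ i))" for s
  proof -
    have "(t + s) ^ n = (\<Sum>i\<le>n. real (n choose i) * s ^ i * t ^ (n - i))"
      by (subst add.commute) (rule binomial_ring)
    moreover have "exp (- \<beta> * (t + s)) = exp (- \<beta> * t) * exp (- \<beta> * s)"
      by (simp add: distrib_left flip: exp_add)
    ultimately show ?thesis by (simp add: G_def sum_distrib_left mult_ac)
  qed
  have "integrable lborel (\<lambda>s. G (t + 1 * s))"
    unfolding shift by (intro Bochner_Integration.integrable_sum integrable_mult_right integrable_kernel_moment assms)
  then show "integrable lborel (\<lambda>x. rl_kernel \<nu> (x - t) * (exp (- \<beta> * x) * x ^ n))"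
    unfolding G_def[symmetric] by (subst (asm) lborel_integrable_real_affine_iff) auto
  have "(LINT x|lborel. G x) = \<bar>1\<bar> *\<^sub>R (LINT s|lborel. G (t + 1 * s))"
    by (rule lborel_integral_real_affine) simp
  also have "\<dots> = (\<Sum>i\<le>n. (exp (- \<beta> * t) * (real (n choose i) * t ^ (n - i))) * kernel_moment \<nu> \<beta> i)"
    unfolding shift kernel_moment_def using integrable_kernel_moment[OF assms]
    by (simp add: Bochner_Integration.integral_sum)
  also have "\<dots> = exp (- \<beta> * t) * (\<Sum>i\<le>n. real (n choose i) * kernel_moment \<nu> \<beta> i * t ^ (n - i))"
    by (simp add: sum_distrib_left mult_ac)
  finally show "(LINT x|lborel. rl_kernel \<nu> (x - t) * (exp (- \<beta> * x) * x ^ n))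
       = exp (- \<beta> * t) * (\<Sum>i\<le>n. real (n choose i) * kernel_moment \<nu> \<beta> i * t ^ (n - i))"
    unfolding G_def .
qed

lemma ip_lag_lebesgue:
  assumes "f \<in> L2 (lag a \<beta>)" "g \<in> L2 (lag a \<beta>)"
  shows "ip (lag a \<beta>) f g = (LINT x|lebesgue. indicator {0<..} x *\<^sub>R ((x powr a * exp (- \<beta> * x)) *\<^sub>R (f x * cnj (g x))))"
    and "integrable lebesgue (\<lambda>x. indicator {0<..} x *\<^sub>R ((x powr a * exp (- \<beta> * x)) *\<^sub>R (f x * cnj (g x))))"
proof -
  have int: "integrable (lag a \<beta>) (\<lambda>x. f x * cnj (g x))" by (rule ip_integrable[OF assms])
  then have m: "(\<lambda>x. f x * cnj (g x)) \<in> borel_measurable (lebesgue_on {0<..})"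
    unfolding measurable_lag[symmetric, of _ a \<beta>] by auto
  show "ip (lag a \<beta>) f g = (LINT x|lebesgue. indicator {0<..} x *\<^sub>R ((x powr a * exp (- \<beta> * x)) *\<^sub>R (f x * cnj (g x))))"
    unfolding ip_def integral_lag[OF m] by (subst integral_restrict_space) auto
  show "integrable lebesgue (\<lambda>x. indicator {0<..} x *\<^sub>R ((x powr a * exp (- \<beta> * x)) *\<^sub>R (f x * cnj (g x))))"
    using int unfolding integrable_lag[OF m] by (subst (asm) integrable_restrict_space) auto
qed

text \<open>
  On bounded intervals the exponential weight is bounded below, and the constant function \<open>1\<close> is square integrable.
\<close>
lemma L2_lag_loc_integrable:
  assumes a: "a > -1" and \<beta>: "\<beta> > 0" and f: "f \<in> L2 (lag a \<beta>)"
  shows "loc_integrable (restrict_pos (\<lambda>x. (x powr a) *\<^sub>R f x))"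
  unfolding loc_integrable_def
proof (intro conjI allI impI)
  interpret poly_measure "lag a \<beta>" by (rule poly_measure_lag[OF a \<beta>])
  fix X :: real
  have one: "(\<lambda>x. 1) \<in> L2 (lag a \<beta>)" using rpoly_L2[of 1] by (simp add: rpoly_def[abs_def])
  define G where "G = (\<lambda>x. indicator {0<..} x *\<^sub>R ((x powr a * exp (- \<beta> * x)) *\<^sub>R (f x * cnj 1)))"
  have G: "integrable lebesgue G" unfolding G_def by (rule ip_lag_lebesgue(2)[OF f one])
  have "indicator {0..X} x *\<^sub>R restrict_pos (\<lambda>x. (x powr a) *\<^sub>R f x) x = (indicator {0..X} x * exp (\<beta> * x)) *\<^sub>R G x" for x
    by (auto simp: G_def indicator_def exp_minus field_simps)
  moreover have "integrable lebesgue (\<lambda>x. (indicator {0..X} x * exp (\<beta> * x)) *\<^sub>R G x)"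
  proof (rule Bochner_Integration.integrable_bound[OF integrable_scaleR_right[OF G, of "exp (\<beta> * X)"]])
    show "(\<lambda>x. (indicator {0..X} x * exp (\<beta> * x)) *\<^sub>R G x) \<in> borel_measurable lebesgue"
      by (rule borel_measurable_scaleR[OF _ borel_measurable_integrable[OF G]]) (intro borel_imp_lebesgue, measurable)
    have "indicator {0..X} x * exp (\<beta> * x) \<le> exp (\<beta> * X)" for x using \<beta> by (auto simp: indicator_def)
    then show "AE x in lebesgue. norm ((indicator {0..X} x * exp (\<beta> * x)) *\<^sub>R G x) \<le> norm (exp (\<beta> * X) *\<^sub>R G x)"
      unfolding norm_scaleR by (intro AE_I2 mult_right_mono) auto
  qed
  ultimately show "set_integrable lebesgue {0..X} (restrict_pos (\<lambda>x. (x powr a) *\<^sub>R f x))"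
    unfolding set_integrable_def by simp
qed simp

text \<open>
  The linear map on polynomials that sends \<open>x\<^sup>i\<close> to \<open>T i\<close>.
\<close>
definition lin_ext :: "(nat \<Rightarrow> complex poly) \<Rightarrow> complex poly \<Rightarrow> complex poly" where
  "lin_ext T r = (\<Sum>i\<le>degree r. smult (coeff r i) (T i))"

lemma rpoly_sum_monom: "rpoly r x = (\<Sum>i\<le>degree r. coeff r i * rpoly (monom 1 i) x)"
  by (simp add: rpoly_def poly_monom poly_altdef[of r])

lemma ip_lin_ext:
  assumes M: "poly_measure M1" "poly_measure M2" and F: "F \<in> L2 M1" and G: "G \<in> L2 M2"
    and mono: "\<And>i. ip M1 F (rpoly (monom 1 i)) = ip M2 G (rpoly (T i))"
  shows "ip M1 F (rpoly r) = ip M2 G (rpoly (lin_ext T r))"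
proof -
  have "ip M1 F (rpoly r) = ip M1 F (\<lambda>x. \<Sum>i\<le>degree r. coeff r i * rpoly (monom 1 i) x)"
    by (rule arg_cong[of _ _ "ip M1 F"], rule ext, rule rpoly_sum_monom)
  also have "\<dots> = (\<Sum>i\<le>degree r. cnj (coeff r i) * ip M1 F (rpoly (monom 1 i)))"
    by (subst ip_sum_right) (simp_all add: ip_cmult_right L2_cmult F poly_measure.rpoly_L2[OF M(1)])
  also have "\<dots> = (\<Sum>i\<le>degree r. cnj (coeff r i) * ip M2 G (rpoly (T i)))" by (simp add: mono)
  also have "\<dots> = ip M2 G (\<lambda>x. \<Sum>i\<le>degree r. coeff r i * rpoly (T i) x)"
    by (subst ip_sum_right) (simp_all add: ip_cmult_right L2_cmult G poly_measure.rpoly_L2[OF M(2)])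
  also have "\<dots> = ip M2 G (rpoly (lin_ext T r))" by (simp add: lin_ext_def rpoly_simps[abs_def])
  finally show ?thesis .
qed

lemma lin_ext_degree:
  assumes T: "\<And>i. deg_less (Suc i + d) (T i)" and r: "deg_less (Suc n) r"
  shows "deg_less (Suc n + d) (lin_ext T r)" and "coeff (lin_ext T r) (n + d) = coeff r n * coeff (T n) (n + d)"
proof -
  have deg: "degree r \<le> n" using r by (simp add: deg_less_Suc_degree)
  show "deg_less (Suc n + d) (lin_ext T r)"
    unfolding lin_ext_def
  proof (intro deg_less_sum deg_less_smult)
    fix i assume "i \<in> {..degree r}"
    then show "deg_less (Suc n + d) (T i)" using deg by (intro deg_less_mono[OF T[of i]]) auto
  qed
  have "coeff (lin_ext T r) (n + d) = (\<Sum>i\<le>degree r. coeff r i * coeff (T i) (n + d))"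
    by (simp add: lin_ext_def coeff_sum)
  also have "\<dots> = (\<Sum>i\<le>n. coeff r i * coeff (T i) (n + d))"
    using deg by (intro sum.mono_neutral_left) (auto simp: coeff_eq_0)
  also have "\<dots> = (\<Sum>i\<in>{n}. coeff r i * coeff (T i) (n + d))"
    using T by (intro sum.mono_neutral_right) (auto simp: deg_less_def)
  finally show "coeff (lin_ext T r) (n + d) = coeff r n * coeff (T n) (n + d)" by simp
qed

lemma weyl_monom_degree:
  assumes "\<nu> > 0" "\<beta> > 0"
  shows "deg_less (Suc n + 0) (weyl_monom \<nu> \<beta> n)" "coeff (weyl_monom \<nu> \<beta> n) n = of_real (\<beta> powr - \<nu>)"
proof -
  show "deg_less (Suc n + 0) (weyl_monom \<nu> \<beta> n)"
    unfolding weyl_monom_def by (intro deg_less_sum) (auto simp: deg_less_def)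
  have "coeff (weyl_monom \<nu> \<beta> n) n = (\<Sum>i\<le>n. if n - i = n then of_real (real (n choose i) * kernel_moment \<nu> \<beta> i) else 0)"
    unfolding weyl_monom_def by (simp only: coeff_sum coeff_monom)
  also have "\<dots> = (\<Sum>i\<in>{0}. if n - i = n then of_real (real (n choose i) * kernel_moment \<nu> \<beta> i) else 0)"
    by (intro sum.mono_neutral_right) auto
  finally show "coeff (weyl_monom \<nu> \<beta> n) n = of_real (\<beta> powr - \<nu>)" by (simp add: kernel_moment_0[OF assms])
qed

text \<open>
  The operator \<open>x\<^sup>-\<^sup>\<nu>I\<^sup>\<nu>\<close>. Dividing by \<open>x\<^sup>\<nu>\<close> turns the target space into the one for the measure \<open>x\<^sup>\<nu> e\<^sup>-\<^sup>\<beta>\<^sup>x dx\<close>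
  and makes the operator preserve polynomials and their degrees.
\<close>
definition rl_scaled :: "real \<Rightarrow> (real \<Rightarrow> complex) \<Rightarrow> real \<Rightarrow> complex" where
  "rl_scaled \<nu> \<gamma> x = (x powr - \<nu>) *\<^sub>R rl_int \<nu> (restrict_pos \<gamma>) x"

lemma L2_lag_0_loc_integrable:
  assumes \<beta>: "\<beta> > 0" and f: "f \<in> L2 (lag 0 \<beta>)"
  shows "loc_integrable (restrict_pos f)"
proof -
  have "restrict_pos (\<lambda>x. (x powr 0) *\<^sub>R f x) = restrict_pos f"
    by (auto simp: fun_eq_iff restrict_pos_def indicator_def)
  then show ?thesis using L2_lag_loc_integrable[of 0 \<beta> f] \<beta> f by simp
qed

text \<open>
  The adjoint of \<open>x\<^sup>-\<^sup>\<nu>I\<^sup>\<nu>\<close> between the weights \<open>0\<close> and \<open>\<nu>\<close>: after Fubini, the power \<open>x\<^sup>\<nu>\<close> of the weight cancels and the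
  inner integral is the Weyl integral of \<open>e\<^sup>-\<^sup>\<beta>\<^sup>xx\<^sup>n\<close>.
\<close>
lemma ip_rl_scaled_monom:
  assumes \<nu>: "\<nu> > 0" and \<beta>: "\<beta> > 0" and \<gamma>: "\<gamma> \<in> L2 (lag 0 \<beta>)" and f: "rl_scaled \<nu> \<gamma> \<in> L2 (lag \<nu> \<beta>)"
  shows "ip (lag \<nu> \<beta>) (rl_scaled \<nu> \<gamma>) (rpoly (monom 1 n)) = ip (lag 0 \<beta>) \<gamma> (rpoly (weyl_monom \<nu> \<beta> n))"
proof -
  interpret M: poly_measure "lag \<nu> \<beta>" by (rule poly_measure_lag) (use \<nu> \<beta> in auto)
  interpret M0: poly_measure "lag 0 \<beta>" by (rule poly_measure_lag) (use \<beta> in auto)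
  define g where "g = restrict_pos \<gamma>"
  have g: "loc_integrable g" unfolding g_def by (rule L2_lag_0_loc_integrable[OF \<beta> \<gamma>])
  define S where "S = (\<lambda>t. \<Sum>i\<le>n. real (n choose i) * kernel_moment \<nu> \<beta> i * t ^ (n - i))"
  define k where "k = (\<lambda>t x. indicator {0<..} t * (rl_kernel \<nu> (x - t) * (exp (- \<beta> * x) * x ^ n)))"
  have km: "case_prod k \<in> borel_measurable (borel \<Otimes>\<^sub>M borel)"
    unfolding k_def case_prod_beta by measurable
  have knn: "k t x \<ge> 0" for t x
  proof (cases "t > 0 \<and> x > t")
    case True then show ?thesis using \<nu> by (simp add: k_def)
  next
    case False then show ?thesis by (auto simp: k_def)
  qed
  have ki: "integrable lborel (k t)" for t
    unfolding k_def by (intro integrable_mult_right weyl_kernel_integral \<nu> \<beta>)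
  have kint: "(LINT x|lborel. k t x) = exp (- \<beta> * t) * S t" if "t > 0" for t
    unfolding k_def S_def using weyl_kernel_integral(2)[OF \<nu> \<beta>, of t n] that by simp
  have gt: "t > 0" if "g t \<noteq> 0" for t using that by (cases "t > 0") (auto simp: g_def)
  have bound: "(\<integral>\<^sup>+x. ennreal \<bar>k t x\<bar> \<partial>lborel) \<le> ennreal (exp (- \<beta> * t) * S t)" if "g t \<noteq> 0" for t
    using knn kint[OF gt[OF that]] nn_integral_eq_integral[OF ki[of t]] by simp
  have Snn: "S t \<ge> 0" if "t > 0" for t
  proof -
    have "kernel_moment \<nu> \<beta> i \<ge> 0" for i
      unfolding kernel_moment_def
    proof (rule integral_nonneg_AE, rule AE_I2)
      fix s show "rl_kernel \<nu> s * exp (- \<beta> * s) * s ^ i \<ge> 0" using \<nu> by (cases "s > 0") auto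
    qed
    then show ?thesis unfolding S_def using that by (intro sum_nonneg) auto
  qed
  have int: "integrable lebesgue (\<lambda>x. indicator {0<..} x *\<^sub>R ((x powr 0 * exp (- \<beta> * x)) *\<^sub>R (\<gamma> x * cnj (rpoly (weyl_monom \<nu> \<beta> n) x))))"
    by (rule ip_lag_lebesgue[OF \<gamma> M0.rpoly_L2])
  have eq: "indicator {0<..} x *\<^sub>R ((x powr 0 * exp (- \<beta> * x)) *\<^sub>R (\<gamma> x * cnj (rpoly (weyl_monom \<nu> \<beta> n) x))) = (exp (- \<beta> * x) * S x) *\<^sub>R g x" for x
  proof -
    have "rpoly (weyl_monom \<nu> \<beta> n) x = of_real (S x)" by (simp only: rpoly_weyl_monom S_def)
    then show ?thesis by (cases "x > 0") (simp_all add: g_def scaleR_conv_of_real mult_ac)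
  qed
  have Bint: "integrable lebesgue (\<lambda>t. exp (- \<beta> * t) * S t * norm (g t))"
  proof (rule Bochner_Integration.integrable_cong[THEN iffD1, rotated -1])
    show "integrable lebesgue (\<lambda>t. norm ((exp (- \<beta> * t) * S t) *\<^sub>R g t))"
      using int unfolding eq by (rule integrable_norm)
    show "norm ((exp (- \<beta> * t) * S t) *\<^sub>R g t) = exp (- \<beta> * t) * S t * norm (g t)" for t
      using Snn[of t] gt[of t] by (cases "t > 0") (auto simp: abs_mult)
  qed simp
  have gm: "g \<in> borel_measurable lebesgue" by (rule loc_integrable_measurable[OF g])
  have inner: "(LINT t|lebesgue. k t x *\<^sub>R g t) = indicator {0<..} x *\<^sub>R ((x powr \<nu> * exp (- \<beta> * x)) *\<^sub>R (rl_scaled \<nu> \<gamma> x * cnj (rpoly (monom 1 n) x)))" for x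
  proof -
    have "(LINT t|lebesgue. k t x *\<^sub>R g t) = (LINT t|lebesgue. (exp (- \<beta> * x) * x ^ n) *\<^sub>R (rl_kernel \<nu> (x - t) *\<^sub>R g t))"
      by (intro Bochner_Integration.integral_cong refl) (use gt in \<open>auto simp: k_def indicator_def mult_ac\<close>)
    also have "\<dots> = (exp (- \<beta> * x) * x ^ n) *\<^sub>R rl_int \<nu> g x"
      unfolding rl_int_def by (rule integral_scaleR_right)
    also have "\<dots> = indicator {0<..} x *\<^sub>R ((x powr \<nu> * exp (- \<beta> * x)) *\<^sub>R (rl_scaled \<nu> \<gamma> x * cnj (rpoly (monom 1 n) x)))"
    proof (cases "x > 0")
      case True
      then have "x powr \<nu> * x powr - \<nu> = 1" by (simp flip: powr_add)
      then show ?thesis using True 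
        by (simp add: rl_scaled_def g_def rpoly_simps scaleR_conv_of_real mult_ac flip: of_real_mult of_real_power)
    next
      case False
      then show ?thesis using rl_int_nonpos[OF g, of x] by simp
    qed
    finally show ?thesis .
  qed
  have "ip (lag \<nu> \<beta>) (rl_scaled \<nu> \<gamma>) (rpoly (monom 1 n)) = (LINT x|lebesgue. LINT t|lebesgue. k t x *\<^sub>R g t)"
    unfolding ip_lag_lebesgue(1)[OF f M.rpoly_L2] inner ..
  also have "\<dots> = (LINT t|lebesgue. (LINT x|lborel. k t x) *\<^sub>R g t)"
    by (rule kernel_integral_swap[OF km gm bound Bint])
  also have "\<dots> = (LINT t|lebesgue. (exp (- \<beta> * t) * S t) *\<^sub>R g t)"
  proof (intro Bochner_Integration.integral_cong refl)
    fix t show "(LINT x|lborel. k t x) *\<^sub>R g t = (exp (- \<beta> * t) * S t) *\<^sub>R g t"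
      using gt[of t] kint[of t] by (cases "g t = 0") auto
  qed
  also have "\<dots> = ip (lag 0 \<beta>) \<gamma> (rpoly (weyl_monom \<nu> \<beta> n))"
    unfolding ip_lag_lebesgue(1)[OF \<gamma> M0.rpoly_L2] eq ..
  finally show ?thesis .
qed

lemma ip_rl_scaled:
  assumes \<nu>: "\<nu> > 0" and \<beta>: "\<beta> > 0" and \<gamma>: "\<gamma> \<in> L2 (lag 0 \<beta>)" and f: "rl_scaled \<nu> \<gamma> \<in> L2 (lag \<nu> \<beta>)"
  shows "ip (lag \<nu> \<beta>) (rl_scaled \<nu> \<gamma>) (rpoly r) = ip (lag 0 \<beta>) \<gamma> (rpoly (lin_ext (weyl_monom \<nu> \<beta>) r))"
  by (rule ip_lin_ext[OF poly_measure_lag poly_measure_lag f \<gamma> ip_rl_scaled_monom[OF assms]]) (use \<nu> \<beta> in auto)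

text \<open>
  The polynomial \<open>x\<^sup>-\<^sup>\<nu>I\<^sup>\<nu>x\<^sup>n\<close>.
\<close>
definition rl_monom :: "real \<Rightarrow> nat \<Rightarrow> complex poly" where
  "rl_monom \<nu> n = monom (of_real (fact n / Gamma (\<nu> + real n + 1))) n"

text \<open>
  On the half line \<open>x\<^sup>n\<close> is \<open>n!\<close> times the kernel of order \<open>n + 1\<close>, so this is the convolution of kernels.
\<close>
lemma rl_int_restrict_pos_monom:
  assumes "\<nu> > 0"
  shows "integrable lebesgue (\<lambda>y. rl_kernel \<nu> (x - y) *\<^sub>R restrict_pos (rpoly (monom 1 n)) y)"
    and "rl_int \<nu> (restrict_pos (rpoly (monom 1 n))) x = of_real (fact n * rl_kernel (\<nu> + real n + 1) x)"
proof -
  define G where "G = (\<lambda>y. rl_kernel \<nu> (x - y) * rl_kernel (real n + 1) (y - 0))"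
  have eq: "rl_kernel \<nu> (x - y) *\<^sub>R restrict_pos (rpoly (monom 1 n)) y = complex_of_real (fact n * G y)" for y
  proof (cases "y > 0")
    case True
    then have "rl_kernel (real n + 1) y = y ^ n / fact n"
      by (simp add: rl_kernel_def Gamma_fact powr_realpow add.commute[of _ 1])
    then show ?thesis using True by (simp add: G_def rpoly_simps scaleR_conv_of_real)
  qed (simp add: G_def)
  have nn: "(\<integral>\<^sup>+y. ennreal (G y) \<partial>lborel) = ennreal (rl_kernel (\<nu> + real n + 1) x)"
    unfolding G_def using rl_kernel_convolution[of \<nu> "real n + 1" x 0] assms by (simp add: add.assoc)
  have Gnn: "G y \<ge> 0" for y unfolding G_def using assms by simp
  have [measurable]: "G \<in> borel_measurable borel" unfolding G_def by measurable
  have Gi: "integrable lborel G" using nn Gnn by (intro integrableI_bounded) auto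
  have GI: "(LINT y|lborel. G y) = rl_kernel (\<nu> + real n + 1) x"
    using nn Gnn assms by (subst integral_eq_nn_integral) auto
  show "integrable lebesgue (\<lambda>y. rl_kernel \<nu> (x - y) *\<^sub>R restrict_pos (rpoly (monom 1 n)) y)"
    unfolding eq using Gi by (subst integrable_completion) auto
  show "rl_int \<nu> (restrict_pos (rpoly (monom 1 n))) x = of_real (fact n * rl_kernel (\<nu> + real n + 1) x)"
    unfolding rl_int_def eq by (subst integral_completion) (auto simp: GI)
qed

lemma rl_scaled_rpoly:
  assumes \<nu>: "\<nu> > 0" and x: "x > 0"
  shows "rl_scaled \<nu> (rpoly r) x = rpoly (lin_ext (rl_monom \<nu>) r) x"
proof -
  have "rl_int \<nu> (restrict_pos (rpoly r)) x = (LINT y|lebesgue. (\<Sum>i\<le>degree r. coeff r i * (rl_kernel \<nu> (x - y) *\<^sub>R restrict_pos (rpoly (monom 1 i)) y)))"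
    unfolding rl_int_def
    by (intro Bochner_Integration.integral_cong refl)
       (auto simp: restrict_pos_def rpoly_sum_monom[of r] indicator_def scaleR_sum_right)
  also have "\<dots> = (\<Sum>i\<le>degree r. coeff r i * rl_int \<nu> (restrict_pos (rpoly (monom 1 i))) x)"
  proof -
    have "(LINT y|lebesgue. (\<Sum>i\<le>degree r. coeff r i * (rl_kernel \<nu> (x - y) *\<^sub>R restrict_pos (rpoly (monom 1 i)) y)))
        = (\<Sum>i\<le>degree r. LINT y|lebesgue. coeff r i * (rl_kernel \<nu> (x - y) *\<^sub>R restrict_pos (rpoly (monom 1 i)) y))"
      by (rule Bochner_Integration.integral_sum) (intro integrable_mult_right rl_int_restrict_pos_monom(1)[OF \<nu>])
    also have "\<dots> = (\<Sum>i\<le>degree r. coeff r i * rl_int \<nu> (restrict_pos (rpoly (monom 1 i))) x)"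
      unfolding rl_int_def by (intro sum.cong refl integral_mult_right_zero)
    finally show ?thesis .
  qed
  finally have "rl_scaled \<nu> (rpoly r) x = (\<Sum>i\<le>degree r. coeff r i * of_real (x powr - \<nu> * (fact i * rl_kernel (\<nu> + real i + 1) x)))"
    unfolding rl_scaled_def rl_int_restrict_pos_monom(2)[OF \<nu>]
    by (simp add: scaleR_conv_of_real sum_distrib_left mult_ac)
  also have "\<dots> = (\<Sum>i\<le>degree r. coeff r i * rpoly (rl_monom \<nu> i) x)"
  proof (intro sum.cong refl)
    fix i
    have "x powr - \<nu> * x powr (\<nu> + real i) = x ^ i" using x by (simp add: powr_realpow flip: powr_add)
    then have "x powr - \<nu> * (fact i * rl_kernel (\<nu> + real i + 1) x) = fact i / Gamma (\<nu> + real i + 1) * x ^ i"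
      using x by (simp add: rl_kernel_def field_simps)
    then show "coeff r i * of_real (x powr - \<nu> * (fact i * rl_kernel (\<nu> + real i + 1) x)) = coeff r i * rpoly (rl_monom \<nu> i) x"
      by (simp add: rl_monom_def rpoly_simps del: of_real_mult of_real_divide) simp
  qed
  also have "\<dots> = rpoly (lin_ext (rl_monom \<nu>) r) x" by (simp add: lin_ext_def rpoly_simps)
  finally show ?thesis .
qed

section \<open>The adjoint of differentiation\<close>

lemma tendsto_powr_exp_at_top:
  fixes p \<beta> :: real
  assumes "\<beta> > 0"
  shows "((\<lambda>x. x powr p * exp (- \<beta> * x)) \<longlongrightarrow> 0) at_top"
  using assms by real_asymp

text \<open>
  The test function \<open>W = x\<^sup>p e\<^sup>-\<^sup>\<beta>\<^sup>x\<close> for the integration by parts \<open>\<integral> f'W = - \<integral> f W'\<close>. In the application \<open>W\<close> is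
  the weight \<open>x\<^sup>a\<^sup>+\<^sup>1 e\<^sup>-\<^sup>\<beta>\<^sup>x\<close> times \<open>x\<^sup>n\<close>.
\<close>
locale powr_exp =
  fixes p \<beta> :: real
  assumes p: "p \<ge> 1" and \<beta>: "\<beta> > 0"
begin

definition W :: "real \<Rightarrow> real" where "W x = x powr p * exp (- \<beta> * x)"
definition W' :: "real \<Rightarrow> real" where "W' x = (p * x powr (p - 1) - \<beta> * x powr p) * exp (- \<beta> * x)"

lemma W_measurable [measurable]: "W \<in> borel_measurable borel" "W' \<in> borel_measurable borel"
  unfolding W_def W'_def by measurable

lemma W_deriv: "x > 0 \<Longrightarrow> (W has_real_derivative W' x) (at x)"
  unfolding W_def W'_def by (auto intro!: derivative_eq_intros simp: algebra_simps powr_diff)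

lemma W'_integrable: "set_integrable lborel {0<..} W'"
proof -
  have "set_integrable lborel {0<..} (\<lambda>x. p * (x powr (p - 1) * exp (- \<beta> * x)) - \<beta> * (x powr p * exp (- \<beta> * x)))"
    using p \<beta> by (intro set_integral_diff set_integrable_mult_right set_integrable_powr_exp) auto
  also have "(\<lambda>x. p * (x powr (p - 1) * exp (- \<beta> * x)) - \<beta> * (x powr p * exp (- \<beta> * x))) = W'"
    by (simp add: W'_def fun_eq_iff algebra_simps)
  finally show ?thesis .
qed

lemma W_right_limit: "(W \<longlongrightarrow> W t) (at_right t)" if "t \<ge> 0"
proof (cases "t = 0")
  case True
  have "((\<lambda>x::real. x powr p) \<longlongrightarrow> 0 powr p) (at_right 0)"
    by (rule tendsto_powr') (use p in \<open>auto simp: eventually_at_filter\<close>)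
  then have "(W \<longlongrightarrow> 0 powr p * exp (- \<beta> * 0)) (at_right 0)"
    unfolding W_def by (rule tendsto_mult) (intro tendsto_intros)
  then show ?thesis using True by (simp add: W_def)
next
  case False
  then have "isCont W t" using W_deriv[of t] that by (intro DERIV_isCont) auto
  then show ?thesis by (simp add: isCont_def filterlim_at_split)
qed

lemma isCont_W': "x > 0 \<Longrightarrow> isCont W' x"
  unfolding W'_def by (auto intro!: continuous_intros)

lemma W'_integral_Ioi: assumes "t \<ge> 0" shows "(LINT x:{t<..}|lborel. W' x) = - W t"
proof -
  have ei: "einterval (ereal t) \<infinity> = {t<..}" by (auto simp: einterval_def)
  have "(LBINT x=ereal t..\<infinity>. W' x) = 0 - W t"
  proof (rule interval_integral_FTC_integrable)
    show "(W has_vector_derivative W' x) (at x)" if "ereal t < ereal x" for x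
      using W_deriv[of x] that assms by (simp add: has_real_derivative_iff_has_vector_derivative)
    show "isCont W' x" if "ereal t < ereal x" for x using isCont_W' that assms by simp
    show "set_integrable lborel (einterval (ereal t) \<infinity>) W'"
      unfolding ei by (rule set_integrable_subset[OF W'_integrable]) (use assms in auto)
    show "((W \<circ> real_of_ereal) \<longlongrightarrow> W t) (at_right (ereal t))"
      using W_right_limit[OF assms] by (simp add: ereal_tendsto_simps)
    show "((W \<circ> real_of_ereal) \<longlongrightarrow> 0) (at_left \<infinity>)"
      using tendsto_powr_exp_at_top[OF \<beta>, of p] unfolding W_def by (simp add: ereal_tendsto_simps W_def[abs_def])
  qed auto
  then show ?thesis by (simp add: interval_lebesgue_integral_def ei)
qed

lemma W'_integral_total: "(LINT x:{0<..}|lborel. W' x) = 0"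
  using W'_integral_Ioi[of 0] p by (simp add: W_def)

lemma W'_integral_Ioc: assumes "t > 0" shows "(LINT x:{0<..<t}|lborel. W' x) = W t"
proof -
  have "(LINT x:{0<..<t} \<union> {t<..}|lborel. W' x) = (LINT x:{0<..<t}|lborel. W' x) + (LINT x:{t<..}|lborel. W' x)"
  proof (rule set_integral_Un)
    show "set_integrable lborel {0<..<t} W'" by (rule set_integrable_subset[OF W'_integrable]) auto
    show "set_integrable lborel {t<..} W'" by (rule set_integrable_subset[OF W'_integrable]) (use assms in auto)
  qed auto
  moreover have "(LINT x:{0<..<t} \<union> {t<..}|lborel. W' x) = (LINT x:{0<..}|lborel. W' x)"
    unfolding set_lebesgue_integral_def
  proof (rule integral_cong_AE)
    show "AE x in lborel. indicator ({0<..<t} \<union> {t<..}) x *\<^sub>R W' x = indicator {0<..} x *\<^sub>R W' x"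
      using AE_lborel_singleton[of t] by eventually_elim (use assms in \<open>auto simp: indicator_def\<close>)
  qed measurable
  ultimately show ?thesis using W'_integral_total W'_integral_Ioi[of t] assms by simp
qed

text \<open>
  For an absolutely continuous \<open>f\<close> the function \<open>f x - f 1\<close> is the integral of \<open>sign_kernel t x * f' t\<close> over
  \<open>t > 0\<close>. With the base point \<open>1\<close> inside the half line, \<open>W'\<close> gets integrated from \<open>t\<close> to \<open>\<infinity>\<close> for \<open>t > 1\<close> and from \<open>0\<close> to \<open>t\<close> for
  \<open>t < 1\<close>. As \<open>W\<close> vanishes at both ends, no boundary terms arise and nothing has to be known about the limits of \<open>f\<close>.
\<close>
definition sign_kernel :: "real \<Rightarrow> real \<Rightarrow> real" where
  "sign_kernel t x = indicator {1<..} t * indicator {t<..} x - indicator {0<..<1} t * indicator {0<..<t} x"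

lemma sign_kernel_measurable [measurable]: "(\<lambda>(t, x). sign_kernel t x * W' x) \<in> borel_measurable (borel \<Otimes>\<^sub>M borel)"
proof -
  have "(\<lambda>z::real \<times> real. (if 1 < fst z \<and> fst z < snd z then 1 else 0) - (if 0 < fst z \<and> fst z < 1 \<and> 0 < snd z \<and> snd z < fst z then 1 else 0) :: real)
      \<in> borel_measurable (borel \<Otimes>\<^sub>M borel)"
    by measurable
  moreover have "(\<lambda>(t, x). sign_kernel t x) = (\<lambda>z::real \<times> real. (if 1 < fst z \<and> fst z < snd z then 1 else 0) - (if 0 < fst z \<and> fst z < 1 \<and> 0 < snd z \<and> snd z < fst z then 1 else 0) :: real)"
    by (auto simp: fun_eq_iff sign_kernel_def indicator_def)
  ultimately have [measurable]: "(\<lambda>(t, x). sign_kernel t x) \<in> borel_measurable (borel \<Otimes>\<^sub>M borel)" by simp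
  have "(\<lambda>z. (\<lambda>(t, x). sign_kernel t x) z * W' (snd z)) \<in> borel_measurable (borel \<Otimes>\<^sub>M borel)" by measurable
  then show ?thesis by (simp add: case_prod_beta)
qed

lemma sign_kernel_cases:
  "1 < t \<Longrightarrow> sign_kernel t x = indicator {t<..} x"
  "0 < t \<Longrightarrow> t < 1 \<Longrightarrow> sign_kernel t x = - indicator {0<..<t} x"
  by (auto simp: sign_kernel_def)

lemma sign_kernel_integral:
  assumes "t > 0" "t \<noteq> 1"
  shows "(LINT x|lborel. sign_kernel t x * W' x) = - W t"
proof (cases "t > 1")
  case True
  then show ?thesis using W'_integral_Ioi[of t] by (simp add: sign_kernel_cases set_lebesgue_integral_def)
next
  case False
  then show ?thesis using W'_integral_Ioc[of t] assms by (simp add: sign_kernel_cases set_lebesgue_integral_def)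
qed

definition tail :: "real \<Rightarrow> real" where "tail x = (p * x powr (p - 1) + \<beta> * x powr p) * exp (- (\<beta> / 4) * x)"
definition C1 :: real where "C1 = (LINT x:{0<..}|lborel. tail x)"
text \<open>
  The first summand serves for \<open>t > 1\<close>, the second one for \<open>t < 1\<close>.
\<close>
definition C :: real where "C = C1 + (p + \<beta>) * exp (3 * \<beta> / 4)"

lemma tail_nonneg: "tail x \<ge> 0"
  unfolding tail_def using p \<beta> by simp

lemma tail_integrable: "set_integrable lborel {0<..} tail"
proof -
  have "set_integrable lborel {0<..} (\<lambda>x. p * (x powr (p - 1) * exp (- (\<beta> / 4) * x)) + \<beta> * (x powr p * exp (- (\<beta> / 4) * x)))"
    using p \<beta> by (intro set_integral_add set_integrable_mult_right set_integrable_powr_exp) auto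
  also have "(\<lambda>x. p * (x powr (p - 1) * exp (- (\<beta> / 4) * x)) + \<beta> * (x powr p * exp (- (\<beta> / 4) * x))) = tail"
    by (simp add: tail_def fun_eq_iff algebra_simps)
  finally show ?thesis .
qed

lemma W'_abs_le: "\<bar>W' x\<bar> \<le> (p * x powr (p - 1) + \<beta> * x powr p) * exp (- \<beta> * x)"
proof -
  have "p * x powr (p - 1) \<ge> 0" "\<beta> * x powr p \<ge> 0" using p \<beta> by auto
  then have "\<bar>p * x powr (p - 1) - \<beta> * x powr p\<bar> \<le> p * x powr (p - 1) + \<beta> * x powr p" by linarith
  then show ?thesis unfolding W'_def abs_mult by (simp add: mult_right_mono)
qed

lemma C_nonneg: "C1 \<ge> 0" "C \<ge> 0"
proof -
  show "C1 \<ge> 0"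
    unfolding C1_def set_lebesgue_integral_def using tail_nonneg by (intro integral_nonneg_AE) auto
  then show "C \<ge> 0" unfolding C_def using p \<beta> by (intro add_nonneg_nonneg) auto
qed

text \<open>
  The bound is integrable against \<open>f'\<close> when \<open>f'\<close> is square integrable for the weight \<open>x\<^sup>q e\<^sup>-\<^sup>\<beta>\<^sup>x\<close>: it is this weight times
  \<open>e\<^sup>\<beta>\<^sup>t\<^sup>/\<^sup>4\<close>, which is square integrable as well. A quarter of the exponential decay is spent on the integral over
  \<open>x > t\<close>.
\<close>
lemma sign_kernel_bound:
  assumes "t > 0" and q: "0 \<le> q" "q \<le> p"
  shows "(\<integral>\<^sup>+x. ennreal \<bar>sign_kernel t x * W' x\<bar> \<partial>lborel) \<le> ennreal (C * (t powr q * exp (- (3 * \<beta> / 4) * t)))"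
proof -
  consider "t > 1" | "t < 1" | "t = 1" by linarith
  then show ?thesis
  proof cases
    case 1
    have "(\<integral>\<^sup>+x. ennreal \<bar>sign_kernel t x * W' x\<bar> \<partial>lborel)
        \<le> (\<integral>\<^sup>+x. ennreal (exp (- (3 * \<beta> / 4) * t) * (indicator {0<..} x * tail x)) \<partial>lborel)"
    proof (intro nn_integral_mono ennreal_leI)
      fix x
      show "\<bar>sign_kernel t x * W' x\<bar> \<le> exp (- (3 * \<beta> / 4) * t) * (indicator {0<..} x * tail x)"
      proof (cases "x > t")
        case True
        have "\<bar>W' x\<bar> \<le> (p * x powr (p - 1) + \<beta> * x powr p) * exp (- \<beta> * x)" by (rule W'_abs_le)
        also have "\<dots> \<le> (p * x powr (p - 1) + \<beta> * x powr p) * (exp (- (3 * \<beta> / 4) * t) * exp (- (\<beta> / 4) * x))"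
        proof (rule mult_left_mono)
          have "- \<beta> * x \<le> - (3 * \<beta> / 4) * t + - (\<beta> / 4) * x" 
          proof -
            have "\<beta> * t \<le> \<beta> * x" using \<beta> True by (intro mult_left_mono) auto
            moreover have "- (3 * \<beta> / 4) * t + - (\<beta> / 4) * x = - (3 / 4) * (\<beta> * t) - (1 / 4) * (\<beta> * x)" by simp
            ultimately show ?thesis by linarith
          qed
          then show "exp (- \<beta> * x) \<le> exp (- (3 * \<beta> / 4) * t) * exp (- (\<beta> / 4) * x)"
            unfolding exp_add[symmetric] by (rule exp_le_cancel_iff[THEN iffD2])
        qed (use p \<beta> in auto)
        finally show ?thesis using True 1 by (simp add: sign_kernel_cases tail_def mult_ac)
      next
        case False
        then show ?thesis using 1 tail_nonneg by (simp add: sign_kernel_cases)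
      qed
    qed
    also have "\<dots> = ennreal (exp (- (3 * \<beta> / 4) * t) * C1)"
    proof (subst nn_integral_eq_integral)
      show "integrable lborel (\<lambda>x. exp (- (3 * \<beta> / 4) * t) * (indicator {0<..} x * tail x))"
        using tail_integrable unfolding set_integrable_def by (intro integrable_mult_right) simp
      show "ennreal (LINT x|lborel. exp (- (3 * \<beta> / 4) * t) * (indicator {0<..} x * tail x)) = ennreal (exp (- (3 * \<beta> / 4) * t) * C1)"
        unfolding C1_def set_lebesgue_integral_def by simp
    qed (use tail_nonneg in auto)
    also have "\<dots> \<le> ennreal (C * (t powr q * exp (- (3 * \<beta> / 4) * t)))"
    proof (rule ennreal_leI)
      have "C1 \<le> C" unfolding C_def using p \<beta> by simp
      moreover have "1 \<le> t powr q" using 1 q by (intro ge_one_powr_ge_zero) auto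
      ultimately have "C1 * 1 \<le> C * t powr q" using C_nonneg by (intro mult_mono) auto
      then show "exp (- (3 * \<beta> / 4) * t) * C1 \<le> C * (t powr q * exp (- (3 * \<beta> / 4) * t))"
        by (simp add: mult_ac mult_left_mono)
    qed
    finally show ?thesis .
  next
    case 2
    have "(\<integral>\<^sup>+x. ennreal \<bar>sign_kernel t x * W' x\<bar> \<partial>lborel)
        \<le> (\<integral>\<^sup>+x. ennreal ((p + \<beta>) * t powr (p - 1)) * indicator {0<..<t} x \<partial>lborel)"
    proof (intro nn_integral_mono)
      fix x
      have "\<bar>W' x\<bar> \<le> (p + \<beta>) * t powr (p - 1)" if x: "0 < x" "x < t"
      proof -
        have "\<bar>W' x\<bar> \<le> (p * x powr (p - 1) + \<beta> * x powr p) * exp (- \<beta> * x)" by (rule W'_abs_le)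
        also have "\<dots> \<le> (p * x powr (p - 1) + \<beta> * x powr p) * 1"
          using x \<beta> p by (intro mult_left_mono) auto
        also have "\<dots> \<le> p * t powr (p - 1) + \<beta> * t powr (p - 1)"
        proof -
          have 1: "x powr (p - 1) \<le> t powr (p - 1)" using x p by (intro powr_mono2) auto
          have "x powr p \<le> x powr (p - 1)" using x 2 by (intro powr_mono') auto
          then have "x powr p \<le> t powr (p - 1)" using 1 by linarith
          then show ?thesis using 1 p \<beta> by (simp add: add_mono mult_left_mono)
        qed
        finally show ?thesis by (simp add: algebra_simps)
      qed
      then show "ennreal \<bar>sign_kernel t x * W' x\<bar> \<le> ennreal ((p + \<beta>) * t powr (p - 1)) * indicator {0<..<t} x"
        using 2 assms by (auto simp: sign_kernel_cases indicator_def intro!: ennreal_leI)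
    qed
    also have "\<dots> = ennreal ((p + \<beta>) * t powr (p - 1)) * ennreal t"
      using assms by (subst nn_integral_cmult_indicator) auto
    also have "\<dots> = ennreal ((p + \<beta>) * t powr p)"
    proof -
      have "t powr (p - 1) * t = t powr p" using assms powr_mult_base[of t "p - 1"] by (simp add: mult.commute)
      then show ?thesis using p \<beta> assms by (simp add: ennreal_mult'[symmetric] mult.assoc)
    qed
    also have "\<dots> \<le> ennreal (C * (t powr q * exp (- (3 * \<beta> / 4) * t)))"
    proof (rule ennreal_leI)
      have "t powr p \<le> t powr q" using 2 assms q by (intro powr_mono') auto
      then have "(p + \<beta>) * t powr p \<le> (p + \<beta>) * t powr q" using p \<beta> by (intro mult_left_mono) auto
      also have "\<dots> \<le> ((p + \<beta>) * t powr q) * (exp (3 * \<beta> / 4) * exp (- (3 * \<beta> / 4) * t))"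
      proof -
        have "1 \<le> exp (3 * \<beta> / 4) * exp (- (3 * \<beta> / 4) * t)"
          using 2 \<beta> unfolding exp_add[symmetric] by simp
        from mult_left_mono[OF this, of "(p + \<beta>) * t powr q"] show ?thesis using p \<beta> by simp
      qed
      also have "\<dots> = ((p + \<beta>) * exp (3 * \<beta> / 4)) * (t powr q * exp (- (3 * \<beta> / 4) * t))" by (simp add: mult_ac)
      also have "\<dots> \<le> C * (t powr q * exp (- (3 * \<beta> / 4) * t))"
        using C_nonneg by (intro mult_right_mono) (auto simp: C_def)
      finally show "(p + \<beta>) * t powr p \<le> C * (t powr q * exp (- (3 * \<beta> / 4) * t))" .
    qed
    finally show ?thesis .
  next
    case 3
    then show ?thesis by (simp add: sign_kernel_def)
  qed
qed

end

text \<open>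
  The polynomial \<open>- x\<^sup>-\<^sup>a e\<^sup>\<beta>\<^sup>x (x\<^sup>a\<^sup>+\<^sup>1 e\<^sup>-\<^sup>\<beta>\<^sup>x x\<^sup>n)'\<close>.
\<close>
definition deriv_adj_monom :: "real \<Rightarrow> real \<Rightarrow> nat \<Rightarrow> complex poly" where
  "deriv_adj_monom a \<beta> n = monom (of_real \<beta>) (Suc n) - monom (of_real (a + 1 + real n)) n"

text \<open>
  The adjoint of differentiation from the weight \<open>a\<close> to the weight \<open>a + 1\<close>, obtained from Fubini's theorem for
  \<open>sign_kernel t x * W' x * f' t\<close>. Integrating over \<open>t\<close> first gives \<open>\<integral> (f - f 1) W'\<close>, and \<open>W'\<close> has integral \<open>0\<close>;
  integrating over \<open>x\<close> first gives \<open>- \<integral> f'W\<close>.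
\<close>
lemma ip_deriv_monom:
  assumes a: "a \<ge> 0" and \<beta>: "\<beta> > 0" and f: "f \<in> L2 (lag a \<beta>)" and f': "f' \<in> L2 (lag (a + 1) \<beta>)"
    and AC: "\<And>x y. 0 < x \<Longrightarrow> x \<le> y \<Longrightarrow> f' absolutely_integrable_on {x..y} \<and> integral {x..y} f' = f y - f x"
  shows "ip (lag (a + 1) \<beta>) f' (rpoly (monom 1 n)) = ip (lag a \<beta>) f (rpoly (deriv_adj_monom a \<beta> n))"
proof -
  define p where "p = a + 1 + real n"
  interpret powr_exp p \<beta> by unfold_locales (use a \<beta> in \<open>auto simp: p_def\<close>)
  interpret M: poly_measure "lag a \<beta>" by (rule poly_measure_lag) (use a \<beta> in auto)
  interpret M1: poly_measure "lag (a + 1) \<beta>" by (rule poly_measure_lag) (use a \<beta> in auto)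
  define k where "k = (\<lambda>t x. sign_kernel t x * W' x)"
  define h where "h = (\<lambda>x. indicator {0<..} x *\<^sub>R f' x)"
  have km: "case_prod k \<in> borel_measurable (borel \<Otimes>\<^sub>M borel)" unfolding k_def by (rule sign_kernel_measurable)
  have hm: "h \<in> borel_measurable lebesgue"
    using f' unfolding h_def by (subst borel_measurable_restrict_space_iff[symmetric]) (auto simp: L2_def measurable_lag)
  have ht: "t > 0" if "h t \<noteq> 0" for t using that by (auto simp: h_def indicator_def split: if_splits)
  have bound: "(\<integral>\<^sup>+x. ennreal \<bar>k t x\<bar> \<partial>lborel) \<le> ennreal (C * (t powr (a + 1) * exp (- (3 * \<beta> / 4) * t)))" if "h t \<noteq> 0" for t
    unfolding k_def by (rule sign_kernel_bound) (use ht[OF that] a in \<open>auto simp: p_def\<close>)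
  have e4: "(\<lambda>x. of_real (x ^ 0 * exp (\<beta> / 4 * x))) \<in> L2 (lag (a + 1) \<beta>)"
    by (rule L2_lag_monomial_exp) (use a \<beta> in auto)
  have eqB: "C * (t powr (a + 1) * exp (- (3 * \<beta> / 4) * t)) * norm (h t)
     = C * norm (indicator {0<..} t *\<^sub>R ((t powr (a + 1) * exp (- \<beta> * t)) *\<^sub>R (f' t * cnj (of_real (t ^ 0 * exp (\<beta> / 4 * t))))))" for t
  proof -
    have "exp (- (3 * \<beta> / 4) * t) = exp (- \<beta> * t) * exp (\<beta> / 4 * t)"
      by (simp add: algebra_simps flip: exp_add)
    then show ?thesis by (simp add: h_def norm_mult abs_mult)
  qed
  have Bint: "integrable lebesgue (\<lambda>t. C * (t powr (a + 1) * exp (- (3 * \<beta> / 4) * t)) * norm (h t))"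
    unfolding eqB by (intro integrable_mult_right integrable_norm ip_lag_lebesgue(2)[OF f' e4])
  have piece: "(LINT t|lebesgue. k t x *\<^sub>R h t) = c *\<^sub>R (f z - f y)"
    if "0 < y" "y \<le> z" and eq: "\<And>t. t \<noteq> x \<Longrightarrow> t \<noteq> 1 \<Longrightarrow> k t x *\<^sub>R h t = c *\<^sub>R (indicator {y..z} t *\<^sub>R f' t)" for c x y z
  proof -
    have f'yz: "set_integrable lebesgue {y..z} f'" "integral {y..z} f' = f z - f y" using AC[OF that(1,2)] by auto
    have "(LINT t|lebesgue. k t x *\<^sub>R h t) = (LINT t|lebesgue. c *\<^sub>R (indicator {y..z} t *\<^sub>R f' t))"
    proof (rule integral_cong_AE)
      show "AE t in lebesgue. k t x *\<^sub>R h t = c *\<^sub>R (indicator {y..z} t *\<^sub>R f' t)"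
        using AE_lebesgue_neq[of x] AE_lebesgue_neq[of 1] by eventually_elim (rule eq)
      have "(\<lambda>t. k t x) \<in> borel_measurable borel" using measurable_compose[OF measurable_Pair2' km, of x] by simp
      then show "(\<lambda>t. k t x *\<^sub>R h t) \<in> borel_measurable lebesgue"
        by (rule borel_measurable_scaleR[OF borel_imp_lebesgue hm])
      show "(\<lambda>t. c *\<^sub>R (indicator {y..z} t *\<^sub>R f' t)) \<in> borel_measurable lebesgue"
        using f'yz(1) by (intro borel_measurable_scaleR[OF borel_measurable_const borel_measurable_integrable]) (simp add: set_integrable_def)
    qed
    also have "\<dots> = c *\<^sub>R (LINT t:{y..z}|lebesgue. f' t)"
      unfolding set_lebesgue_integral_def by (rule integral_scaleR_right)
    finally show ?thesis using set_lebesgue_integral_eq_integral(2)[OF f'yz(1)] f'yz(2) by simp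
  qed
  have inner: "(LINT t|lebesgue. k t x *\<^sub>R h t) = indicator {0<..} x *\<^sub>R (W' x *\<^sub>R (f x - f 1))" for x
  proof -
    consider "x \<le> 0" | "0 < x" "x \<le> 1" | "1 < x" by linarith
    then show ?thesis
    proof cases
      case 1
      have z: "(\<lambda>t. k t x *\<^sub>R h t) = (\<lambda>t. 0)"
        by (rule ext) (use 1 in \<open>auto simp: k_def sign_kernel_def indicator_def\<close>)
      show ?thesis unfolding z using 1 by simp
    next
      case 2
      then show ?thesis
        by (subst piece[of x 1 x "- W' x"]) (auto simp: k_def h_def sign_kernel_def indicator_def algebra_simps)
    next
      case 3
      then show ?thesis
        by (subst piece[of 1 x x "W' x"]) (auto simp: k_def h_def sign_kernel_def indicator_def)
    qed
  qed
  have Weq: "W' x = x powr a * exp (- \<beta> * x) * ((a + 1 + real n) * x ^ n - \<beta> * x ^ Suc n)"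
    and Wq: "W x = x powr (a + 1) * exp (- \<beta> * x) * x ^ n" if "x > 0" for x
  proof -
    have "x powr (p - 1) = x powr a * x ^ n" "x powr p = x powr a * x ^ Suc n"
      using that by (simp_all add: p_def powr_add powr_realpow)
    then show "W' x = x powr a * exp (- \<beta> * x) * ((a + 1 + real n) * x ^ n - \<beta> * x ^ Suc n)"
      unfolding W'_def by (simp add: p_def algebra_simps)
    show "W x = x powr (a + 1) * exp (- \<beta> * x) * x ^ n"
      unfolding W_def using that by (simp add: p_def powr_add powr_realpow)
  qed
  have W'f: "indicator {0<..} x *\<^sub>R (W' x *\<^sub>R f x) = - (indicator {0<..} x *\<^sub>R ((x powr a * exp (- \<beta> * x)) *\<^sub>R (f x * cnj (rpoly (deriv_adj_monom a \<beta> n) x))))" for x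
  proof (cases "x > 0")
    case True
    define q where "q = \<beta> * x ^ Suc n - (a + 1 + real n) * x ^ n"
    have "cnj (rpoly (deriv_adj_monom a \<beta> n) x) = of_real q"
      by (simp add: deriv_adj_monom_def rpoly_simps q_def)
    moreover have "W' x = - (x powr a * exp (- \<beta> * x) * q)"
      unfolding Weq[OF True] q_def by (simp add: algebra_simps)
    ultimately show ?thesis using True by (simp add: scaleR_conv_of_real mult_ac)
  qed simp
  have W'f_int: "integrable lebesgue (\<lambda>x. indicator {0<..} x *\<^sub>R (W' x *\<^sub>R f x))"
    unfolding W'f using ip_lag_lebesgue(2)[OF f M.rpoly_L2] by simp
  have W'1_int: "integrable lebesgue (\<lambda>x. indicator {0<..} x *\<^sub>R W' x)"
    using W'_integrable unfolding set_integrable_def by (subst integrable_completion) auto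
  have W'1: "(LINT x|lebesgue. indicator {0<..} x *\<^sub>R W' x) = 0"
    using W'_integral_total unfolding set_lebesgue_integral_def by (subst integral_completion) auto
  have "(LINT x|lebesgue. LINT t|lebesgue. k t x *\<^sub>R h t) = (LINT x|lebesgue. indicator {0<..} x *\<^sub>R (W' x *\<^sub>R f x) - (indicator {0<..} x *\<^sub>R W' x) *\<^sub>R f 1)"
    unfolding inner by (intro Bochner_Integration.integral_cong refl) (simp add: algebra_simps)
  also have "\<dots> = (LINT x|lebesgue. indicator {0<..} x *\<^sub>R (W' x *\<^sub>R f x)) - (LINT x|lebesgue. indicator {0<..} x *\<^sub>R W' x) *\<^sub>R f 1"
    using W'f_int W'1_int by (subst Bochner_Integration.integral_diff) auto
  also have "\<dots> = - ip (lag a \<beta>) f (rpoly (deriv_adj_monom a \<beta> n))"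
    unfolding W'1 W'f ip_lag_lebesgue(1)[OF f M.rpoly_L2] by simp
  finally have 1: "(LINT x|lebesgue. LINT t|lebesgue. k t x *\<^sub>R h t) = - ip (lag a \<beta>) f (rpoly (deriv_adj_monom a \<beta> n))" .
  have "(LINT x|lebesgue. LINT t|lebesgue. k t x *\<^sub>R h t) = (LINT t|lebesgue. (LINT x|lborel. k t x) *\<^sub>R h t)"
    by (rule kernel_integral_swap[OF km hm bound Bint])
  also have "\<dots> = (LINT t|lebesgue. - (indicator {0<..} t *\<^sub>R ((t powr (a + 1) * exp (- \<beta> * t)) *\<^sub>R (f' t * cnj (rpoly (monom 1 n) t)))))"
  proof (rule integral_cong_AE)
    show "AE t in lebesgue. (LINT x|lborel. k t x) *\<^sub>R h t = - (indicator {0<..} t *\<^sub>R ((t powr (a + 1) * exp (- \<beta> * t)) *\<^sub>R (f' t * cnj (rpoly (monom 1 n) t))))"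
      using AE_lebesgue_neq[of 1]
    proof eventually_elim
      case (elim t)
      show ?case
      proof (cases "t > 0")
        case True
        then show ?thesis using sign_kernel_integral[OF True elim]
          by (simp add: k_def h_def Wq rpoly_simps scaleR_conv_of_real mult_ac)
      qed (simp add: h_def)
    qed
    show "(\<lambda>t. - (indicator {0<..} t *\<^sub>R ((t powr (a + 1) * exp (- \<beta> * t)) *\<^sub>R (f' t * cnj (rpoly (monom 1 n) t))))) \<in> borel_measurable lebesgue"
      using ip_lag_lebesgue(2)[OF f' M1.rpoly_L2] by (intro borel_measurable_uminus borel_measurable_integrable)
    have "(\<lambda>t. LINT x|lborel. k t x) \<in> borel_measurable borel"
      using lborel.borel_measurable_lebesgue_integral[of k borel] km by (simp add: measurable_cong_sets[OF sets_pair_measure_cong[OF refl sets_lborel] refl])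
    then show "(\<lambda>t. (LINT x|lborel. k t x) *\<^sub>R h t) \<in> borel_measurable lebesgue"
      by (intro borel_measurable_scaleR borel_imp_lebesgue hm)
  qed
  also have "\<dots> = - ip (lag (a + 1) \<beta>) f' (rpoly (monom 1 n))"
    unfolding ip_lag_lebesgue(1)[OF f' M1.rpoly_L2] by simp
  finally show ?thesis using 1 by simp
qed

lemma ip_deriv:
  assumes a: "a \<ge> 0" and \<beta>: "\<beta> > 0" and f: "f \<in> L2 (lag a \<beta>)" and f': "f' \<in> L2 (lag (a + 1) \<beta>)"
    and AC: "\<And>x y. 0 < x \<Longrightarrow> x \<le> y \<Longrightarrow> f' absolutely_integrable_on {x..y} \<and> integral {x..y} f' = f y - f x"
  shows "ip (lag (a + 1) \<beta>) f' (rpoly r) = ip (lag a \<beta>) f (rpoly (lin_ext (deriv_adj_monom a \<beta>) r))"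
  by (rule ip_lin_ext[OF poly_measure_lag poly_measure_lag f' f ip_deriv_monom[OF assms]]) (use a \<beta> in auto)

lemma rpoly_has_vector_derivative: "(rpoly p has_vector_derivative rpoly (pderiv p) x) (at x within S)"
proof -
  have "(poly p has_field_derivative poly (pderiv p) (complex_of_real x)) (at (complex_of_real x))"
    by (rule poly_DERIV)
  from has_vector_derivative_real_field[OF this] show ?thesis
    by (simp add: rpoly_def[abs_def])
qed

lemma rpoly_AC: 
  assumes "x \<le> y"
  shows "rpoly (pderiv p) absolutely_integrable_on {x..y} \<and> integral {x..y} (rpoly (pderiv p)) = rpoly p y - rpoly p x"
proof
  have "continuous_on {x..y} (rpoly (pderiv p))"
    unfolding rpoly_def by (intro continuous_intros)
  then show "rpoly (pderiv p) absolutely_integrable_on {x..y}"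
    by (rule absolutely_integrable_continuous_real)
  show "integral {x..y} (rpoly (pderiv p)) = rpoly p y - rpoly p x"
    by (intro integral_unique fundamental_theorem_of_calculus assms rpoly_has_vector_derivative)
qed

section \<open>Comparison of the best-approximation errors\<close>

lemma L2_lag_AE_cong:
  assumes f: "f \<in> L2 (lag a \<beta>)" and g: "g \<in> borel_measurable (lebesgue_on {0<..})"
    and ae: "AE x in lebesgue. x > 0 \<longrightarrow> f x = g x"
  shows "g \<in> L2 (lag a \<beta>)" "sqnorm (lag a \<beta>) g = sqnorm (lag a \<beta>) f"
proof -
  have gm: "g \<in> borel_measurable (lag a \<beta>)" using g by (simp add: measurable_lag)
  have fm: "f \<in> borel_measurable (lag a \<beta>)" using f by (simp add: L2_def)
  have ae': "AE x in lag a \<beta>. (cmod (f x))\<^sup>2 = (cmod (g x))\<^sup>2"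
    unfolding AE_lag using ae by eventually_elim auto
  have "integrable (lag a \<beta>) (\<lambda>x. (cmod (g x))\<^sup>2)"
    by (rule integrable_cong_AE_imp[of _ "\<lambda>x. (cmod (f x))\<^sup>2"]) (use f gm ae' in \<open>auto simp: L2_def elim: eventually_mono\<close>)
  then show "g \<in> L2 (lag a \<beta>)" using gm by (simp add: L2_def)
  show "sqnorm (lag a \<beta>) g = sqnorm (lag a \<beta>) f"
    unfolding sqnorm_def by (rule integral_cong_AE) (use fm gm ae' in \<open>auto elim: eventually_mono\<close>)
qed

lemma ip_lag_AE_cong:
  assumes f: "f \<in> L2 (lag a \<beta>)" and g: "g \<in> L2 (lag a \<beta>)" and h: "h \<in> L2 (lag a \<beta>)"
    and ae: "AE x in lebesgue. x > 0 \<longrightarrow> f x = g x"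
  shows "ip (lag a \<beta>) f h = ip (lag a \<beta>) g h"
  unfolding ip_def
proof (rule integral_cong_AE)
  show "AE x in lag a \<beta>. f x * cnj (h x) = g x * cnj (h x)"
    unfolding AE_lag using ae by eventually_elim auto
qed (use ip_integrable[OF f h] ip_integrable[OF g h] in auto)

text \<open>
  Multiplication by \<open>x\<^sup>s e\<^sup>-\<^sup>\<lambda>\<^sup>x\<close>. It maps \<open>L\<^sup>2(x\<^sup>a e\<^sup>-\<^sup>2\<^sup>\<lambda>\<^sup>x dx)\<close> isometrically onto \<open>L\<^sup>2(\<omega>\<^sup>b)\<close> when \<open>b + 2s = a\<close>; it is used for
  \<open>s = \<nu>, b = -\<nu>\<close> and for \<open>s = 0\<close>.
\<close>
definition wexp :: "real \<Rightarrow> real \<Rightarrow> (real \<Rightarrow> complex) \<Rightarrow> real \<Rightarrow> complex" where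
  "wexp s lam f x = of_real (x powr s * exp (- lam * x)) * f x"

lemma wexp_measurable:
  "wexp s lam f \<in> borel_measurable (lebesgue_on {0<..}) \<longleftrightarrow> f \<in> borel_measurable (lebesgue_on {0<..})"
proof -
  have m: "(\<lambda>x. complex_of_real (x powr a * exp (b * x))) \<in> borel_measurable (lebesgue_on {0<..})" for a b
    by (intro borel_imp_lebesgue_on) measurable
  have 1: "wexp s lam f \<in> borel_measurable (lebesgue_on {0<..})" if "f \<in> borel_measurable (lebesgue_on {0<..})" for s lam f
    unfolding wexp_def using that m[of s "- lam"] by (intro borel_measurable_times)
  have "wexp (- s) (- lam) (wexp s lam f) x = f x" if "x > 0" for x
  proof -
    have "x powr - s * x powr s = 1" using that by (simp flip: powr_add)
    moreover have "exp (- (- lam) * x) * exp (- lam * x) = 1" by (simp flip: exp_add)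
    ultimately have "(x powr - s * exp (- (- lam) * x)) * (x powr s * exp (- lam * x)) = 1"
      by (simp only: mult.commute mult.left_commute mult.assoc)
    then show ?thesis unfolding wexp_def by (simp only: mult.assoc[symmetric] of_real_mult[symmetric]) simp
  qed
  then have "wexp (- s) (- lam) (wexp s lam f) \<in> borel_measurable (lebesgue_on {0<..}) \<longleftrightarrow> f \<in> borel_measurable (lebesgue_on {0<..})"
    by (intro measurable_cong) (simp add: space_restrict_space)
  then show ?thesis using 1 by blast
qed

lemma wexp_weight:
  assumes "x > 0" "b + 2 * s = a"
  shows "wexp s lam f x * cnj (wexp s lam g x) * of_real (x powr b) = (x powr a * exp (- (2 * lam) * x)) *\<^sub>R (f x * cnj (g x))"
    and "(cmod (wexp s lam f x))\<^sup>2 * x powr b = (x powr a * exp (- (2 * lam) * x)) *\<^sub>R (cmod (f x))\<^sup>2"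
proof -
  have 1: "(x powr s * exp (- lam * x)) * (x powr s * exp (- lam * x)) * x powr b = x powr a * exp (- (2 * lam) * x)"
  proof -
    have "x powr a = x powr s * x powr s * x powr b" using assms(2) by (simp flip: powr_add add: algebra_simps)
    moreover have "exp (- (2 * lam) * x) = exp (- lam * x) * exp (- lam * x)" by (simp flip: exp_add)
    ultimately show ?thesis by (simp only: mult.commute mult.left_commute mult.assoc)
  qed
  define A where "A = x powr s * exp (- lam * x)"
  have "wexp s lam f x * cnj (wexp s lam g x) * of_real (x powr b) = of_real (A * A * x powr b) * (f x * cnj (g x))"
    unfolding wexp_def A_def[symmetric] by (simp add: mult_ac)
  then show "wexp s lam f x * cnj (wexp s lam g x) * of_real (x powr b) = (x powr a * exp (- (2 * lam) * x)) *\<^sub>R (f x * cnj (g x))"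
    unfolding 1[folded A_def] by (simp add: scaleR_conv_of_real)
  have "(cmod (wexp s lam f x))\<^sup>2 * x powr b = (A * A * x powr b) * (cmod (f x))\<^sup>2"
    unfolding wexp_def A_def[symmetric] by (simp add: norm_mult power_mult_distrib power2_eq_square mult_ac)
  then show "(cmod (wexp s lam f x))\<^sup>2 * x powr b = (x powr a * exp (- (2 * lam) * x)) *\<^sub>R (cmod (f x))\<^sup>2"
    unfolding 1[folded A_def] by simp
qed

lemma weighted_L2_cong:
  assumes "\<And>x. x > 0 \<Longrightarrow> F x = G x"
  shows "F \<in> weighted_L2 b \<longleftrightarrow> G \<in> weighted_L2 b" "winner b F H = winner b G H" "winner b H F = winner b H G"
proof -
  have "F \<in> borel_measurable (lebesgue_on {0<..}) \<longleftrightarrow> G \<in> borel_measurable (lebesgue_on {0<..})"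
    by (rule measurable_cong) (use assms in \<open>simp add: space_restrict_space\<close>)
  moreover have "integrable (lebesgue_on {0<..}) (\<lambda>x. (cmod (F x))\<^sup>2 * x powr b) \<longleftrightarrow> integrable (lebesgue_on {0<..}) (\<lambda>x. (cmod (G x))\<^sup>2 * x powr b)"
    by (rule Bochner_Integration.integrable_cong) (use assms in \<open>simp_all add: space_restrict_space\<close>)
  ultimately show "F \<in> weighted_L2 b \<longleftrightarrow> G \<in> weighted_L2 b" by (simp add: weighted_L2_def)
  show "winner b F H = winner b G H" "winner b H F = winner b H G"
    unfolding winner_def by (rule Bochner_Integration.integral_cong; use assms in \<open>simp add: space_restrict_space\<close>)+
qed

lemma weighted_L2_wexp:
  assumes "b + 2 * s = a"
  shows "wexp s lam f \<in> weighted_L2 b \<longleftrightarrow> f \<in> L2 (lag a (2 * lam))"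
proof (cases "f \<in> borel_measurable (lebesgue_on {0<..})")
  case True
  have "integrable (lebesgue_on {0<..}) (\<lambda>x. (cmod (wexp s lam f x))\<^sup>2 * x powr b) \<longleftrightarrow>
        integrable (lebesgue_on {0<..}) (\<lambda>x. (x powr a * exp (- (2 * lam) * x)) *\<^sub>R (cmod (f x))\<^sup>2)"
    by (rule Bochner_Integration.integrable_cong[OF refl]) (use wexp_weight(2)[OF _ assms] in \<open>simp add: space_restrict_space\<close>)
  also have "\<dots> \<longleftrightarrow> integrable (lag a (2 * lam)) (\<lambda>x. (cmod (f x))\<^sup>2)"
    using True by (subst integrable_lag) auto
  finally show ?thesis using True by (simp add: weighted_L2_def L2_def wexp_measurable measurable_lag)
next
  case False
  then show ?thesis by (simp add: weighted_L2_def L2_def wexp_measurable measurable_lag)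
qed

lemma winner_wexp:
  assumes "b + 2 * s = a" and f: "f \<in> L2 (lag a (2 * lam))" and g: "g \<in> L2 (lag a (2 * lam))"
  shows "winner b (wexp s lam f) (wexp s lam g) = ip (lag a (2 * lam)) f g"
proof -
  have m: "(\<lambda>x. f x * cnj (g x)) \<in> borel_measurable (lebesgue_on {0<..})"
    using borel_measurable_integrable[OF ip_integrable[OF f g]] by (simp add: measurable_lag)
  show ?thesis
    unfolding winner_def ip_def integral_lag[OF m]
    by (rule Bochner_Integration.integral_cong[OF refl]) (use wexp_weight(1)[OF _ assms(1)] in \<open>simp add: space_restrict_space\<close>)
qed

lemma wnorm_wexp:
  assumes "b + 2 * s = a" and f: "f \<in> L2 (lag a (2 * lam))"
  shows "wnorm b (wexp s lam f) = sqrt (sqnorm (lag a (2 * lam)) f)"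
  unfolding wnorm_def winner_wexp[OF assms(1) f f] by (simp add: ip_self)

lemma deg_less_pderiv: "deg_less n p \<Longrightarrow> deg_less (n - 1) (pderiv p)"
  unfolding deg_less_def by (auto simp: coeff_pderiv)

lemma deg_less_pderiv_pow: "deg_less n p \<Longrightarrow> deg_less (n - k) ((pderiv ^^ k) p)"
proof (induction k)
  case (Suc k)
  then show ?case using deg_less_pderiv[of "n - k" "(pderiv ^^ k) p"] by simp
qed simp

lemma lin_ext_0 [simp]: "lin_ext T 0 = 0" by (simp add: lin_ext_def)

lemma deriv_adj_monom_degree: "deg_less (Suc i + 1) (deriv_adj_monom a \<beta> i)" "coeff (deriv_adj_monom a \<beta> i) (i + 1) = of_real \<beta>"
  by (auto simp: deriv_adj_monom_def deg_less_def)

lemma deriv_adj_degree: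
  assumes "deg_less n r"
  shows "deg_less (Suc n) (lin_ext (deriv_adj_monom a \<beta>) r)"
proof (cases n)
  case (Suc k)
  then show ?thesis using lin_ext_degree(1)[of 1 "deriv_adj_monom a \<beta>" k r] deriv_adj_monom_degree assms by simp
qed (use assms in simp)

lemma deriv_adj_pderiv_degree:
  assumes "deg_less n r"
  shows "deg_less n (lin_ext (deriv_adj_monom a \<beta>) (pderiv r))"
proof (cases n)
  case 0
  then show ?thesis using assms by simp
next
  case (Suc k)
  then show ?thesis using deriv_adj_degree[OF deg_less_pderiv[OF assms]] by simp
qed

text \<open>
  The differential equation of the Laguerre polynomials. The operator on the left is symmetric and preserves degrees,
  so it maps an orthogonal polynomial to a multiple of itself; the factor is its effect on the leading coefficient.
\<close>
lemma deriv_adj_pderiv_orthopoly: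
  assumes a: "a \<ge> 0" and \<beta>: "\<beta> > 0"
  shows "lin_ext (deriv_adj_monom a \<beta>) (pderiv (poly_measure.orthopoly (lag a \<beta>) n)) = smult (of_real (\<beta> * real n)) (poly_measure.orthopoly (lag a \<beta>) n)"
proof -
  interpret M: poly_measure "lag a \<beta>" by (rule poly_measure_lag) (use a \<beta> in auto)
  interpret M1: poly_measure "lag (a + 1) \<beta>" by (rule poly_measure_lag) (use a \<beta> in auto)
  define P where "P = M.orthopoly n"
  define R where "R = lin_ext (deriv_adj_monom a \<beta>) (pderiv P)"
  have adj: "ip (lag (a + 1) \<beta>) (rpoly (pderiv p)) (rpoly r) = ip (lag a \<beta>) (rpoly p) (rpoly (lin_ext (deriv_adj_monom a \<beta>) r))" for p r
    by (rule ip_deriv[OF a \<beta> M.rpoly_L2 M1.rpoly_L2 rpoly_AC])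
  have dP: "deg_less (Suc n) P" and cP: "coeff P n = 1" unfolding P_def by (rule M.deg_orthopoly M.coeff_orthopoly)+
  have R: "deg_less (Suc n) R" unfolding R_def by (rule deriv_adj_pderiv_degree[OF dP])
  have "ip (lag a \<beta>) (rpoly R) (rpoly r) = 0" if "deg_less n r" for r
  proof -
    have "ip (lag a \<beta>) (rpoly r) (rpoly R) = ip (lag (a + 1) \<beta>) (rpoly (pderiv r)) (rpoly (pderiv P))"
      unfolding R_def adj ..
    also have "\<dots> = cnj (ip (lag (a + 1) \<beta>) (rpoly (pderiv P)) (rpoly (pderiv r)))" by (rule ip_commute)
    also have "\<dots> = 0"
      unfolding adj P_def using M.orthopoly_orthogonal[OF deriv_adj_pderiv_degree[OF that]] by simp
    finally show ?thesis by (subst ip_commute) simp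
  qed
  then have "R = smult (coeff R n) P" unfolding P_def by (intro M.orthopoly_unique R)
  moreover have "coeff R n = of_real (\<beta> * real n)"
  proof (cases n)
    case 0
    then have "deg_less 0 (pderiv P)" using deg_less_pderiv[OF dP] by simp
    then show ?thesis using 0 by (simp add: R_def)
  next
    case (Suc k)
    have "deg_less (Suc k) (pderiv P)" using deg_less_pderiv[OF dP] Suc by simp
    from lin_ext_degree(2)[of 1 "deriv_adj_monom a \<beta>", OF deriv_adj_monom_degree(1) this] 
    have "coeff R (k + 1) = coeff (pderiv P) k * of_real \<beta>" unfolding R_def deriv_adj_monom_degree(2) .
    then show ?thesis using Suc cP by (simp add: coeff_pderiv mult.commute)
  qed
  ultimately show ?thesis by (simp add: R_def P_def)
qed

text \<open>
  The derivatives of the orthogonal polynomials \<open>P n\<close> are orthogonal for the weight \<open>a + 1\<close>, and after division by the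
  eigenvalue \<open>\<beta>n\<close> the coefficients of \<open>f'\<close> for them are those of \<open>f\<close>. Then \<open>\<parallel>Q n\<parallel>\<^sup>2 = \<parallel>P n\<parallel>\<^sup>2/(\<beta>n)\<close>, and \<open>n \<ge> K\<close> is all that occurs.
\<close>
lemma sqnorm_le_deriv:
  assumes a: "a \<ge> 0" and \<beta>: "\<beta> > 0" and f: "f \<in> L2 (lag a \<beta>)" and f': "f' \<in> L2 (lag (a + 1) \<beta>)"
    and AC: "\<And>x y. 0 < x \<Longrightarrow> x \<le> y \<Longrightarrow> f' absolutely_integrable_on {x..y} \<and> integral {x..y} f' = f y - f x"
    and K: "K \<ge> 1" and orth: "\<And>r. deg_less K r \<Longrightarrow> ip (lag a \<beta>) f (rpoly r) = 0"
  shows "sqnorm (lag a \<beta>) f \<le> 1 / (\<beta> * real K) * sqnorm (lag (a + 1) \<beta>) f'"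
proof -
  interpret M: poly_measure "lag a \<beta>" by (rule poly_measure_lag) (use a \<beta> in auto)
  interpret M1: poly_measure "lag (a + 1) \<beta>" by (rule poly_measure_lag) (use a \<beta> in auto)
  define P where "P = M.orthopoly"
  define c where "c = (\<lambda>n::nat. 1 / (\<beta> * real n))"
  define Q where "Q = (\<lambda>n. smult (of_real (c n)) (pderiv (P n)))"
  have adjP: "lin_ext (deriv_adj_monom a \<beta>) (pderiv (P n)) = smult (of_real (\<beta> * real n)) (P n)" for n
    unfolding P_def by (rule deriv_adj_pderiv_orthopoly[OF a \<beta>])
  have ipQ: "ip (lag (a + 1) \<beta>) (rpoly (pderiv p)) (rpoly (Q n)) = ip (lag a \<beta>) (rpoly p) (rpoly (P n))" if "n \<ge> 1" for p n
    unfolding Q_def using ip_deriv[OF a \<beta> M.rpoly_L2 M1.rpoly_L2 rpoly_AC, of p "pderiv (P n)"] that \<beta>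
    by (simp add: M1.ip_rpoly_right M.ip_rpoly_right adjP c_def)
  have ipf: "ip (lag (a + 1) \<beta>) f' (rpoly (Q n)) = ip (lag a \<beta>) f (rpoly (P n))" if "n \<ge> 1" for n
    unfolding Q_def using ip_deriv[OF a \<beta> f f' AC, of "pderiv (P n)"] that \<beta>
    by (simp add: M1.ip_rpoly_right[OF f'] M.ip_rpoly_right[OF f] adjP c_def)
  have Qn: "Q n = smult (of_real (c n)) (pderiv (P n))" for n by (simp add: Q_def)
  have QQ: "ip (lag (a + 1) \<beta>) (rpoly (Q n)) (rpoly (Q m)) = of_real (c n) * ip (lag a \<beta>) (rpoly (P n)) (rpoly (P m))" if "m \<ge> 1" for n m
    unfolding Qn[of n] M1.ip_rpoly_linear ipQ[OF that] ..
  have nQ: "sqnorm (lag (a + 1) \<beta>) (rpoly (Q n)) = c n * sqnorm (lag a \<beta>) (rpoly (P n))" if "n \<ge> 1" for n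
  proof -
    have "complex_of_real (sqnorm (lag (a + 1) \<beta>) (rpoly (Q n))) = of_real (c n * sqnorm (lag a \<beta>) (rpoly (P n)))"
      using QQ[OF that, of n] by (simp add: ip_self)
    then show ?thesis by (simp only: of_real_eq_iff)
  qed
  have OP: "orthogonal_family (lag a \<beta>) UNIV (\<lambda>n. rpoly (P n))" unfolding P_def by (rule M.orthogonal_family_orthopoly)
  show ?thesis
  proof (rule sqnorm_le_by_coefficients[OF OP _ f f'])
    show "orthogonal_family (lag (a + 1) \<beta>) {K..} (\<lambda>n. rpoly (Q n))"
      unfolding orthogonal_family_def
    proof (intro ballI conjI impI)
      fix n m assume "n \<in> {K..}" "m \<in> {K..}" "m \<noteq> n"
      then show "ip (lag (a + 1) \<beta>) (rpoly (Q m)) (rpoly (Q n)) = 0"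
        using QQ[of n m] OP K by (simp add: orthogonal_family_def)
    next
      fix n assume "n \<in> {K..}"
      then have "n \<ge> 1" using K by simp
      then show "sqnorm (lag (a + 1) \<beta>) (rpoly (Q n)) > 0"
        using nQ[of n] OP \<beta> by (simp add: orthogonal_family_def c_def)
    qed auto
    show "\<exists>n b. sqnorm (lag a \<beta>) (\<lambda>x. f x - (\<Sum>i<n. b i * rpoly (P i) x)) < \<epsilon>" if "\<epsilon> > 0" for \<epsilon>
      unfolding P_def by (rule M.dense_orthopoly[OF approx_lag[OF _ \<beta> f] that]) (use a in simp)
    show "ip (lag a \<beta>) f (rpoly (P n)) = 0" if "n < K" for n
      unfolding P_def by (rule orth[OF deg_less_mono[OF M.deg_orthopoly]]) (use that in simp)
    show "ip (lag a \<beta>) f (rpoly (P n)) = ip (lag (a + 1) \<beta>) f' (rpoly (Q n))" if "K \<le> n" for n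
      using ipf[of n] that K by simp
    show "sqnorm (lag (a + 1) \<beta>) (rpoly (Q n)) \<le> 1 / (\<beta> * real K) * sqnorm (lag a \<beta>) (rpoly (P n))" if "K \<le> n" for n
    proof -
      have "c n \<le> 1 / (\<beta> * real K)" unfolding c_def using that K \<beta> by (intro divide_left_mono mult_left_mono) auto
      from mult_right_mono[OF this sqnorm_nonneg] show ?thesis using nQ[of n] that K by simp
    qed
  qed (use \<beta> in auto)
qed

lemma fact_Gamma_decreasing:
  fixes \<nu> :: real
  assumes "\<nu> > 0" "K \<le> n"
  shows "fact n / Gamma (\<nu> + real n + 1) \<le> fact K / Gamma (\<nu> + real K + 1)"
  using assms(2)
proof (induction n rule: dec_induct)
  case (step n)
  have G: "Gamma (\<nu> + real n + 1) > 0" using assms by (intro Gamma_real_pos) auto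
  have "\<nu> + real (Suc n) + 1 = (\<nu> + real n + 1) + 1" by simp
  then have "Gamma (\<nu> + real (Suc n) + 1) = (\<nu> + real n + 1) * Gamma (\<nu> + real n + 1)"
    using assms by (simp only:) (rule Gamma_plus1, auto simp: nonpos_Ints_def)
  then have "fact (Suc n) / Gamma (\<nu> + real (Suc n) + 1) = ((real n + 1) / (\<nu> + real n + 1)) * (fact n / Gamma (\<nu> + real n + 1))"
    by (simp add: field_simps)
  also have "\<dots> \<le> 1 * (fact n / Gamma (\<nu> + real n + 1))"
    using assms G by (intro mult_right_mono) auto
  finally show ?case using step.IH by simp
qed simp

lemma rl_monom_degree: "deg_less (Suc n + 0) (rl_monom \<nu> n)" "coeff (rl_monom \<nu> n) n = of_real (fact n / Gamma (\<nu> + real n + 1))"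
  by (auto simp: rl_monom_def deg_less_def)

lemma rl_scaled_measurable:
  assumes "loc_integrable (restrict_pos \<gamma>)" "\<nu> > 0"
  shows "rl_scaled \<nu> \<gamma> \<in> borel_measurable (lebesgue_on {0<..})"
proof -
  have "rl_int \<nu> (restrict_pos \<gamma>) \<in> borel_measurable (lebesgue_on {0<..})"
    by (intro measurable_restrict_space1 loc_integrable_measurable loc_integrable_rl_int assms)
  moreover have "(\<lambda>x::real. x powr - \<nu>) \<in> borel_measurable (lebesgue_on {0<..})"
    by (intro borel_imp_lebesgue_on) measurable
  ultimately show ?thesis unfolding rl_scaled_def by (intro borel_measurable_scaleR)
qed

lemma rl_scaled_rpoly_L2:
  assumes \<nu>: "\<nu> > 0" and \<beta>: "\<beta> > 0"
  shows "rl_scaled \<nu> (rpoly r) \<in> L2 (lag \<nu> \<beta>)"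
proof -
  interpret M0: poly_measure "lag 0 \<beta>" by (rule poly_measure_lag) (use \<beta> in auto)
  interpret M: poly_measure "lag \<nu> \<beta>" by (rule poly_measure_lag) (use \<nu> \<beta> in auto)
  show ?thesis
    by (rule L2_lag_AE_cong(1)[OF M.rpoly_L2[of "lin_ext (rl_monom \<nu>) r"]])
       (use rl_scaled_rpoly[OF \<nu>] rl_scaled_measurable[OF L2_lag_0_loc_integrable[OF \<beta> M0.rpoly_L2] \<nu>] in auto)
qed

lemma ip_rl_scaled_rpoly:
  assumes \<nu>: "\<nu> > 0" and \<beta>: "\<beta> > 0"
  shows "ip (lag 0 \<beta>) (rpoly p) (rpoly (lin_ext (weyl_monom \<nu> \<beta>) r)) = ip (lag \<nu> \<beta>) (rpoly (lin_ext (rl_monom \<nu>) p)) (rpoly r)"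
proof -
  interpret M0: poly_measure "lag 0 \<beta>" by (rule poly_measure_lag) (use \<beta> in auto)
  interpret M: poly_measure "lag \<nu> \<beta>" by (rule poly_measure_lag) (use \<nu> \<beta> in auto)
  have "ip (lag \<nu> \<beta>) (rl_scaled \<nu> (rpoly p)) (rpoly r) = ip (lag \<nu> \<beta>) (rpoly (lin_ext (rl_monom \<nu>) p)) (rpoly r)"
    by (rule ip_lag_AE_cong[OF rl_scaled_rpoly_L2[OF \<nu> \<beta>] M.rpoly_L2 M.rpoly_L2]) (use rl_scaled_rpoly[OF \<nu>] in auto)
  then show ?thesis using ip_rl_scaled[OF \<nu> \<beta> M0.rpoly_L2 rl_scaled_rpoly_L2[OF \<nu> \<beta>], of p r] by simp
qed

text \<open>
  Let \<open>Q n\<close> be the image of the orthogonal polynomial \<open>P n\<close> of weight \<open>\<nu>\<close> under the adjoint. Applying \<open>x\<^sup>-\<^sup>\<nu>I\<^sup>\<nu>\<close> to it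
  multiplies the leading coefficient of \<open>P n\<close> by \<open>c n = \<beta>\<^sup>-\<^sup>\<nu>n!/\<Gamma>(\<nu> + n + 1)\<close>, so that the \<open>Q n\<close> are orthogonal with
  \<open>\<parallel>Q n\<parallel>\<^sup>2 = c n \<parallel>P n\<parallel>\<^sup>2\<close>, and \<open>c\<close> is decreasing.
\<close>
lemma sqnorm_le_rl_scaled:
  assumes \<nu>: "\<nu> > 0" and \<beta>: "\<beta> > 0" and \<gamma>: "\<gamma> \<in> L2 (lag 0 \<beta>)" and f: "rl_scaled \<nu> \<gamma> \<in> L2 (lag \<nu> \<beta>)"
    and orth: "\<And>r. deg_less K r \<Longrightarrow> ip (lag 0 \<beta>) \<gamma> (rpoly r) = 0"
  shows "sqnorm (lag \<nu> \<beta>) (rl_scaled \<nu> \<gamma>) \<le> \<beta> powr - \<nu> * (fact K / Gamma (\<nu> + real K + 1)) * sqnorm (lag 0 \<beta>) \<gamma>"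
proof -
  interpret M0: poly_measure "lag 0 \<beta>" by (rule poly_measure_lag) (use \<beta> in auto)
  interpret M: poly_measure "lag \<nu> \<beta>" by (rule poly_measure_lag) (use \<nu> \<beta> in auto)
  define P where "P = M.orthopoly"
  define Q where "Q = (\<lambda>n. lin_ext (weyl_monom \<nu> \<beta>) (P n))"
  define B where "B = (\<lambda>n. lin_ext (rl_monom \<nu>) (Q n))"
  define c where "c = (\<lambda>n. \<beta> powr - \<nu> * (fact n / Gamma (\<nu> + real n + 1)))"
  have G: "Gamma (\<nu> + real n + 1) > 0" for n using \<nu> by (intro Gamma_real_pos) auto
  have cpos: "c n > 0" for n unfolding c_def using G[of n] \<beta> by simp
  have dP: "deg_less (Suc n) (P n)" "coeff (P n) n = 1" for n unfolding P_def by (rule M.deg_orthopoly M.coeff_orthopoly)+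
  have dQ: "deg_less (Suc n) (Q n)" "coeff (Q n) n = of_real (\<beta> powr - \<nu>)" for n
    unfolding Q_def using lin_ext_degree[of 0 "weyl_monom \<nu> \<beta>", OF weyl_monom_degree(1)[OF \<nu> \<beta>] dP(1)] weyl_monom_degree(2)[OF \<nu> \<beta>] dP(2)[of n]
    by simp_all
  have dB: "deg_less (Suc n) (B n)" "coeff (B n) n = of_real (c n)" for n
    unfolding B_def c_def using lin_ext_degree[of 0 "rl_monom \<nu>", OF rl_monom_degree(1) dQ(1)[of n]] rl_monom_degree(2)[of \<nu> n] dQ(2)[of n]
    by simp_all
  have Qn: "Q n = lin_ext (weyl_monom \<nu> \<beta>) (P n)" for n by (simp add: Q_def)
  have QQ: "ip (lag 0 \<beta>) (rpoly (Q m)) (rpoly (Q n)) = ip (lag \<nu> \<beta>) (rpoly (B m)) (rpoly (P n))" for m n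
    unfolding Qn[of n] B_def by (rule ip_rl_scaled_rpoly[OF \<nu> \<beta>])
  have low: "ip (lag 0 \<beta>) (rpoly (Q m)) (rpoly (Q n)) = 0" if "m < n" for m n
  proof -
    have "ip (lag \<nu> \<beta>) (rpoly (P n)) (rpoly (B m)) = 0"
      unfolding P_def by (rule M.orthopoly_orthogonal[OF deg_less_mono[OF dB(1)]]) (use that in simp)
    then show ?thesis unfolding QQ by (subst ip_commute) simp
  qed
  have nQ: "sqnorm (lag 0 \<beta>) (rpoly (Q n)) = c n * sqnorm (lag \<nu> \<beta>) (rpoly (P n))" for n
  proof -
    \<comment> \<open>\<open>B n\<close> is a multiple of \<open>P n\<close> up to lower degrees, which are orthogonal to \<open>P n\<close>.\<close>
    define d where "d = B n - smult (coeff (B n) n) (P n)"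
    have "deg_less n d" unfolding d_def by (rule deg_less_diff_lead[OF dB(1) dP])
    then have "ip (lag \<nu> \<beta>) (rpoly (P n)) (rpoly d) = 0" unfolding P_def by (rule M.orthopoly_orthogonal)
    then have d0: "ip (lag \<nu> \<beta>) (rpoly d) (rpoly (P n)) = 0" by (subst ip_commute) simp
    have "B n = d + smult (of_real (c n)) (P n)" by (simp add: d_def dB(2))
    then have "ip (lag \<nu> \<beta>) (rpoly (B n)) (rpoly (P n)) = of_real (c n) * ip (lag \<nu> \<beta>) (rpoly (P n)) (rpoly (P n))"
      using d0 by (simp add: M.ip_rpoly_linear)
    then have "complex_of_real (sqnorm (lag 0 \<beta>) (rpoly (Q n))) = of_real (c n * sqnorm (lag \<nu> \<beta>) (rpoly (P n)))"
      using QQ[of n n] by (simp add: ip_self)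
    then show ?thesis by (simp only: of_real_eq_iff)
  qed
  have OP: "orthogonal_family (lag \<nu> \<beta>) UNIV (\<lambda>n. rpoly (P n))" unfolding P_def by (rule M.orthogonal_family_orthopoly)
  have ipf: "ip (lag \<nu> \<beta>) (rl_scaled \<nu> \<gamma>) (rpoly (P n)) = ip (lag 0 \<beta>) \<gamma> (rpoly (Q n))" for n
    unfolding Q_def by (rule ip_rl_scaled[OF \<nu> \<beta> \<gamma> f])
  have "sqnorm (lag \<nu> \<beta>) (rl_scaled \<nu> \<gamma>) \<le> c K * sqnorm (lag 0 \<beta>) \<gamma>"
  proof (rule sqnorm_le_by_coefficients[OF OP _ f \<gamma>])
    show "orthogonal_family (lag 0 \<beta>) {K..} (\<lambda>n. rpoly (Q n))"
      unfolding orthogonal_family_def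
    proof (intro ballI conjI impI)
      fix n m :: nat assume "m \<noteq> n"
      then consider "m < n" | "n < m" by linarith
      then show "ip (lag 0 \<beta>) (rpoly (Q m)) (rpoly (Q n)) = 0"
        using low ip_commute[of "lag 0 \<beta>" "rpoly (Q m)" "rpoly (Q n)"] by cases auto
    next
      fix n show "sqnorm (lag 0 \<beta>) (rpoly (Q n)) > 0"
        using nQ[of n] OP cpos[of n] by (simp add: orthogonal_family_def)
    qed auto
    show "\<exists>n b. sqnorm (lag \<nu> \<beta>) (\<lambda>x. rl_scaled \<nu> \<gamma> x - (\<Sum>i<n. b i * rpoly (P i) x)) < \<epsilon>" if "\<epsilon> > 0" for \<epsilon>
      unfolding P_def by (rule M.dense_orthopoly[OF approx_lag[OF _ \<beta> f] that]) (use \<nu> in simp)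
    show "ip (lag \<nu> \<beta>) (rl_scaled \<nu> \<gamma>) (rpoly (P n)) = 0" if "n < K" for n
      unfolding ipf by (rule orth[OF deg_less_mono[OF dQ(1)]]) (use that in simp)
    show "ip (lag \<nu> \<beta>) (rl_scaled \<nu> \<gamma>) (rpoly (P n)) = ip (lag 0 \<beta>) \<gamma> (rpoly (Q n))" for n by (rule ipf)
    show "sqnorm (lag 0 \<beta>) (rpoly (Q n)) \<le> c K * sqnorm (lag \<nu> \<beta>) (rpoly (P n))" if "K \<le> n" for n
    proof -
      have "c n \<le> c K" unfolding c_def using fact_Gamma_decreasing[OF \<nu> that] by (intro mult_left_mono) auto
      then show ?thesis unfolding nQ by (intro mult_right_mono) auto
    qed
  qed (use cpos[of K] in auto)
  then show ?thesis by (simp add: c_def)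
qed

section \<open>The error of the projection\<close>

lemma measurable_lebesgue_on_AE:
  fixes f g :: "real \<Rightarrow> complex"
  assumes f: "f \<in> borel_measurable (lebesgue_on {0<..})" and ae: "AE x in lebesgue. x > 0 \<longrightarrow> f x = g x"
  shows "g \<in> borel_measurable (lebesgue_on {0<..})"
proof -
  have "(\<lambda>x. indicator {0<..} x *\<^sub>R f x) \<in> borel_measurable lebesgue"
    using f by (subst borel_measurable_restrict_space_iff[symmetric]) auto
  then have "(\<lambda>x. indicator {0<..} x *\<^sub>R g x) \<in> borel_measurable lebesgue"
    by (rule borel_measurable_AE) (use ae in \<open>auto elim!: eventually_mono simp: indicator_def\<close>)
  then show ?thesis by (subst borel_measurable_restrict_space_iff) auto
qed

lemma F_space_iff: "\<phi> \<in> F_space N \<nu> lam \<longleftrightarrow> (\<exists>p. deg_less (Suc N) p \<and> \<phi> = wexp \<nu> lam (rpoly p))"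
  unfolding F_space_def deg_less_Suc_degree by (auto simp: wexp_def[abs_def] rpoly_def[abs_def])

lemma wnorm_cong:
  assumes "\<And>x. x > 0 \<Longrightarrow> F x = G x"
  shows "wnorm b F = wnorm b G"
  unfolding wnorm_def using weighted_L2_cong(2)[of F G b F, OF assms] weighted_L2_cong(3)[of F G b G, OF assms] by simp

text \<open>
  The orthogonality relations fix the polynomial, hence also the values of the projection at negative arguments; this makes
  the description in \<^const>\<open>proj\<close> definite.
\<close>
lemma proj_eqI:
  assumes \<nu>: "\<nu> > 0" and lam: "lam > 0" and u: "\<And>x. x > 0 \<Longrightarrow> u x = wexp \<nu> lam f x"
    and f: "f \<in> L2 (lag \<nu> (2 * lam))" and p: "deg_less (Suc N) p"
    and orth: "\<And>r. deg_less (Suc N) r \<Longrightarrow> ip (lag \<nu> (2 * lam)) (\<lambda>x. rpoly p x - f x) (rpoly r) = 0"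
  shows "proj N \<nu> lam u = wexp \<nu> lam (rpoly p)"
proof -
  interpret M: poly_measure "lag \<nu> (2 * lam)" by (rule poly_measure_lag) (use \<nu> lam in auto)
  have win: "winner (- \<nu>) (\<lambda>x. wexp \<nu> lam (rpoly p') x - u x) (wexp \<nu> lam (rpoly r)) = ip (lag \<nu> (2 * lam)) (\<lambda>x. rpoly p' x - f x) (rpoly r)" for p' r
  proof -
    have "winner (- \<nu>) (\<lambda>x. wexp \<nu> lam (rpoly p') x - u x) (wexp \<nu> lam (rpoly r)) = winner (- \<nu>) (wexp \<nu> lam (\<lambda>x. rpoly p' x - f x)) (wexp \<nu> lam (rpoly r))"
      by (rule weighted_L2_cong(2)) (simp add: u wexp_def right_diff_distrib)
    also have "\<dots> = ip (lag \<nu> (2 * lam)) (\<lambda>x. rpoly p' x - f x) (rpoly r)"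
      by (rule winner_wexp) (use f in auto)
    finally show ?thesis .
  qed
  show ?thesis
    unfolding proj_def
  proof (rule the_equality)
    show "wexp \<nu> lam (rpoly p) \<in> F_space N \<nu> lam \<and> (\<forall>\<phi>\<in>F_space N \<nu> lam. winner (- \<nu>) (\<lambda>x. wexp \<nu> lam (rpoly p) x - u x) \<phi> = 0)"
      using p orth win by (auto simp: F_space_iff)
  next
    fix w assume w: "w \<in> F_space N \<nu> lam \<and> (\<forall>\<phi>\<in>F_space N \<nu> lam. winner (- \<nu>) (\<lambda>x. w x - u x) \<phi> = 0)"
    then obtain p' where p': "deg_less (Suc N) p'" "w = wexp \<nu> lam (rpoly p')" by (auto simp: F_space_iff)
    have orth': "ip (lag \<nu> (2 * lam)) (\<lambda>x. rpoly p' x - f x) (rpoly r) = 0" if "deg_less (Suc N) r" for r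

    proof -
      have "wexp \<nu> lam (rpoly r) \<in> F_space N \<nu> lam" using that by (auto simp: F_space_iff)
      then have "winner (- \<nu>) (\<lambda>x. w x - u x) (wexp \<nu> lam (rpoly r)) = 0" using w by blast
      then show ?thesis unfolding p'(2) win .
    qed
    define d where "d = p' - p"
    have d: "deg_less (Suc N) d" unfolding d_def using p p' by auto
    have "rpoly d = (\<lambda>x. (rpoly p' x - f x) - (rpoly p x - f x))" by (simp add: d_def rpoly_simps fun_eq_iff)
    then have "ip (lag \<nu> (2 * lam)) (rpoly d) (rpoly d) = ip (lag \<nu> (2 * lam)) (\<lambda>x. (rpoly p' x - f x) - (rpoly p x - f x)) (rpoly d)" by simp
    also have "\<dots> = 0" using f orth[OF d] orth'[OF d] by (subst ip_diff_left) auto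
    finally have "d = 0" by (rule M.rpoly_eq_0)
    then show "w = wexp \<nu> lam (rpoly p)" using p'(2) by (simp add: d_def)
  qed
qed

text \<open>
  Let \<open>q\<close> be the projection of \<open>\<gamma>\<^sub>0\<close> in the weight \<open>0\<close>. Because the adjoints respect degrees, \<open>x\<^sup>-\<^sup>\<nu>I\<^sup>\<nu>q\<close> and \<open>q\<^sup>(\<^sup>k\<^sup>)\<close> are
  the projections of \<open>x\<^sup>-\<^sup>\<nu>v\<close> and of \<open>\<gamma>\<^sub>k\<close>. The errors \<open>\<eta>\<^sub>k = q\<^sup>(\<^sup>k\<^sup>) - \<gamma>\<^sub>k\<close> form a chain again, which shows that
  the error of the projection lies in the space and identifies its derivatives.
\<close>
lemma projection_error_bounds:
  fixes N m :: nat
  assumes \<nu>: "\<nu> > 0" and lam: "lam > 0" and mN: "m \<le> N + 1" and u: "u \<in> A_space m \<nu> lam"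
  defines "\<beta> \<equiv> 2 * lam" and "e \<equiv> \<lambda>x. proj N \<nu> lam u x - u x"
  shows "wnorm (- \<nu>) e \<le> sqrt (\<beta> powr - \<nu> * (fact (N + 1) / Gamma (\<nu> + real (N + 1) + 1)) * (\<Prod>i=0..<m. 1 / (\<beta> * real (N + 1 - i))))
            * wnorm (real m) (tempered_deriv (\<nu> + real m) lam u)"
    and "k \<le> m \<Longrightarrow> e \<in> A_space k \<nu> lam"
    and "k \<le> m \<Longrightarrow> wnorm (real k) (tempered_deriv (\<nu> + real k) lam e) \<le> sqrt (\<Prod>i=k..<m. 1 / (\<beta> * real (N + 1 - i)))
            * wnorm (real m) (tempered_deriv (\<nu> + real m) lam u)"
proof -
  have \<beta>: "\<beta> > 0" using lam by (simp add: \<beta>_def)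
  interpret M: poly_measure "lag \<nu> \<beta>" by (rule poly_measure_lag) (use \<nu> \<beta> in auto)
  interpret M0: poly_measure "lag 0 \<beta>" by (rule poly_measure_lag) (use \<beta> in auto)
  have pm: "poly_measure (lag (real k) \<beta>)" for k by (rule poly_measure_lag) (use \<beta> in auto)
  define v where "v = (\<lambda>x. of_real (exp (lam * x)) * u x)"
  define \<gamma> where "\<gamma> = (\<lambda>k::nat. RL_deriv (\<nu> + real k) v)"
  define f where "f = (\<lambda>x. of_real (x powr - \<nu>) * v x)"
  have uf: "u x = wexp \<nu> lam f x" and vf: "v x = (x powr \<nu>) *\<^sub>R f x" if "x > 0" for x
  proof -
    have 1: "x powr \<nu> * x powr - \<nu> = 1" using that by (simp flip: powr_add)
    have 2: "exp (- lam * x) * exp (lam * x) = 1" by (simp flip: exp_add)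
    have "(x powr \<nu> * exp (- lam * x)) * (x powr - \<nu> * exp (lam * x)) = (x powr \<nu> * x powr - \<nu>) * (exp (- lam * x) * exp (lam * x))"
      by (simp only: mult.commute mult.left_commute mult.assoc)
    then have "(x powr \<nu> * exp (- lam * x)) * (x powr - \<nu> * exp (lam * x)) = 1" unfolding 1 2 by simp
    then show "u x = wexp \<nu> lam f x"
      unfolding wexp_def f_def v_def by (simp only: mult.assoc[symmetric] of_real_mult[symmetric]) simp
    show "v x = (x powr \<nu>) *\<^sub>R f x"
      unfolding f_def scaleR_conv_of_real by (simp only: mult.assoc[symmetric] of_real_mult[symmetric] 1) simp
  qed
  have uA: "u \<in> weighted_L2 (- \<nu>)" "RL_differentiable_on \<nu> UNIV v"
    "\<And>k. k \<le> m \<Longrightarrow> RL_differentiable_on (\<nu> + real k) {0<..} v"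
    "\<And>k. k \<le> m \<Longrightarrow> tempered_deriv (\<nu> + real k) lam u \<in> weighted_L2 (real k)"
    using u by (auto simp: A_space_def v_def)
  have fL: "f \<in> L2 (lag \<nu> \<beta>)"
    using uA(1) weighted_L2_cong(1)[of u "wexp \<nu> lam f" "- \<nu>"] uf unfolding \<beta>_def
    by (subst weighted_L2_wexp[symmetric, of "- \<nu>" \<nu>]) auto
  have tw: "tempered_deriv \<mu> lam z x = wexp 0 lam (RL_deriv \<mu> (\<lambda>y. of_real (exp (lam * y)) * z y)) x" if "x > 0" for \<mu> z x
    using that by (simp add: tempered_deriv_def wexp_def)
  have \<gamma>L: "\<gamma> k \<in> L2 (lag (real k) \<beta>)" if "k \<le> m" for k
  proof -
    have "wexp 0 lam (\<gamma> k) \<in> weighted_L2 (real k)"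
      using uA(4)[OF that] weighted_L2_cong(1)[of "tempered_deriv (\<nu> + real k) lam u" "wexp 0 lam (\<gamma> k)"] tw
      by (simp add: \<gamma>_def v_def)
    then show ?thesis unfolding \<beta>_def by (subst (asm) weighted_L2_wexp) auto
  qed
  have wu: "wnorm (real m) (tempered_deriv (\<nu> + real m) lam u) = sqrt (sqnorm (lag (real m) \<beta>) (\<gamma> m))"
    using wnorm_cong[of "tempered_deriv (\<nu> + real m) lam u" "wexp 0 lam (\<gamma> m)"] tw wnorm_wexp[of "real m" 0 "real m" "\<gamma> m" lam] \<gamma>L[of m]
    by (simp add: \<gamma>_def v_def \<beta>_def)
  have pv: "restrict_pos v = restrict_pos (\<lambda>x. (x powr \<nu>) *\<^sub>R f x)"
    using vf by (auto simp: restrict_pos_def fun_eq_iff indicator_def)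
  have vloc: "loc_integrable (restrict_pos v)"
    unfolding pv by (rule L2_lag_loc_integrable[OF _ \<beta> fL]) (use \<nu> in simp)
  have chain: "RL_chain m \<nu> v \<gamma>"
    unfolding \<gamma>_def by (rule RL_chainI[OF \<nu> vloc uA(2) uA(3)[OF order_refl]])
  have g0: "\<gamma> 0 \<in> L2 (lag 0 \<beta>)" using \<gamma>L[of 0] by simp
  obtain q where q: "deg_less (Suc N) q" "\<And>r. deg_less (Suc N) r \<Longrightarrow> ip (lag 0 \<beta>) (\<lambda>x. \<gamma> 0 x - rpoly q x) (rpoly r) = 0"
    using M0.orthogonal_projection_exists[OF g0, of "Suc N"] by blast
  \<comment> \<open>The sign is that of the error \<open>\<pi>u - u\<close>.\<close>
  define \<eta> where "\<eta> = (\<lambda>k x. rpoly ((pderiv ^^ k) q) x - \<gamma> k x)"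
  have \<eta>L: "\<eta> k \<in> L2 (lag (real k) \<beta>)" if "k \<le> m" for k
    unfolding \<eta>_def by (intro L2_diff poly_measure.rpoly_L2[OF pm] \<gamma>L that)
  have AC: "AC_chain m {0<..} \<eta>"
    unfolding \<eta>_def
  proof (rule AC_chain_diff)
    show "AC_chain m {0<..} (\<lambda>k. rpoly ((pderiv ^^ k) q))"
      unfolding AC_chain_def using rpoly_AC by simp
    show "AC_chain m {0<..} \<gamma>" using chain by (simp add: RL_chain_def)
  qed
  have step: "\<eta> (Suc k) absolutely_integrable_on {x..y} \<and> integral {x..y} (\<eta> (Suc k)) = \<eta> k y - \<eta> k x"
    if "k < m" "0 < x" "x \<le> y" for k x y
    using AC_chainD[OF AC that(1), of x y] that by auto
  have orth: "ip (lag (real k) \<beta>) (\<eta> k) (rpoly r) = 0" if "k \<le> m" "deg_less (Suc N - k) r" for k r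
    using that
  proof (induction k arbitrary: r)
    case 0
    have "ip (lag 0 \<beta>) (\<eta> 0) (rpoly r) = ip (lag 0 \<beta>) (\<lambda>x. (-1) * (\<gamma> 0 x - rpoly q x)) (rpoly r)"
      by (simp add: \<eta>_def)
    then show ?case using q(2)[of r] 0 by (simp only: ip_cmult_left) simp
  next
    case (Suc k)
    have k: "k < m" using Suc.prems by simp
    have "deg_less (Suc N - k) (lin_ext (deriv_adj_monom (real k) \<beta>) r)"
    proof -
      have "deg_less (Suc (N - k)) (lin_ext (deriv_adj_monom (real k) \<beta>) r)"
        using deriv_adj_degree[of "N - k" r "real k" \<beta>] Suc.prems by simp
      moreover have "Suc (N - k) = Suc N - k" using k mN by simp
      ultimately show ?thesis by simp
    qed
    then have "ip (lag (real k) \<beta>) (\<eta> k) (rpoly (lin_ext (deriv_adj_monom (real k) \<beta>) r)) = 0"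
      using Suc.IH k by simp
    moreover have "ip (lag (real k + 1) \<beta>) (\<eta> (Suc k)) (rpoly r) = ip (lag (real k) \<beta>) (\<eta> k) (rpoly (lin_ext (deriv_adj_monom (real k) \<beta>) r))"
      by (rule ip_deriv[OF _ \<beta> \<eta>L _ step[OF k]]) (use k \<eta>L[of "Suc k"] in \<open>auto simp: add.commute\<close>)
    ultimately show ?case by (simp add: add.commute)
  qed
  have top: "sqnorm (lag (real m) \<beta>) (\<eta> m) \<le> sqnorm (lag (real m) \<beta>) (\<gamma> m)"
  proof -
    interpret Mm: poly_measure "lag (real m) \<beta>" by (rule pm)
    let ?q = "(pderiv ^^ m) q"
    have "sqnorm (lag (real m) \<beta>) (\<eta> m) = sqnorm (lag (real m) \<beta>) (\<lambda>x. \<gamma> m x - rpoly ?q x)"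
      unfolding sqnorm_def \<eta>_def by (simp add: norm_minus_commute)
    also have "\<dots> \<le> sqnorm (lag (real m) \<beta>) (\<gamma> m)"
    proof (rule Mm.residual_sqnorm_le[OF \<gamma>L[OF order_refl] deg_less_pderiv_pow[OF q(1)]])
      fix r assume r: "deg_less (Suc N - m) r"
      have "ip (lag (real m) \<beta>) (\<lambda>x. \<gamma> m x - rpoly ?q x) (rpoly r) = ip (lag (real m) \<beta>) (\<lambda>x. (-1) * \<eta> m x) (rpoly r)"
        by (simp add: \<eta>_def)
      also have "\<dots> = 0" unfolding ip_cmult_left using orth[OF order_refl r] by simp
      finally show "ip (lag (real m) \<beta>) (\<lambda>x. \<gamma> m x - rpoly ?q x) (rpoly r) = 0" .
    qed
    finally show ?thesis .
  qed
  have bound: "sqnorm (lag (real k) \<beta>) (\<eta> k) \<le> (\<Prod>i=k..<m. 1 / (\<beta> * real (N + 1 - i))) * sqnorm (lag (real m) \<beta>) (\<gamma> m)" if "k \<le> m" for k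
    using that
  proof (induction k rule: inc_induct)
    case base
    then show ?case using top by simp
  next
    case (step k)
    have "sqnorm (lag (real k) \<beta>) (\<eta> k) \<le> 1 / (\<beta> * real (Suc N - k)) * sqnorm (lag (real k + 1) \<beta>) (\<eta> (Suc k))"
    proof (rule sqnorm_le_deriv[OF _ \<beta>])
      show "\<eta> (Suc k) \<in> L2 (lag (real k + 1) \<beta>)" using \<eta>L[of "Suc k"] step.hyps by (simp add: add.commute)
      show "ip (lag (real k) \<beta>) (\<eta> k) (rpoly r) = 0" if "deg_less (Suc N - k) r" for r
        using orth[OF _ that] step.hyps by simp
      show "1 \<le> Suc N - k" using step.hyps mN by simp
    qed (use step.hyps \<eta>L \<open>\<And>x y k. k < m \<Longrightarrow> 0 < x \<Longrightarrow> x \<le> y \<Longrightarrow> \<eta> (Suc k) absolutely_integrable_on {x..y} \<and> integral {x..y} (\<eta> (Suc k)) = \<eta> k y - \<eta> k x\<close> in auto)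
    also have "\<dots> \<le> 1 / (\<beta> * real (Suc N - k)) * ((\<Prod>i=Suc k..<m. 1 / (\<beta> * real (N + 1 - i))) * sqnorm (lag (real m) \<beta>) (\<gamma> m))"
      using step.IH \<beta> by (intro mult_left_mono) (auto simp: add.commute)
    also have "\<dots> = (\<Prod>i=k..<m. 1 / (\<beta> * real (N + 1 - i))) * sqnorm (lag (real m) \<beta>) (\<gamma> m)"
      using step.hyps by (simp add: prod.atLeast_Suc_lessThan)
    finally show ?case .
  qed
  define p where "p = lin_ext (rl_monom \<nu>) q"
  have p: "deg_less (Suc N) p"
    unfolding p_def using lin_ext_degree(1)[of 0 "rl_monom \<nu>", OF rl_monom_degree(1) q(1)] by simp
  have \<eta>0L: "\<eta> 0 \<in> L2 (lag 0 \<beta>)" using \<eta>L[of 0] by simp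
  have loc\<eta>: "loc_integrable (restrict_pos (\<eta> 0))" by (rule L2_lag_0_loc_integrable[OF \<beta> \<eta>0L])
  have locg: "loc_integrable (restrict_pos (\<gamma> 0))" by (rule L2_lag_0_loc_integrable[OF \<beta> g0])
  have locq: "loc_integrable (restrict_pos (rpoly q))" by (rule L2_lag_0_loc_integrable[OF \<beta> M0.rpoly_L2])
  \<comment> \<open>The integrals of \<open>q\<close> and \<open>\<gamma> 0\<close> converge absolutely at almost every \<open>x\<close>, and there \<open>I\<^sup>\<nu>\<close> is additive.\<close>
  have AEr: "AE x in lebesgue. x > 0 \<longrightarrow> rl_int \<nu> (restrict_pos (\<eta> 0)) x = (x powr \<nu>) *\<^sub>R (rpoly p x - f x)"
    using AE_integrable_rl_kernel[OF locg \<nu>] AE_integrable_rl_kernel[OF locq \<nu>] chain[unfolded RL_chain_def, THEN conjunct2, THEN conjunct1]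
  proof eventually_elim
    case (elim x)
    show ?case
    proof
      assume x: "x > 0"
      have 1: "x powr \<nu> * x powr - \<nu> = 1" using x by (simp flip: powr_add)
      have "rl_int \<nu> (restrict_pos (\<eta> 0)) x = (LINT y|lebesgue. rl_kernel \<nu> (x - y) *\<^sub>R restrict_pos (rpoly q) y - rl_kernel \<nu> (x - y) *\<^sub>R restrict_pos (\<gamma> 0) y)"
        unfolding rl_int_def by (rule Bochner_Integration.integral_cong[OF refl]) (simp add: \<eta>_def restrict_pos_def algebra_simps)
      also have "\<dots> = rl_int \<nu> (restrict_pos (rpoly q)) x - rl_int \<nu> (restrict_pos (\<gamma> 0)) x"
        unfolding rl_int_def by (rule Bochner_Integration.integral_diff[OF elim(2,1)])
      also have "rl_int \<nu> (restrict_pos (\<gamma> 0)) x = (x powr \<nu>) *\<^sub>R f x" using elim(3) x vf by simp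
      also have "rl_int \<nu> (restrict_pos (rpoly q)) x = (x powr \<nu> * x powr - \<nu>) *\<^sub>R rl_int \<nu> (restrict_pos (rpoly q)) x" unfolding 1 by simp
      also have "\<dots> = (x powr \<nu>) *\<^sub>R rpoly p x"
        using rl_scaled_rpoly[OF \<nu> x, of q] by (simp add: rl_scaled_def p_def flip: scaleR_scaleR)
      finally show "rl_int \<nu> (restrict_pos (\<eta> 0)) x = (x powr \<nu>) *\<^sub>R (rpoly p x - f x)" by (simp add: algebra_simps)
    qed
  qed
  have AEs: "AE x in lebesgue. x > 0 \<longrightarrow> rpoly p x - f x = rl_scaled \<nu> (\<eta> 0) x"
    using AEr
  proof eventually_elim
    case (elim x)
    show ?case
    proof
      assume x: "x > 0"
      have 1: "x powr - \<nu> * x powr \<nu> = 1" using x by (simp flip: powr_add)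
      show "rpoly p x - f x = rl_scaled \<nu> (\<eta> 0) x"
        unfolding rl_scaled_def using elim x by (simp only: scaleR_scaleR 1) simp
    qed
  qed
  have pfL: "(\<lambda>x. rpoly p x - f x) \<in> L2 (lag \<nu> \<beta>)" using fL by blast
  have sL: "rl_scaled \<nu> (\<eta> 0) \<in> L2 (lag \<nu> \<beta>)"
    and snsq: "sqnorm (lag \<nu> \<beta>) (rl_scaled \<nu> (\<eta> 0)) = sqnorm (lag \<nu> \<beta>) (\<lambda>x. rpoly p x - f x)"
    using L2_lag_AE_cong[OF pfL rl_scaled_measurable[OF loc\<eta> \<nu>] AEs] by auto
  have orth0: "ip (lag 0 \<beta>) (\<eta> 0) (rpoly r) = 0" if "deg_less (Suc N) r" for r
    using orth[of 0 r] that by simp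
  have orth\<nu>: "ip (lag \<nu> \<beta>) (\<lambda>x. rpoly p x - f x) (rpoly r) = 0" if "deg_less (Suc N) r" for r
  proof -
    have "ip (lag \<nu> \<beta>) (\<lambda>x. rpoly p x - f x) (rpoly r) = ip (lag \<nu> \<beta>) (rl_scaled \<nu> (\<eta> 0)) (rpoly r)"
      by (rule ip_lag_AE_cong[OF pfL sL M.rpoly_L2 AEs])
    also have "\<dots> = ip (lag 0 \<beta>) (\<eta> 0) (rpoly (lin_ext (weyl_monom \<nu> \<beta>) r))"
      by (rule ip_rl_scaled[OF \<nu> \<beta> \<eta>0L sL])
    also have "\<dots> = 0"
      using lin_ext_degree(1)[of 0 "weyl_monom \<nu> \<beta>", OF weyl_monom_degree(1)[OF \<nu> \<beta>] that] by (intro orth0) simp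
    finally show ?thesis .
  qed
  have proj: "proj N \<nu> lam u = wexp \<nu> lam (rpoly p)"
    by (rule proj_eqI[OF \<nu> lam uf _ p]) (use fL orth\<nu> in \<open>simp_all add: \<beta>_def\<close>)
  have ef: "e x = wexp \<nu> lam (\<lambda>x. rpoly p x - f x) x" if "x > 0" for x
    unfolding e_def proj uf[OF that] by (simp add: wexp_def right_diff_distrib)
  have eW: "e \<in> weighted_L2 (- \<nu>)"
    using pfL weighted_L2_cong(1)[of e "wexp \<nu> lam (\<lambda>x. rpoly p x - f x)", OF ef]
    unfolding \<beta>_def by (subst (asm) weighted_L2_wexp[symmetric, of "- \<nu>" \<nu>]) auto
  have "wnorm (- \<nu>) e = wnorm (- \<nu>) (wexp \<nu> lam (\<lambda>x. rpoly p x - f x))" by (rule wnorm_cong[OF ef])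
  also have "\<dots> = sqrt (sqnorm (lag \<nu> \<beta>) (\<lambda>x. rpoly p x - f x))"
    unfolding \<beta>_def by (rule wnorm_wexp) (use pfL in \<open>auto simp: \<beta>_def\<close>)
  also have "\<dots> = sqrt (sqnorm (lag \<nu> \<beta>) (rl_scaled \<nu> (\<eta> 0)))" unfolding snsq ..
  also have "\<dots> \<le> sqrt (\<beta> powr - \<nu> * (fact (N + 1) / Gamma (\<nu> + real (N + 1) + 1)) * sqnorm (lag 0 \<beta>) (\<eta> 0))"
    by (rule real_sqrt_le_mono, rule sqnorm_le_rl_scaled[OF \<nu> \<beta> \<eta>0L sL]) (rule orth0, simp)
  also have "\<dots> \<le> sqrt (\<beta> powr - \<nu> * (fact (N + 1) / Gamma (\<nu> + real (N + 1) + 1)) * ((\<Prod>i=0..<m. 1 / (\<beta> * real (N + 1 - i))) * sqnorm (lag (real m) \<beta>) (\<gamma> m)))"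
  proof -
    have "Gamma (\<nu> + real (N + 1) + 1) > 0" using \<nu> by (intro Gamma_real_pos) auto
    then show ?thesis using bound[of 0] by (intro real_sqrt_le_mono mult_left_mono) auto
  qed
  also have "\<dots> = sqrt (\<beta> powr - \<nu> * (fact (N + 1) / Gamma (\<nu> + real (N + 1) + 1)) * (\<Prod>i=0..<m. 1 / (\<beta> * real (N + 1 - i)))) * wnorm (real m) (tempered_deriv (\<nu> + real m) lam u)"
    unfolding wu by (simp only: real_sqrt_mult mult.assoc)
  finally show "wnorm (- \<nu>) e \<le> sqrt (\<beta> powr - \<nu> * (fact (N + 1) / Gamma (\<nu> + real (N + 1) + 1)) * (\<Prod>i=0..<m. 1 / (\<beta> * real (N + 1 - i))))
            * wnorm (real m) (tempered_deriv (\<nu> + real m) lam u)" .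
  define z where "z = (\<lambda>x. of_real (exp (lam * x)) * e x)"
  have zf: "z x = (x powr \<nu>) *\<^sub>R (rpoly p x - f x)" if "x > 0" for x
  proof -
    have "exp (lam * x) * (x powr \<nu> * exp (- lam * x)) = x powr \<nu>"
      by (simp add: mult.left_commute[of _ "x powr \<nu>"] flip: exp_add)
    then show ?thesis
      unfolding z_def ef[OF that] wexp_def scaleR_conv_of_real by (simp only: mult.assoc[symmetric] of_real_mult[symmetric])
  qed
  have zchain: "RL_chain m \<nu> z \<eta>"
    unfolding RL_chain_def
  proof (intro conjI loc\<eta> AC)
    show "AE x in lebesgue. restrict_pos z x = rl_int \<nu> (restrict_pos (\<eta> 0)) x"
      using AEr
    proof eventually_elim
      case (elim x)
      then show ?case using zf[of x] rl_int_nonpos[OF loc\<eta>, of x] by (cases "x > 0") auto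
    qed
  qed
  have tL: "tempered_deriv (\<nu> + real k) lam e \<in> weighted_L2 (real k)"
    and tn: "wnorm (real k) (tempered_deriv (\<nu> + real k) lam e) = sqrt (sqnorm (lag (real k) \<beta>) (\<eta> k))" if "k \<le> m" for k
  proof -
    let ?D = "RL_deriv (\<nu> + real k) z"
    have ae: "AE x in lebesgue. x > 0 \<longrightarrow> \<eta> k x = ?D x"
      using RL_chain_RL_deriv[OF \<nu> zchain that] by eventually_elim auto
    have mD: "?D \<in> borel_measurable (lebesgue_on {0<..})"
      by (rule measurable_lebesgue_on_AE[OF _ ae]) (use \<eta>L[OF that] in \<open>simp add: L2_def measurable_lag\<close>)
    have DL: "?D \<in> L2 (lag (real k) \<beta>)" and Dn: "sqnorm (lag (real k) \<beta>) ?D = sqnorm (lag (real k) \<beta>) (\<eta> k)"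
      using L2_lag_AE_cong[OF \<eta>L[OF that] mD ae] by auto
    have t: "tempered_deriv (\<nu> + real k) lam e x = wexp 0 lam ?D x" if "x > 0" for x
      using tw[OF that] by (simp add: z_def)
    show "tempered_deriv (\<nu> + real k) lam e \<in> weighted_L2 (real k)"
    proof -
      have "wexp 0 lam ?D \<in> weighted_L2 (real k)"
        using DL unfolding \<beta>_def by (subst weighted_L2_wexp) auto
      then show ?thesis using weighted_L2_cong(1)[of "tempered_deriv (\<nu> + real k) lam e" "wexp 0 lam ?D" "real k"] t by blast
    qed
    have "wnorm (real k) (tempered_deriv (\<nu> + real k) lam e) = wnorm (real k) (wexp 0 lam ?D)" by (rule wnorm_cong[OF t])
    also have "\<dots> = sqrt (sqnorm (lag (real k) \<beta>) ?D)"
      unfolding \<beta>_def by (rule wnorm_wexp) (use DL in \<open>auto simp: \<beta>_def\<close>)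
    finally show "wnorm (real k) (tempered_deriv (\<nu> + real k) lam e) = sqrt (sqnorm (lag (real k) \<beta>) (\<eta> k))" unfolding Dn .
  qed
  show "e \<in> A_space k \<nu> lam" if "k \<le> m"
    unfolding A_space_def mem_Collect_eq z_def[symmetric]
    using eW RL_chain_RL_differentiable_UNIV[OF \<nu> zchain] RL_chain_RL_differentiable_pos[OF \<nu> zchain] tL that by auto
  show "wnorm (real k) (tempered_deriv (\<nu> + real k) lam e) \<le> sqrt (\<Prod>i=k..<m. 1 / (\<beta> * real (N + 1 - i)))
            * wnorm (real m) (tempered_deriv (\<nu> + real m) lam u)" if "k \<le> m"
    unfolding tn[OF that] wu real_sqrt_mult[symmetric] using bound[OF that] by simp
qed

lemma factor_ratio_tendsto:
  fixes k m :: nat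
  shows "(\<lambda>N. \<Prod>i=k..<m. real N / real (N + 1 - i)) \<longlonglongrightarrow> 1"
proof -
  have "(\<lambda>N. real N / real (N + 1 - i)) \<longlonglongrightarrow> 1" for i
  proof -
    have "(\<lambda>N. real N / (real N + 1 - real i)) \<longlonglongrightarrow> 1" by real_asymp
    then show ?thesis
    proof (rule Lim_transform_eventually)
      show "eventually (\<lambda>N. real N / (real N + 1 - real i) = real N / real (N + 1 - i)) sequentially"
        using eventually_ge_at_top[of i] by eventually_elim (simp add: of_nat_diff)
    qed
  qed
  then have "(\<lambda>N. \<Prod>i=k..<m. real N / real (N + 1 - i)) \<longlonglongrightarrow> (\<Prod>i=k..<m. 1)" by (intro tendsto_prod)
  then show ?thesis by simp
qed

text \<open>
  Euler's limit formula for the Gamma function, shifted by two steps of the functional equation.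
\<close>
lemma Gamma_ratio_tendsto:
  fixes \<nu> :: real
  assumes \<nu>: "\<nu> > 0"
  shows "(\<lambda>N. real N powr \<nu> * (fact (N + 1) / Gamma (\<nu> + real (N + 1) + 1))) \<longlonglongrightarrow> 1"
proof -
  have G: "Gamma \<nu> > 0" using \<nu> by (rule Gamma_real_pos)
  have nz: "\<nu> \<notin> \<int>\<^sub>\<le>\<^sub>0" using \<nu> by (auto simp: nonpos_Ints_def)
  have "(\<lambda>N. (Gamma_series' \<nu> N / Gamma \<nu>) * (real N * (real N + 1) / ((\<nu> + real N) * (\<nu> + real N + 1)))) \<longlonglongrightarrow> (Gamma \<nu> / Gamma \<nu>) * 1"
  proof (intro tendsto_mult tendsto_divide Gamma_series'_LIMSEQ tendsto_const)
    show "(\<lambda>N. real N * (real N + 1) / ((\<nu> + real N) * (\<nu> + real N + 1))) \<longlonglongrightarrow> 1" by real_asymp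
  qed (use G in auto)
  moreover have "eventually (\<lambda>N. (Gamma_series' \<nu> N / Gamma \<nu>) * (real N * (real N + 1) / ((\<nu> + real N) * (\<nu> + real N + 1)))
       = real N powr \<nu> * (fact (N + 1) / Gamma (\<nu> + real (N + 1) + 1))) sequentially"
    using eventually_ge_at_top[of 1]
  proof eventually_elim
    case (elim N)
    have GN: "Gamma (\<nu> + real N) > 0" using \<nu> by (intro Gamma_real_pos) auto
    have p1: "Gamma (\<nu> + real N + 1) = (\<nu> + real N) * Gamma (\<nu> + real N)"
      using \<nu> by (intro Gamma_plus1) (auto simp: nonpos_Ints_def)
    have p2: "Gamma (\<nu> + real (N + 1) + 1) = (\<nu> + real N + 1) * ((\<nu> + real N) * Gamma (\<nu> + real N))"
    proof -
      have "Gamma (\<nu> + real N + 1 + 1) = (\<nu> + real N + 1) * Gamma (\<nu> + real N + 1)"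
        using \<nu> by (intro Gamma_plus1) (auto simp: nonpos_Ints_def)
      then show ?thesis unfolding p1 by (simp add: add_ac)
    qed
    have f1: "fact (N + 1) = (real N + 1) * real N * fact (N - 1)"
      using elim by (cases N) (auto simp: algebra_simps)
    have s: "Gamma_series' \<nu> N / Gamma \<nu> = fact (N - 1) * real N powr \<nu> / Gamma (\<nu> + real N)"
      using elim G unfolding Gamma_series'_def pochhammer_Gamma[OF nz]
      by (simp add: powr_def mult.commute)
    show ?case
      unfolding s p2 f1 using GN \<nu> by (simp add: field_simps)
  qed
  ultimately have "(\<lambda>N. real N powr \<nu> * (fact (N + 1) / Gamma (\<nu> + real (N + 1) + 1))) \<longlonglongrightarrow> (Gamma \<nu> / Gamma \<nu>) * 1"
    by (rule Lim_transform_eventually)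
  then show ?thesis using G by simp
qed

theorem theorem3:
  fixes \<nu> :: real and m :: nat
  assumes "\<nu> > 0"
  shows "(\<exists>c :: nat \<Rightarrow> real. (\<forall>N. c N > 0) \<and> c \<longlonglongrightarrow> 1 \<and>
            (\<forall>N lam u. 1 \<le> N \<longrightarrow> m \<le> N + 1 \<longrightarrow> lam > 0 \<longrightarrow> u \<in> A_space m \<nu> lam \<longrightarrow>
               wnorm (- \<nu>) (\<lambda>x. proj N \<nu> lam u x - u x)
                 \<le> c N * (2 * lam * real N) powr (- (\<nu> + real m) / 2)
                     * wnorm (real m) (tempered_deriv (\<nu> + real m) lam u)))
       \<and> (\<forall>k\<le>m. \<exists>c :: nat \<Rightarrow> real. (\<forall>N. c N > 0) \<and> c \<longlonglongrightarrow> 1 \<and>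
            (\<forall>N lam u. 1 \<le> N \<longrightarrow> m \<le> N + 1 \<longrightarrow> lam > 0 \<longrightarrow> u \<in> A_space m \<nu> lam \<longrightarrow>
               (\<lambda>x. proj N \<nu> lam u x - u x) \<in> A_space k \<nu> lam \<and>
               wnorm (real k) (tempered_deriv (\<nu> + real k) lam (\<lambda>x. proj N \<nu> lam u x - u x))
                 \<le> c N * (2 * lam * real N) powr ((real k - real m) / 2)
                     * wnorm (real m) (tempered_deriv (\<nu> + real m) lam u)))"
proof -
  \<comment> \<open>The two factors of the error bounds after division by the stated power of \<open>2\<lambda>N\<close>; both tend to \<open>1\<close>.\<close>
  define D where "D = (\<lambda>k N. \<Prod>i=k..<m. real N / real (N + 1 - i))"
  define g where "g = (\<lambda>N. real N powr \<nu> * (fact (N + 1) / Gamma (\<nu> + real (N + 1) + 1)))"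
  \<comment> \<open>The constants below are the square roots from the error bounds where these apply, and \<open>1\<close> at the finitely many other \<open>N\<close>.\<close>
  define adm where "adm = (\<lambda>N. 1 \<le> N \<and> m \<le> N + 1)"
  have adm: "eventually adm sequentially"
    unfolding adm_def using eventually_ge_at_top[of "max 1 m"] by eventually_elim auto
  have Dpos: "D k N > 0" if "adm N" for k N
    unfolding D_def using that by (intro prod_pos) (auto simp: adm_def)
  have gpos: "g N > 0" if "adm N" for N
    unfolding g_def using that assms Gamma_real_pos[of "\<nu> + real (N + 1) + 1"] by (auto simp: adm_def)
  have prod_eq: "(\<Prod>i=k..<m. 1 / (2 * lam * real (N + 1 - i))) = D k N * (2 * lam * real N) powr (real k - real m)"
    if "k \<le> m" "adm N" "lam > 0" for k N and lam :: real
  proof -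
    have pos: "2 * lam * real N > 0" using that by (simp add: adm_def)
    have "(\<Prod>i=k..<m. 1 / (2 * lam * real (N + 1 - i))) = (\<Prod>i=k..<m. (real N / real (N + 1 - i)) * (1 / (2 * lam * real N)))"
      using that by (intro prod.cong) (auto simp: adm_def)
    also have "\<dots> = D k N * (1 / (2 * lam * real N)) ^ (m - k)"
      unfolding D_def by (simp only: prod.distrib prod_constant card_atLeastLessThan)
    also have "(1 / (2 * lam * real N)) ^ (m - k) = (2 * lam * real N) powr (- real (m - k))"

    proof -
      have "(1 / x) ^ n = x powr (- real n)" if "x > 0" for x :: real and n
        using that by (simp add: powr_minus powr_realpow power_one_over inverse_eq_divide)
      then show ?thesis using pos by blast
    qed
    also have "- real (m - k) = real k - real m" using that by (simp add: of_nat_diff)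
    finally show ?thesis .
  qed
  have sqrt_powr: "sqrt (x powr y) = x powr (y / 2)" if "x > 0" for x y :: real
    using that by (simp add: powr_half_sqrt[symmetric] powr_powr)
  define c1 where "c1 = (\<lambda>N. if adm N then sqrt (g N * D 0 N) else 1)"
  define c2 where "c2 = (\<lambda>k N. if adm N then sqrt (D k N) else 1)"
  show ?thesis
  proof (intro conjI allI impI exI)
    show "c1 N > 0" for N unfolding c1_def using gpos Dpos by simp
    have "(\<lambda>N. sqrt (g N * D 0 N)) \<longlonglongrightarrow> sqrt (1 * 1)"
      unfolding g_def D_def by (intro tendsto_intros Gamma_ratio_tendsto assms factor_ratio_tendsto)
    then have "(\<lambda>N. sqrt (g N * D 0 N)) \<longlonglongrightarrow> 1" by simp
    then show "c1 \<longlonglongrightarrow> 1"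
      by (rule Lim_transform_eventually) (use adm in \<open>auto elim!: eventually_mono simp: c1_def\<close>)
    fix N lam and u :: "real \<Rightarrow> complex"
    assume H: "1 \<le> N" "m \<le> N + 1" "lam > 0" "u \<in> A_space m \<nu> lam"
    have a: "adm N" using H by (simp add: adm_def)
    have pos: "2 * lam * real N > 0" using H by simp
    have "(2 * lam) powr - \<nu> * (fact (N + 1) / Gamma (\<nu> + real (N + 1) + 1)) = g N * (2 * lam * real N) powr - \<nu>"
    proof -
      have "(2 * lam * real N) powr - \<nu> = (2 * lam) powr - \<nu> * real N powr - \<nu>" using H by (simp add: powr_mult)
      moreover have "real N powr \<nu> * real N powr - \<nu> = 1" using H by (simp flip: powr_add)
      ultimately show ?thesis unfolding g_def by (simp add: mult_ac)
    qed
    then have "(2 * lam) powr - \<nu> * (fact (N + 1) / Gamma (\<nu> + real (N + 1) + 1)) * (\<Prod>i=0..<m. 1 / (2 * lam * real (N + 1 - i)))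
        = (g N * D 0 N) * ((2 * lam * real N) powr - \<nu> * (2 * lam * real N) powr (real 0 - real m))"
      using prod_eq[of 0 N lam] a H by (simp add: mult_ac)
    also have "(2 * lam * real N) powr - \<nu> * (2 * lam * real N) powr (real 0 - real m) = (2 * lam * real N) powr (- (\<nu> + real m))"
      by (simp flip: powr_add)
    finally have "sqrt ((2 * lam) powr - \<nu> * (fact (N + 1) / Gamma (\<nu> + real (N + 1) + 1)) * (\<Prod>i=0..<m. 1 / (2 * lam * real (N + 1 - i))))
        = c1 N * (2 * lam * real N) powr (- (\<nu> + real m) / 2)"
      using a by (simp only: real_sqrt_mult sqrt_powr[OF pos] c1_def if_True)
    then show "wnorm (- \<nu>) (\<lambda>x. proj N \<nu> lam u x - u x)
                 \<le> c1 N * (2 * lam * real N) powr (- (\<nu> + real m) / 2) * wnorm (real m) (tempered_deriv (\<nu> + real m) lam u)"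
      using projection_error_bounds(1)[OF assms H(3,2,4)] by simp
  next
    fix k assume k: "k \<le> m"
    show "c2 k N > 0" for N unfolding c2_def using Dpos by simp
    have "(\<lambda>N. sqrt (D k N)) \<longlonglongrightarrow> sqrt 1"
      unfolding D_def by (intro tendsto_intros factor_ratio_tendsto)
    then have "(\<lambda>N. sqrt (D k N)) \<longlonglongrightarrow> 1" by simp
    then show "c2 k \<longlonglongrightarrow> 1"
      by (rule Lim_transform_eventually) (use adm in \<open>auto elim!: eventually_mono simp: c2_def\<close>)
    fix N lam and u :: "real \<Rightarrow> complex"
    assume H: "1 \<le> N" "m \<le> N + 1" "lam > 0" "u \<in> A_space m \<nu> lam"
    have a: "adm N" using H by (simp add: adm_def)
    have pos: "2 * lam * real N > 0" using H by simp
    show "(\<lambda>x. proj N \<nu> lam u x - u x) \<in> A_space k \<nu> lam"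
      by (rule projection_error_bounds(2)[OF assms H(3,2,4) k])
    have "sqrt (\<Prod>i=k..<m. 1 / (2 * lam * real (N + 1 - i))) = c2 k N * (2 * lam * real N) powr ((real k - real m) / 2)"
      using a by (simp only: prod_eq[OF k a H(3)] real_sqrt_mult sqrt_powr[OF pos] c2_def if_True)
    then show "wnorm (real k) (tempered_deriv (\<nu> + real k) lam (\<lambda>x. proj N \<nu> lam u x - u x))
                 \<le> c2 k N * (2 * lam * real N) powr ((real k - real m) / 2) * wnorm (real m) (tempered_deriv (\<nu> + real m) lam u)"
      using projection_error_bounds(3)[OF assms H(3,2,4) k] by simp
  qed
qed

end
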